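(* Let $\mathbb{X}=\{1,2,3,\dots\}$, let $f:\mathbb{X}\to[0,\infty)$ be a non-negative function with envelope family $\Lambda_f=\{\mu\in\mathcal{P}(\mathbb{X}):\mu(x)\le f(x)\ \forall x\in\mathbb{X}\}$, and let $\rho:\mathbb{X}\times\mathbb{X}\to[0,\infty)$ be an unbounded distortion function that is consistent with respect to the Euclidean norm. (i) If $f\notin\ell_1(\mathbb{X})$, then for any $d>0$ and any $D$-semifaithful coding scheme $\{\xi_n,n\ge1\}$ operating at distortion $d$, $$\sup_{\mu\in\Lambda_f}\left[R(\xi_n,\mu^n)-\mathcal{R}_n(d,\mu^n)\right]=\infty\qquad\text{for all } n\ge1.$$ (ii) If $f\in\ell_1(\mathbb{X})$, then for any $d>0$ there exists a $D$-semifaithful coding scheme $\{\xi_n,n\ge1\}$ operating at distortion $d$ (with respect to $\{\rho_n,n\ge1\}$) such that $$\lim_{n\to\infty}\left[R(\xi_n,\mu^n)-\mathcal{R}_n(d,\mu^n)\right]=0\qquad\text{for every }\mu\in\Lambda_f\cap\mathcal{H}(\mathbb{X}).$$ (iii) The condition $\sup_{\mu\in\Lambda_f}H(\mu)<\infty$ is equivalent to $\Lambda_f\subset\mathcal{H}(\mathbb{X})$, and if it holds, then for any $d>0$ the scheme in (ii) can be taken so that in addition $$\lim_{n\to\infty}\sup_{\mu\in\Lambda_f}\left[R(\xi_n,\mu^n)-\mathcal{R}_n(d,\mu^n)\right]=0.$$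
   Context: $\mathcal{P}(S)$ is the set of probability measures on a countable set $S$; $\log$ is base $2$; $\mu(x)$ denotes the probability mass function; $\mu^n$ is the $n$-fold product of $\mu\in\mathcal{P}(\mathbb{X})$; $H(\mu)=-\sum_x\mu(x)\log\mu(x)$ is the Shannon entropy; $\mathcal{H}(\mathbb{X})=\{\mu\in\mathcal{P}(\mathbb{X}):H(\mu)<\infty\}$. Distortions $\rho$ satisfy $\rho(x,x)=0$ and $\rho(x,\bar x)>0$ for $x\ne\bar x$, and $\rho_n(x^n,\bar x^n)=\frac1n\sum_{i=1}^n\rho(x_i,\bar x_i)$. An unbounded distortion $\rho$ is consistent with respect to the Euclidean norm if for any $K>0$ there exists $\epsilon>0$ such that for all $i,j\in\mathbb{X}$, $|i-j|\ge\epsilon$ implies $\rho(i,j)\ge K$. $D$-semifaithful code of length $n$ operating at distortion $d$: a triplet $\xi_n=(\phi_n,\mathcal{C}_n,\mathcal{D}_n)$, where $\phi_n:\mathbb{X}^n\to\mathcal{B}_n\subset\mathbb{X}^n$ is a quantizer with range $\mathcal{B}_n=\phi_n(\mathbb{X}^n)$ such that $\rho_n(x^n,\phi_n(x^n))\le d$ for every $x^n\in\mathbb{X}^n$ and $y^n\in\phi_n^{-1}(\{y^n\})$ for every $y^n\in\mathcal{B}_n$; $\mathcal{C}_n:\mathcal{B}_n\to\{0,1\}^*=\bigcup_{k\ge1}\{0,1\}^k$ is a prefix-free variable-length binary encoder (so $\sum_{y\in\mathcal{B}_n}2^{-\mathcal{L}(\mathcal{C}_n(y))}\le1$, where $\mathcal{L}$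 is the length of a binary string); and $\mathcal{D}_n:\{0,1\}^*\to\mathcal{B}_n$ is the corresponding decoder. A $D$-semifaithful coding scheme operating at distortion $d$ is a sequence $\{\xi_n,n\ge1\}$ of such codes, $\xi_n$ of length $n$. Rate: $R(\xi_n,\mu^n)=\frac1n\mathbb{E}_{X^n\sim\mu^n}\{\mathcal{L}(\mathcal{C}_n(\phi_n(X^n)))\}$. For a partition $\pi$ of $\mathbb{X}^n$ and $\mu\in\mathcal{P}(\mathbb{X}^n)$, $H_{\sigma(\pi)}(\mu)=-\sum_{A\in\pi}\mu(A)\log\mu(A)$. $\mathcal{Q}_n(d)$ is the collection of partitions $\pi$ of $\mathbb{X}^n$ such that for every $A\in\pi$ there is $y^n\in A$ with $\sup_{x^n\in A}\rho_n(x^n,y^n)\le d$. Define $\mathcal{R}_n(d,\mu^n)=\inf_{\pi\in\mathcal{Q}_n(d)}\frac1nH_{\sigma(\pi)}(\mu^n)$. Suprema of differences $R(\xi_n,\mu^n)-\mathcal{R}_n(d,\mu^n)$ are over those $\mu$ for which the difference is well defined (not $\infty-\infty$). *)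

theory Defs
  imports "HOL-Probability.Probability" "HOL-Library.Sublist"
begin

abbreviation alphabet :: "nat set" where
  "alphabet \<equiv> {1..}"

definition words :: "nat \<Rightarrow> nat list set" where
  "words n = {xs. length xs = n \<and> set xs \<subseteq> alphabet}"


subsection \<open>Distortions\<close>

definition distortion :: "(nat \<Rightarrow> nat \<Rightarrow> real) \<Rightarrow> bool" where
  "distortion \<rho> \<longleftrightarrow> (\<forall>x\<in>alphabet. \<forall>y\<in>alphabet.
     \<rho> x y \<ge> 0 \<and> \<rho> x x = 0 \<and> (x \<noteq> y \<longrightarrow> \<rho> x y > 0))"

definition unbounded_distortion :: "(nat \<Rightarrow> nat \<Rightarrow> real) \<Rightarrow> bool" where
  "unbounded_distortion \<rho> \<longleftrightarrow> (\<forall>K. \<exists>i\<in>alphabet. \<exists>j\<in>alphabet. \<rho> i j > K)"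

definition euclidean_consistent :: "(nat \<Rightarrow> nat \<Rightarrow> real) \<Rightarrow> bool" where
  "euclidean_consistent \<rho> \<longleftrightarrow> (\<forall>K>0. \<exists>\<epsilon>>0. \<forall>i\<in>alphabet. \<forall>j\<in>alphabet.
     \<bar>real i - real j\<bar> \<ge> \<epsilon> \<longrightarrow> \<rho> i j \<ge> K)"

definition word_distortion :: "(nat \<Rightarrow> nat \<Rightarrow> real) \<Rightarrow> nat \<Rightarrow> nat list \<Rightarrow> nat list \<Rightarrow> real" where
  "word_distortion \<rho> n xs ys = (\<Sum>i<n. \<rho> (xs ! i) (ys ! i)) / real n"


subsection \<open>Entropies\<close>

text \<open>Entropies take values in \<open>[0,\<infinity>]\<close>. All summands below are nonnegative, so \<open>ennreal\<close>
  does not truncate, and \<open>0 * log 2 0 = 0\<close>.\<close>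

definition shannon_entropy :: "'a pmf \<Rightarrow> ennreal" where
  "shannon_entropy \<mu> =
     (\<integral>\<^sup>+ x. ennreal (- (pmf \<mu> x * log 2 (pmf \<mu> x))) \<partial>count_space UNIV)"

definition partition_entropy :: "'a set set \<Rightarrow> 'a pmf \<Rightarrow> ennreal" where
  "partition_entropy \<pi> \<mu> =
     (\<integral>\<^sup>+ A. ennreal (- (measure_pmf.prob \<mu> A * log 2 (measure_pmf.prob \<mu> A))) \<partial>count_space \<pi>)"

definition finite_entropy_sources :: "nat pmf set" where
  "finite_entropy_sources = {\<mu>. set_pmf \<mu> \<subseteq> alphabet \<and> shannon_entropy \<mu> < \<infinity>}"

definition envelope_family :: "(nat \<Rightarrow> real) \<Rightarrow> nat pmf set" where
  "envelope_family f = {\<mu>. set_pmf \<mu> \<subseteq> alphabet \<and> (\<forall>x\<in>alphabet. pmf \<mu> x \<le> f x)}"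


subsection \<open>D-semifaithful codes\<close>

record dsf_code =
  quantizer :: "nat list \<Rightarrow> nat list"
  encoder :: "nat list \<Rightarrow> bool list"
  decoder :: "bool list \<Rightarrow> nat list"

definition codebook :: "nat \<Rightarrow> dsf_code \<Rightarrow> nat list set" where
  "codebook n \<xi> = quantizer \<xi> ` words n"

text \<open>Binary strings are nonempty; the quantizer, encoder and decoder are only relevant on
  \<^term>\<open>words n\<close>, on the codebook and on nonempty strings, respectively.\<close>

definition semifaithful_code :: "(nat \<Rightarrow> nat \<Rightarrow> real) \<Rightarrow> real \<Rightarrow> nat \<Rightarrow> dsf_code \<Rightarrow> bool" where
  "semifaithful_code \<rho> d n \<xi> \<longleftrightarrow>
     codebook n \<xi> \<subseteq> words n \<and>
     (\<forall>x\<in>words n. word_distortion \<rho> n x (quantizer \<xi> x) \<le> d) \<and>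
     (\<forall>y\<in>codebook n \<xi>. quantizer \<xi> y = y) \<and>
     (\<forall>y\<in>codebook n \<xi>. encoder \<xi> y \<noteq> []) \<and>
     (\<forall>y\<in>codebook n \<xi>. \<forall>z\<in>codebook n \<xi>. y \<noteq> z \<longrightarrow> \<not> prefix (encoder \<xi> y) (encoder \<xi> z)) \<and>
     (\<forall>w. w \<noteq> [] \<longrightarrow> decoder \<xi> w \<in> codebook n \<xi>) \<and>
     (\<forall>y\<in>codebook n \<xi>. decoder \<xi> (encoder \<xi> y) = y)"

definition semifaithful_scheme :: "(nat \<Rightarrow> nat \<Rightarrow> real) \<Rightarrow> real \<Rightarrow> (nat \<Rightarrow> dsf_code) \<Rightarrow> bool" where
  "semifaithful_scheme \<rho> d \<xi> \<longleftrightarrow> (\<forall>n\<ge>1. semifaithful_code \<rho> d n (\<xi> n))"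


subsection \<open>Rates and redundancy\<close>

definition rate :: "nat \<Rightarrow> dsf_code \<Rightarrow> nat list pmf \<Rightarrow> ennreal" where
  "rate n \<xi> P = (\<integral>\<^sup>+ x. of_nat (length (encoder \<xi> (quantizer \<xi> x))) \<partial>measure_pmf P) / of_nat n"

definition admissible_partitions :: "(nat \<Rightarrow> nat \<Rightarrow> real) \<Rightarrow> real \<Rightarrow> nat \<Rightarrow> nat list set set set" where
  "admissible_partitions \<rho> d n = {\<pi>. partition_on (words n) \<pi> \<and>
     (\<forall>A\<in>\<pi>. \<exists>y\<in>A. (SUP x\<in>A. ereal (word_distortion \<rho> n x y)) \<le> ereal d)}"

definition optimal_rate :: "(nat \<Rightarrow> nat \<Rightarrow> real) \<Rightarrow> real \<Rightarrow> nat \<Rightarrow> nat list pmf \<Rightarrow> ennreal" where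
  "optimal_rate \<rho> d n P = (INF \<pi>\<in>admissible_partitions \<rho> d n. partition_entropy \<pi> P / of_nat n)"

definition redundancy ::
  "(nat \<Rightarrow> nat \<Rightarrow> real) \<Rightarrow> real \<Rightarrow> nat \<Rightarrow> dsf_code \<Rightarrow> nat pmf \<Rightarrow> ereal" where
  "redundancy \<rho> d n \<xi> \<mu> =
     enn2ereal (rate n \<xi> (replicate_pmf n \<mu>)) - enn2ereal (optimal_rate \<rho> d n (replicate_pmf n \<mu>))"

text \<open>The supremum ranges over the sources for which the difference is not \<open>\<infinity> - \<infinity>\<close>.
  If there are none, it is \<open>0\<close>, the supremum of the empty subset of \<open>[0,\<infinity>]\<close>, rather than the
  value \<open>-\<infinity>\<close> that \<^typ>\<open>ereal\<close> assigns to it (an envelope family is empty if \<open>f\<close> sums to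
  less than \<open>1\<close>).\<close>

definition worst_redundancy ::
  "(nat \<Rightarrow> nat \<Rightarrow> real) \<Rightarrow> real \<Rightarrow> nat \<Rightarrow> dsf_code \<Rightarrow> nat pmf set \<Rightarrow> ereal" where
  "worst_redundancy \<rho> d n \<xi> \<Lambda> =
     (let M = {\<mu>\<in>\<Lambda>. \<not> (rate n \<xi> (replicate_pmf n \<mu>) = \<infinity> \<and>
                        optimal_rate \<rho> d n (replicate_pmf n \<mu>) = \<infinity>)}
      in if M = {} then 0 else (SUP \<mu>\<in>M. redundancy \<rho> d n \<xi> \<mu>))"

end

theory Submission
  imports Defs "HOL-Real_Asymp.Real_Asymp"
begin

text \<open>
  The redundancy is nonnegative because the cells of a quantizer form an admissible partition, whose
  entropy is at most the expected length of a prefix code.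

  If \<open>f\<close> is not summable, consistency of the distortion bounds the number of words sharing a codeword,
  so the sum of \<open>2\<close> to the minus codeword length over all words is finite. Sources in the envelope
  family that are supported far out then see arbitrarily small total weight, hence redundancy at least
  the logarithm of its inverse.

  If \<open>f\<close> is summable, the letters above \<open>K\<close> are transmitted exactly, with a code adapted to \<open>f\<close>, and so are the
  counts of the letters up to \<open>K\<close>. Given these data every memoryless source is uniform on a finite class of
  words, for which a nearly optimal code can be chosen without knowing the source; averaging over the
  classes, no partition can be better. The quantizers of different classes conflict with each other: a codeword
  of one class has to be a fixed point even if it lies in another class. Therefore each codeword is
  marked by overwriting its first letters with \<open>1,2,1,2,\<dots>\<close>, and every word starting with the mark (an
  improbable event for any source) is its own codeword. The extra distortion is compensated by
  transmitting a small fraction of the positions, chosen to carry at least its share of the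
  distortion, exactly. Finally \<open>K\<close> and the length of the mark tend to infinity slowly.
\<close>


subsection \<open>Prefix codes\<close>

text \<open>The code can match the optimum without knowing the source because both sides are
  compared class by class. On a class the source is uniform, so a good code minimises an unweighted
  sum of code lengths. The competitors in this minimisation need not be idempotent quantizers with
  integer code lengths; therefore every admissible partition, coded with the true distribution of
  its cell centres, is among them. The quantizer conflict is repaired only afterwards, by the mark.

  The parameters are governed by one number j: the mark has 2j letters, K is chosen after j so that
  letters above K are rare for the whole family, then the fraction 1/r of exactly transmitted
  positions with r about j log K, and finally n is taken large. The resulting bound depends on j
  alone and vanishes as j grows, so j may follow n. The source enters this bound only through the
  tail and the total of its cross entropy relative to a distribution built from f. Convergence for
  one source uses its own tail; uniform convergence uses the tail with the masses replaced by
  f.\<close>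

lemma kraft_finite:
  assumes fin: "finite S" and pf: "\<And>b c. b \<in> S \<Longrightarrow> c \<in> S \<Longrightarrow> b \<noteq> c \<Longrightarrow> \<not> prefix b c"
  shows "(\<Sum>b\<in>S. (1/2) ^ length (b :: bool list)) \<le> (1::real)"
proof -
  define N where "N = (\<Sum>b\<in>S. length b)"
  have len: "length b \<le> N" if "b \<in> S" for b
    unfolding N_def using fin that by (rule member_le_sum[rotated 2]) auto
  \<comment> \<open>Incomparable strings have no common extension, so the sets of all extensions to
    one length \<open>N\<close> are disjoint, and counting them gives the inequality.\<close>
  define ext where "ext b = {w. length w = N \<and> prefix b w}" for b :: "bool list"
  have ext: "ext b = append b ` {c. set c \<subseteq> UNIV \<and> length c = N - length b}" if "b \<in> S" for b
    using len[OF that] by (auto simp: ext_def prefix_def image_iff)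
  have cext: "real (card (ext b)) = 2 ^ N * (1/2) ^ length b" if "b \<in> S" for b
  proof -
    have "card (ext b) = 2 ^ (N - length b)"
      unfolding ext[OF that] using card_lists_length_eq[of "UNIV::bool set" "N - length b"]
      by (subst card_image) (auto intro: inj_onI)
    moreover from len[OF that] obtain k where "N = length b + k" using le_Suc_ex by blast
    ultimately show ?thesis by (simp add: power_add power_one_over)
  qed
  have disj: "ext b \<inter> ext c = {}" if "b \<in> S" "c \<in> S" "b \<noteq> c" for b c
    using pf[OF that] pf[of c b] that by (auto simp: ext_def dest: prefix_same_cases)
  have fe: "finite {w :: bool list. length w = N}"
    using finite_lists_length_eq[of "UNIV::bool set" N] by simp
  have "2 ^ N * (\<Sum>b\<in>S. (1/2) ^ length b) = (\<Sum>b\<in>S. real (card (ext b)))"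
    by (simp add: cext sum_distrib_left)
  also have "\<dots> = real (card (\<Union>b\<in>S. ext b))"
    using fin disj by (subst card_UN_disjoint) (auto intro!: finite_subset[OF _ fe] simp: ext_def)
  also have "\<dots> \<le> real (card {w :: bool list. length w = N})"
    by (intro of_nat_mono card_mono[OF fe]) (auto simp: ext_def)
  also have "\<dots> = 2 ^ N"
    using card_lists_length_eq[of "UNIV::bool set" N] by simp
  finally show ?thesis by simp
qed

text \<open>Carries Kraft's inequality from finite to infinite codebooks; enumerating
  \<open>A\<close> turns the integral into a series.\<close>

lemma nn_integral_count_space_le_finite:
  fixes h :: "'a \<Rightarrow> ennreal"
  assumes "countable A" and le: "\<And>F. finite F \<Longrightarrow> F \<subseteq> A \<Longrightarrow> sum h F \<le> c"
  shows "(\<integral>\<^sup>+x. h x \<partial>count_space A) \<le> c"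
proof (cases "finite A")
  case True
  then show ?thesis using le[of A] by (simp add: nn_integral_count_space_finite)
next
  case False
  define g where "g = from_nat_into A"
  have g: "bij_betw g UNIV A"
    unfolding g_def using assms(1) False by (rule bij_betw_from_nat_into)
  have "(\<integral>\<^sup>+x. h x \<partial>count_space A) = (\<Sum>i. h (g i))"
    by (subst nn_integral_bij_count_space[OF g, symmetric]) (rule nn_integral_count_space_nat)
  also have "\<dots> \<le> c"
  proof (rule suminf_le_const)
    fix N
    have "sum (\<lambda>i. h (g i)) {..<N} = sum h (g ` {..<N})"
      using g by (subst sum.reindex) (auto simp: bij_betw_def intro: inj_on_subset)
    also have "\<dots> \<le> c" using g by (intro le) (auto simp: bij_betw_def)
    finally show "sum (\<lambda>i. h (g i)) {..<N} \<le> c" .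
  qed auto
  finally show ?thesis .
qed

lemma kraft:
  fixes enc :: "'a::countable \<Rightarrow> bool list"
  assumes pf: "\<And>y z. y \<in> B \<Longrightarrow> z \<in> B \<Longrightarrow> y \<noteq> z \<Longrightarrow> \<not> prefix (enc y) (enc z)"
  shows "(\<integral>\<^sup>+y. ennreal ((1/2) ^ length (enc y)) \<partial>count_space B) \<le> 1"
proof (rule nn_integral_count_space_le_finite)
  fix F assume F: "finite F" "F \<subseteq> B"
  have inj: "inj_on enc F"
    using F pf by (intro inj_onI) (metis prefix_order.order_refl subsetD)
  have "(\<Sum>b\<in>enc ` F. (1/2) ^ length b) \<le> (1::real)"
    using F pf by (intro kraft_finite) auto
  then have "(\<Sum>y\<in>F. (1/2) ^ length (enc y)) \<le> (1::real)"
    by (subst (asm) sum.reindex[OF inj]) simp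
  then show "(\<Sum>y\<in>F. ennreal ((1/2) ^ length (enc y))) \<le> 1"
    by (subst sum_ennreal) (auto simp: ennreal_le_1)
qed auto

text \<open>The binary fraction 0.b1b2... of a string. All extensions of \<open>bs\<close> have
  values in the half-open interval of length \<open>1 / 2 ^ length bs\<close> starting at
  \<open>dyadic bs\<close>, so prefix-freeness becomes a question about intervals.\<close>

primrec dyadic :: "bool list \<Rightarrow> real" where
  "dyadic [] = 0"
| "dyadic (b # bs) = (of_bool b + dyadic bs) / 2"

lemma dyadic_nonneg: "0 \<le> dyadic bs"
  by (induction bs) auto

lemma dyadic_less_1: "dyadic bs < 1"
proof (induction bs)
  case (Cons b bs)
  then show ?case by (cases b) auto
qed auto

lemma dyadic_append: "dyadic (bs @ cs) = dyadic bs + dyadic cs / 2 ^ length bs"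
  by (induction bs) (auto simp: field_simps)

lemma dyadic_approx:
  assumes "0 \<le> x" "x < 1"
  shows "\<exists>bs. length bs = k \<and> dyadic bs \<le> x \<and> x < dyadic bs + 1 / 2 ^ k"
  using assms
proof (induction k arbitrary: x)
  case (Suc k)
  define b where "b \<longleftrightarrow> x \<ge> 1/2"
  have "0 \<le> 2 * x - of_bool b" "2 * x - of_bool b < 1"
    using Suc.prems by (auto simp: b_def)
  from Suc.IH[OF this] obtain bs where "length bs = k" "dyadic bs \<le> 2 * x - of_bool b"
    "2 * x - of_bool b < dyadic bs + 1 / 2 ^ k" by blast
  then show ?case by (intro exI[of _ "b # bs"]) (auto simp: field_simps)
qed auto

text \<open>Shannon--Fano--Elias coding: the interval of length \<open>pmf Q y\<close> belonging to \<open>y\<close> contains a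
  dyadic interval of at least a quarter of its length.\<close>

lemma prefix_code_of_pmf:
  fixes Q :: "'a::countable pmf"
  obtains enc :: "'a \<Rightarrow> bool list" where
    "\<And>y. y \<in> set_pmf Q \<Longrightarrow> enc y \<noteq> []"
    "\<And>y. y \<in> set_pmf Q \<Longrightarrow> real (length (enc y)) \<le> 2 - log 2 (pmf Q y)"
    "\<And>y z. y \<in> set_pmf Q \<Longrightarrow> z \<in> set_pmf Q \<Longrightarrow> y \<noteq> z \<Longrightarrow> \<not> prefix (enc y) (enc z)"
proof -
  \<comment> \<open>The cumulative distribution for the order by \<open>to_nat\<close>; the
    intervals from \<open>F y\<close> to \<open>F y + pmf Q y\<close> do not overlap.\<close>
  define F where "F y = measure_pmf.prob Q {z. to_nat z < to_nat y}" for y :: 'a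
  have F_le: "F y + pmf Q y \<le> F z" if "to_nat y < to_nat z" for y z
  proof -
    have "F y + pmf Q y = measure_pmf.prob Q ({z. to_nat z < to_nat y} \<union> {y})"
      unfolding F_def by (subst measure_pmf.finite_measure_Union) (auto simp: measure_pmf_single)
    also have "\<dots> \<le> F z"
      unfolding F_def using that by (intro measure_pmf.finite_measure_mono) auto
    finally show ?thesis .
  qed
  have F_1: "F y + pmf Q y \<le> 1" for y
  proof -
    have "F y + pmf Q y = measure_pmf.prob Q ({z. to_nat z < to_nat y} \<union> {y})"
      unfolding F_def by (subst measure_pmf.finite_measure_Union) (auto simp: measure_pmf_single)
    then show ?thesis by simp
  qed
  \<comment> \<open>The summand 1 makes \<open>1 / 2 ^ k y\<close> at most half of
    \<open>pmf Q y\<close>, so the dyadic interval containing the midpoint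
    \<open>F y + pmf Q y / 2\<close> stays inside the interval of \<open>y\<close>.\<close>
  define k where "k y = nat \<lceil>1 - log 2 (pmf Q y)\<rceil>" for y
  have ex: "\<exists>bs. length bs = k y \<and> F y < dyadic bs \<and> dyadic bs + 1 / 2 ^ k y \<le> F y + pmf Q y
      \<and> bs \<noteq> [] \<and> real (length bs) \<le> 2 - log 2 (pmf Q y)" if "y \<in> set_pmf Q" for y
  proof -
    have p: "0 < pmf Q y" "pmf Q y \<le> 1" using that by (auto simp: pmf_positive pmf_le_1)
    then have lg: "log 2 (pmf Q y) \<le> 0" by simp
    have k: "1 - log 2 (pmf Q y) \<le> real (k y)" "real (k y) \<le> 2 - log 2 (pmf Q y)" "k y \<ge> 1"
      using lg unfolding k_def by linarith+
    have "1 / 2 ^ k y = 2 powr (- real (k y))" by (simp add: powr_minus powr_realpow field_simps)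
    also have "\<dots> \<le> 2 powr (log 2 (pmf Q y) - 1)" using k by (intro powr_mono) auto
    also have "\<dots> = pmf Q y / 2" using p by (simp add: powr_diff)
    finally have kp: "1 / 2 ^ k y \<le> pmf Q y / 2" .
    have "0 \<le> F y + pmf Q y / 2" "F y + pmf Q y / 2 < 1"
      using p F_1[of y] by (auto simp: F_def add_nonneg_nonneg)
    from dyadic_approx[OF this, of "k y"] obtain bs where "length bs = k y"
      "dyadic bs \<le> F y + pmf Q y / 2" "F y + pmf Q y / 2 < dyadic bs + 1 / 2 ^ k y" by blast
    with kp k show ?thesis by (intro exI[of _ bs]) auto
  qed
  then obtain enc where enc: "\<And>y. y \<in> set_pmf Q \<Longrightarrow> length (enc y) = k y \<and> F y < dyadic (enc y) \<and>
      dyadic (enc y) + 1 / 2 ^ k y \<le> F y + pmf Q y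
      \<and> enc y \<noteq> [] \<and> real (length (enc y)) \<le> 2 - log 2 (pmf Q y)"
    by metis
  have "\<not> prefix (enc y) (enc z)" if yz: "y \<in> set_pmf Q" "z \<in> set_pmf Q" "y \<noteq> z" for y z
  proof
    assume "prefix (enc y) (enc z)"
    then obtain cs where cs: "enc z = enc y @ cs" by (auto simp: prefix_def)
    \<comment> \<open>An extension of \<open>enc y\<close> has its value in the dyadic interval of
      \<open>enc y\<close>, hence in the interval of \<open>y\<close>, whereas
      \<open>dyadic (enc z)\<close> lies strictly inside that of \<open>z\<close>.\<close>
    have le: "dyadic (enc y) \<le> dyadic (enc z)" "dyadic (enc z) < dyadic (enc y) + 1 / 2 ^ k y"
      using dyadic_nonneg[of cs] dyadic_less_1[of cs] enc[OF yz(1)]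
      by (auto simp: cs dyadic_append divide_strict_right_mono)
    have pos: "(0::real) < 1 / 2 ^ k z" by simp
    consider "to_nat y < to_nat z" | "to_nat z < to_nat y"
      using yz(3) by (meson nat_neq_iff to_nat_split)
    then show False
    proof cases
      case 1
      show False using F_le[OF 1] enc[OF yz(1)] enc[OF yz(2)] le by linarith
    next
      case 2
      show False using F_le[OF 2] enc[OF yz(1)] enc[OF yz(2)] le pos by linarith
    qed
  qed
  with enc that show thesis by blast
qed

subsection \<open>Entropy as a lower bound for the rate\<close>

text \<open>This is \<open>ln u \<le> u - 1\<close> at \<open>u = t / (s * p)\<close>. Summed over a
  probability distribution \<open>p\<close> and weights \<open>t\<close> of total at most
  \<open>s\<close>, the terms with \<open>1 / ln 2\<close> cancel, and the entropy plus
  \<open>log 2 (1 / s)\<close> is at most the sum of \<open>p * - log 2 t\<close>.\<close>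

lemma gibbs_pointwise:
  fixes p t s :: real
  assumes "0 \<le> p" "0 < t" "0 < s"
  shows "- (p * log 2 p) + p * log 2 (t / s) + p / ln 2 \<le> t / (s * ln 2)"
proof (cases "p = 0")
  case False
  with assms have p: "p > 0" by simp
  have "ln (t / (s * p)) \<le> t / (s * p) - 1"
    using assms p by (intro ln_le_minus_one) auto
  then have "p * ln (t / (s * p)) \<le> p * (t / (s * p) - 1)"
    using p by (intro mult_left_mono) auto
  also have "\<dots> = t / s - p" using p assms by (simp add: field_simps)
  finally have "p * ln (t / (s * p)) + p \<le> t / s" by simp
  moreover have "ln (t / (s * p)) = ln (t / s) - ln p"
    using assms p by (simp add: ln_div ln_mult)
  ultimately have "p * (ln (t / s) - ln p) + p \<le> t / s" by simp
  then have "(p * (ln (t / s) - ln p) + p) / ln 2 \<le> t / s / ln 2"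
    by (intro divide_right_mono) auto
  then show ?thesis by (simp add: log_def field_simps)
qed (use assms in auto)

lemma entropy_summand_nonneg: "0 \<le> p \<Longrightarrow> p \<le> 1 \<Longrightarrow> 0 \<le> - (p * log 2 (p::real))"
  by (cases "p = 0") (auto intro: mult_nonneg_nonpos)

lemma shannon_entropy_le_length:
  fixes P :: "'a::countable pmf" and enc :: "'a \<Rightarrow> bool list"
  assumes sup: "set_pmf P \<subseteq> B"
    and pf: "\<And>y z. y \<in> B \<Longrightarrow> z \<in> B \<Longrightarrow> y \<noteq> z \<Longrightarrow> \<not> prefix (enc y) (enc z)"
  shows "shannon_entropy P \<le> (\<integral>\<^sup>+y. of_nat (length (enc y)) \<partial>measure_pmf P)"
proof -
  \<comment> \<open>Gibbs' inequality with \<open>s = 1\<close>. The terms with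
    \<open>1 / ln 2\<close> are kept on both sides, so that all summands are nonnegative; being
    finite, they cancel at the end.\<close>
  have pw: "ennreal (- (pmf P y * log 2 (pmf P y))) + ennreal (1 / ln 2) * ennreal (pmf P y)
     \<le> ennreal (pmf P y) * of_nat (length (enc y))
        + ennreal (1 / ln 2) * (ennreal ((1/2) ^ length (enc y)) * indicator B y)" for y
  proof (cases "y \<in> set_pmf P")
    case True
    have "- (pmf P y * log 2 (pmf P y)) + pmf P y * log 2 ((1/2) ^ length (enc y) / 1) + pmf P y / ln 2
      \<le> (1/2) ^ length (enc y) / (1 * ln 2)"
      by (intro gibbs_pointwise) auto
    moreover have "log 2 ((1/2) ^ length (enc y) / 1) = - real (length (enc y))"
      by (simp add: log_nat_power log_divide)
    ultimately have *: "- (pmf P y * log 2 (pmf P y)) + 1 / ln 2 * pmf P y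
      \<le> pmf P y * real (length (enc y)) + 1 / ln 2 * (1/2) ^ length (enc y)"
      by (simp add: field_simps)
    have "ennreal (- (pmf P y * log 2 (pmf P y))) + ennreal (1 / ln 2) * ennreal (pmf P y)
      = ennreal (- (pmf P y * log 2 (pmf P y)) + 1 / ln 2 * pmf P y)"
      using entropy_summand_nonneg[of "pmf P y"]
      by (subst ennreal_plus) (simp_all add: pmf_le_1 ennreal_mult'[symmetric])
    also have "\<dots> \<le> ennreal (pmf P y * real (length (enc y)) + 1 / ln 2 * (1/2) ^ length (enc y))"
      using * by (rule ennreal_leI)
    also have "\<dots> = ennreal (pmf P y) * of_nat (length (enc y))
        + ennreal (1 / ln 2) * (ennreal ((1/2) ^ length (enc y)) * indicator B y)"
      using True sup
      by (subst ennreal_plus) (auto simp: ennreal_mult'[symmetric] ennreal_of_nat_eq_real_of_nat)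
    finally show ?thesis .
  qed (simp add: set_pmf_iff)
  have "shannon_entropy P + ennreal (1 / ln 2)
    = (\<integral>\<^sup>+y. ennreal (- (pmf P y * log 2 (pmf P y))) + ennreal (1 / ln 2) * ennreal (pmf P y) \<partial>count_space UNIV)"
    by (simp add: nn_integral_add nn_integral_cmult shannon_entropy_def nn_integral_pmf)
  also have "\<dots> \<le> (\<integral>\<^sup>+y. ennreal (pmf P y) * of_nat (length (enc y))
        + ennreal (1 / ln 2) * (ennreal ((1/2) ^ length (enc y)) * indicator B y) \<partial>count_space UNIV)"
    using pw by (intro nn_integral_mono) auto
  also have "\<dots> = (\<integral>\<^sup>+y. of_nat (length (enc y)) \<partial>measure_pmf P)
      + ennreal (1 / ln 2) * (\<integral>\<^sup>+y. ennreal ((1/2) ^ length (enc y)) \<partial>count_space B)"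
    by (simp add: nn_integral_add nn_integral_cmult nn_integral_measure_pmf nn_integral_count_space_indicator[of B])
  also have "\<dots> \<le> (\<integral>\<^sup>+y. of_nat (length (enc y)) \<partial>measure_pmf P) + ennreal (1 / ln 2) * 1"
    using kraft[OF pf] by (intro add_left_mono mult_left_mono) auto
  finally have "ennreal (1 / ln 2) + shannon_entropy P
      \<le> ennreal (1 / ln 2) + (\<integral>\<^sup>+y. of_nat (length (enc y)) \<partial>measure_pmf P)"
    by (simp add: add.commute)
  then show ?thesis by (subst (asm) ennreal_add_left_cancel_le) auto
qed

lemma optimal_rate_le_entropy:
  assumes P: "set_pmf P \<subseteq> words n"
    and q_in: "\<And>x. x \<in> words n \<Longrightarrow> \<phi> x \<in> words n"
    and q_d: "\<And>x. x \<in> words n \<Longrightarrow> word_distortion \<rho> n x (\<phi> x) \<le> d"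
    and q_idem: "\<And>x. x \<in> words n \<Longrightarrow> \<phi> (\<phi> x) = \<phi> x"
  shows "optimal_rate \<rho> d n P \<le> shannon_entropy (map_pmf \<phi> P) / of_nat n"
proof -
  define fib where "fib y = {x \<in> words n. \<phi> x = y}" for y
  define \<pi> where "\<pi> = fib ` \<phi> ` words n"
  have bij: "bij_betw fib (\<phi> ` words n) \<pi>"
    unfolding \<pi>_def by (rule inj_on_imp_bij_betw, rule inj_onI) (use q_in in \<open>auto simp: fib_def\<close>)
  have part: "partition_on (words n) \<pi>"
    by (intro partition_onI) (auto simp: \<pi>_def fib_def disjnt_def)
  have "\<pi> \<in> admissible_partitions \<rho> d n"
    unfolding admissible_partitions_def
  proof (intro CollectI conjI part ballI)
    fix A assume "A \<in> \<pi>"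
    then obtain x where x: "x \<in> words n" "A = fib (\<phi> x)" by (auto simp: \<pi>_def)
    show "\<exists>y\<in>A. (SUP x\<in>A. ereal (word_distortion \<rho> n x y)) \<le> ereal d"
    \<comment> \<open>Idempotence puts the common codeword of a fibre into the fibre, where it
      serves as centre.\<close>
    proof (rule bexI[of _ "\<phi> x"])
      show "(SUP z\<in>A. ereal (word_distortion \<rho> n z (\<phi> x))) \<le> ereal d"
        unfolding x(2) by (rule SUP_least) (metis (mono_tags, lifting) q_d ereal_less_eq(3) fib_def mem_Collect_eq)
      show "\<phi> x \<in> A" using x q_in q_idem by (auto simp: fib_def)
    qed
  qed
  then have "optimal_rate \<rho> d n P \<le> partition_entropy \<pi> P / of_nat n"
    unfolding optimal_rate_def by (rule INF_lower)
  also have "partition_entropy \<pi> P \<le> shannon_entropy (map_pmf \<phi> P)"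
  proof -
    have "measure_pmf.prob P (fib y) = pmf (map_pmf \<phi> P) y" for y
      unfolding pmf_map using P
      by (intro measure_pmf.finite_measure_eq_AE) (auto simp: AE_measure_pmf_iff fib_def)
    then have "partition_entropy \<pi> P = (\<integral>\<^sup>+ y. ennreal (- (pmf (map_pmf \<phi> P) y * log 2 (pmf (map_pmf \<phi> P) y)))
        \<partial>count_space (\<phi> ` words n))"
      unfolding partition_entropy_def by (subst nn_integral_bij_count_space[OF bij, symmetric]) simp
    also have "\<dots> \<le> shannon_entropy (map_pmf \<phi> P)"
      unfolding shannon_entropy_def
      by (subst nn_integral_count_space_indicator) (auto intro!: nn_integral_mono simp: indicator_def)
    finally show ?thesis .
  qed
  finally show ?thesis by (simp add: divide_right_mono_ennreal)
qed

lemma optimal_rate_le_rate: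
  assumes code: "semifaithful_code \<rho> d n \<xi>" and P: "set_pmf P \<subseteq> words n"
  shows "optimal_rate \<rho> d n P \<le> rate n \<xi> P"
proof -
  let ?\<phi> = "quantizer \<xi>"
  have cb: "?\<phi> x \<in> codebook n \<xi>" if "x \<in> words n" for x
    using that by (simp add: codebook_def)
  have "optimal_rate \<rho> d n P \<le> shannon_entropy (map_pmf ?\<phi> P) / of_nat n"
    using code cb P unfolding semifaithful_code_def by (intro optimal_rate_le_entropy) auto
  also have "shannon_entropy (map_pmf ?\<phi> P)
      \<le> (\<integral>\<^sup>+y. of_nat (length (encoder \<xi> y)) \<partial>measure_pmf (map_pmf ?\<phi> P))"
    using code P by (intro shannon_entropy_le_length[where B = "codebook n \<xi>"])
      (auto simp: semifaithful_code_def codebook_def)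
  finally show ?thesis by (simp add: rate_def divide_right_mono_ennreal)
qed

lemma words_nth: "x \<in> words n \<Longrightarrow> i < n \<Longrightarrow> x ! i \<in> alphabet"
  unfolding words_def by (metis (mono_tags, lifting) mem_Collect_eq nth_mem subsetD)

lemma word_distortion_self: "distortion \<rho> \<Longrightarrow> x \<in> words n \<Longrightarrow> word_distortion \<rho> n x x = 0"
  using words_nth by (auto simp: word_distortion_def distortion_def intro!: sum.neutral)

lemma set_replicate_pmf_words:
  "set_pmf \<mu> \<subseteq> alphabet \<Longrightarrow> set_pmf (replicate_pmf n \<mu>) \<subseteq> words n"
  by (auto simp: set_replicate_pmf words_def)

lemma optimal_rate_le_shannon_entropy:
  assumes "distortion \<rho>" "d > 0" "set_pmf P \<subseteq> words n"
  shows "optimal_rate \<rho> d n P \<le> shannon_entropy P / of_nat n"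
proof -
  have "word_distortion \<rho> n x x \<le> d" if "x \<in> words n" for x
    using word_distortion_self[OF assms(1) that] assms(2) by simp
  then have "optimal_rate \<rho> d n P \<le> shannon_entropy (map_pmf (\<lambda>x. x) P) / of_nat n"
    using assms by (intro optimal_rate_le_entropy) auto
  then show ?thesis by simp
qed

subsection \<open>Envelopes that are not summable\<close>

lemma pmf_exists:
  assumes "\<And>x. 0 \<le> h x" "(\<integral>\<^sup>+x. ennreal (h x) \<partial>count_space UNIV) = 1"
  obtains \<mu> where "\<And>x. pmf \<mu> x = h x"
  using pmf_embed_pmf[OF assms] by blast

lemma non_summable_source:
  assumes f_nonneg: "\<forall>x\<in>alphabet. f x \<ge> 0"
    and ns: "\<not> (\<lambda>x. \<bar>f x\<bar>) summable_on alphabet"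
  shows "\<exists>\<mu>\<in>envelope_family f. finite (set_pmf \<mu>) \<and> set_pmf \<mu> \<subseteq> {m<..} \<and>
    (\<forall>x. pmf \<mu> x \<le> (1/2) ^ B)"
proof -
  have "\<exists>F. finite F \<and> F \<subseteq> {m<..} \<and> 2 ^ B \<le> (\<Sum>x\<in>F. min (f x) 1)"
  \<comment> \<open>Infinitely many values that are at least 1 can simply be counted. Otherwise
    bounded sums over the other letters beyond \<open>m\<close> would make \<open>f\<close>
    summable.\<close>
  proof (cases "finite {x. m < x \<and> f x \<ge> 1}")
    case False
    then obtain F where "finite F" "card F = 2 ^ B" "F \<subseteq> {x. m < x \<and> f x \<ge> 1}"
      using infinite_arbitrarily_large by blast
    moreover from this have "(\<Sum>x\<in>F. min (f x) 1) = (\<Sum>x\<in>F. 1)"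
      by (intro sum.cong) auto
    ultimately show ?thesis by (intro exI[of _ F]) auto
  next
    case True
    let ?A = "{x. m < x \<and> f x < 1}"
    show ?thesis
    proof (rule ccontr)
      assume not: "\<not> ?thesis"
      have "(\<lambda>x. \<bar>f x\<bar>) summable_on ?A"
      proof (rule nonneg_bdd_above_summable_on)
        show "bdd_above (sum (\<lambda>x. \<bar>f x\<bar>) ` {F. F \<subseteq> ?A \<and> finite F})"
        proof (intro bdd_aboveI2[where M = "2 ^ B"])
          fix F assume F: "F \<in> {F. F \<subseteq> ?A \<and> finite F}"
          then have "(\<Sum>x\<in>F. \<bar>f x\<bar>) = (\<Sum>x\<in>F. min (f x) 1)"
            using f_nonneg by (intro sum.cong) (auto simp: subset_iff)
          moreover have "\<not> 2 ^ B \<le> (\<Sum>x\<in>F. min (f x) 1)" using not F by auto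
          ultimately show "(\<Sum>x\<in>F. \<bar>f x\<bar>) \<le> 2 ^ B" by simp
        qed
      qed auto
      moreover have "(\<lambda>x. \<bar>f x\<bar>) summable_on ({x. m < x \<and> f x \<ge> 1} \<union> {1..m})"
        using True by (intro summable_on_finite) auto
      moreover have "?A \<inter> ({x. m < x \<and> f x \<ge> 1} \<union> {1..m}) = {}" by auto
      ultimately have "(\<lambda>x. \<bar>f x\<bar>) summable_on (?A \<union> ({x. m < x \<and> f x \<ge> 1} \<union> {1..m}))"
        by (rule summable_on_Un_disjoint)
      moreover have "?A \<union> ({x. m < x \<and> f x \<ge> 1} \<union> {1..m}) = alphabet" by auto
      ultimately show False using ns by simp
    qed
  qed
  then obtain F where F: "finite F" "F \<subseteq> {m<..}" "2 ^ B \<le> (\<Sum>x\<in>F. min (f x) 1)" by blast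
  define S where "S = (\<Sum>x\<in>F. min (f x) 1)"
  define h where "h x = (if x \<in> F then min (f x) 1 / S else 0)" for x
  have S: "S \<ge> 2 ^ B" using F(3) by (simp add: S_def)
  have S1: "S \<ge> 1" by (rule order_trans[OF _ S]) simp
  have f0: "0 \<le> f x" if "x \<in> F" for x using that F(2) f_nonneg by auto
  have h0: "0 \<le> h x" for x using f0 S1 by (auto simp: h_def)
  have "(\<integral>\<^sup>+x. ennreal (h x) \<partial>count_space UNIV) = (\<Sum>x\<in>F. ennreal (h x))"
    using F(1) by (intro nn_integral_count_space') (auto simp: h_def)
  also have "\<dots> = ennreal (\<Sum>x\<in>F. h x)" using h0 by simp
  also have "(\<Sum>x\<in>F. h x) = (\<Sum>x\<in>F. min (f x) 1) / S"
    unfolding sum_divide_distrib by (intro sum.cong) (auto simp: h_def)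
  finally have "(\<integral>\<^sup>+x. ennreal (h x) \<partial>count_space UNIV) = 1"
    using S1 by (simp flip: S_def)
  with h0 obtain \<mu> where \<mu>: "\<And>x. pmf \<mu> x = h x" by (rule pmf_exists) blast
  have set: "set_pmf \<mu> \<subseteq> F" by (auto simp: set_pmf_iff \<mu> h_def split: if_splits)
  show ?thesis
  proof (intro bexI[of _ \<mu>] conjI allI)
    show "finite (set_pmf \<mu>)" "set_pmf \<mu> \<subseteq> {m<..}" using set F finite_subset by blast+
    have "pmf \<mu> x \<le> f x" if "x \<in> alphabet" for x
    proof (cases "x \<in> F")
      case True
      have "min (f x) 1 / S \<le> min (f x) 1 / 1"
        using f0[OF True] S1 by (intro divide_left_mono) auto
      then show ?thesis using True by (simp add: \<mu> h_def)
    qed (use that f_nonneg in \<open>auto simp: \<mu> h_def\<close>)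
    moreover have "set_pmf \<mu> \<subseteq> alphabet" using set F(2) by force
    ultimately show "\<mu> \<in> envelope_family f" by (simp add: envelope_family_def)
    show "pmf \<mu> x \<le> (1/2) ^ B" for x
    proof (cases "x \<in> F")
      case True
      have "min (f x) 1 / S \<le> 1 / 2 ^ B"
        using f0[OF True] S S1 by (intro frac_le) auto
      then show ?thesis using True by (simp add: \<mu> h_def power_one_over)
    qed (simp add: \<mu> h_def)
  qed
qed

text \<open>The words sharing a codeword lie in a box around it: a total distortion of at most
  \<open>n * d\<close> bounds that of each position, and by consistency the distance of the
  letters.\<close>

lemma fiber_card:
  assumes code: "semifaithful_code \<rho> d n \<xi>" and dist: "distortion \<rho>" and cons: "euclidean_consistent \<rho>"
    and d: "d > 0"
  obtains N :: nat where "\<And>F y. finite F \<Longrightarrow> F \<subseteq> words n \<Longrightarrow> y \<in> codebook n \<xi> \<Longrightarrow>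
    card {x\<in>F. quantizer \<xi> x = y} \<le> N"
proof -
  \<comment> \<open>One more than the largest distortion that a single position can have, so that
    reaching it is contradictory.\<close>
  have "real n * d + 1 > 0" using d by (simp add: add_nonneg_pos)
  then obtain \<epsilon> where eps: "\<epsilon> > 0"
    "\<And>i j. i \<in> alphabet \<Longrightarrow> j \<in> alphabet \<Longrightarrow> \<bar>real i - real j\<bar> \<ge> \<epsilon> \<Longrightarrow> \<rho> i j \<ge> real n * d + 1"
    using cons unfolding euclidean_consistent_def by meson
  define R where "R = nat \<lceil>\<epsilon>\<rceil>"
  have near: "x ! i \<le> y ! i + R \<and> y ! i \<le> x ! i + R"
    if x: "x \<in> words n" and y: "y \<in> words n" and xy: "word_distortion \<rho> n x y \<le> d" and i: "i < n" for x y i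
  proof -
    note alph = words_nth[OF x] words_nth[OF y]
    have "\<rho> (x ! i) (y ! i) \<le> (\<Sum>j<n. \<rho> (x ! j) (y ! j))"
      using i alph dist by (intro member_le_sum) (auto simp: distortion_def)
    also have "\<dots> \<le> real n * d" using xy i by (simp add: word_distortion_def field_simps)
    finally have "\<not> \<bar>real (x ! i) - real (y ! i)\<bar> \<ge> \<epsilon>" using eps(2) alph[OF i] by force
    then show ?thesis unfolding R_def by linarith
  qed
  let ?L = "{ys. set ys \<subseteq> {..2 * R} \<and> length ys = n}"
  have "card {x\<in>F. quantizer \<xi> x = y} \<le> card ?L"
    if F: "finite F" "F \<subseteq> words n" and y: "y \<in> codebook n \<xi>" for F y
  proof (rule card_inj_on_le)
    have yw: "y \<in> words n" using y code by (auto simp: semifaithful_code_def)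
    \<comment> \<open>The shift by \<open>R\<close> avoids negative differences: the entries lie
      between 0 and \<open>2 * R\<close>, and the subtraction never truncates.\<close>
    let ?g = "\<lambda>x. map (\<lambda>i. x ! i + R - y ! i) [0..<n]"
    have nr: "x ! i \<le> y ! i + R \<and> y ! i \<le> x ! i + R" if "x \<in> {x\<in>F. quantizer \<xi> x = y}" "i < n" for x i
      using that F(2) code yw by (intro near) (auto simp: semifaithful_code_def)
    show "inj_on ?g {x\<in>F. quantizer \<xi> x = y}"
    proof (rule inj_onI)
      fix x x' assume x: "x \<in> {x\<in>F. quantizer \<xi> x = y}" "x' \<in> {x\<in>F. quantizer \<xi> x = y}" "?g x = ?g x'"
      have "x ! i = x' ! i" if "i < n" for i
      proof -
        have "x ! i + R - y ! i = x' ! i + R - y ! i" using x(3) that by (simp add: map_eq_conv)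
        then show ?thesis using nr[OF x(1) that] nr[OF x(2) that] by linarith
      qed
      then show "x = x'" using x F(2) by (auto simp: words_def intro!: nth_equalityI)
    qed
    show "?g ` {x\<in>F. quantizer \<xi> x = y} \<subseteq> ?L"
    proof (intro image_subsetI CollectI conjI)
      fix x assume x: "x \<in> {x\<in>F. quantizer \<xi> x = y}"
      show "set (?g x) \<subseteq> {..2 * R}" using nr[OF x] by fastforce
    qed auto
    show "finite ?L" by (rule finite_lists_length_eq) auto
  qed
  then show thesis by (rule that)
qed

text \<open>With at most \<open>N\<close> words per codeword, Kraft's inequality bounds the weight
  of all words together by \<open>N\<close>. A finite set \<open>F0\<close> comes within
  \<open>\<delta>\<close> of the supremum; words of letters larger than any in \<open>F0\<close>
  avoid \<open>F0\<close> and share what remains.\<close>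

lemma code_weight_tail:
  assumes code: "semifaithful_code \<rho> d n \<xi>" and dist: "distortion \<rho>" and cons: "euclidean_consistent \<rho>"
    and d: "d > 0" and n: "n \<ge> 1" and \<delta>: "\<delta> > 0"
  shows "\<exists>m. \<forall>F. finite F \<longrightarrow> F \<subseteq> {x\<in>words n. set x \<subseteq> {m<..}} \<longrightarrow>
    (\<Sum>x\<in>F. (1/2) ^ length (encoder \<xi> (quantizer \<xi> x))) \<le> (\<delta> :: real)"
proof -
  obtain N where N: "\<And>F y. finite F \<Longrightarrow> F \<subseteq> words n \<Longrightarrow> y \<in> codebook n \<xi> \<Longrightarrow>
    card {x\<in>F. quantizer \<xi> x = y} \<le> N"
    using fiber_card[OF code dist cons d] by blast
  define w :: "nat list \<Rightarrow> real" where "w x = (1/2) ^ length (encoder \<xi> (quantizer \<xi> x))" for x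
  have bound: "sum w F \<le> real N" if F: "finite F" "F \<subseteq> words n" for F
  proof -
    let ?Y = "quantizer \<xi> ` F"
    have Y: "?Y \<subseteq> codebook n \<xi>" using F by (auto simp: codebook_def)
    have dec: "decoder \<xi> (encoder \<xi> y) = y" if "y \<in> codebook n \<xi>" for y
      using code that unfolding semifaithful_code_def by blast
    have inj: "inj_on (encoder \<xi>) ?Y"
    proof (rule inj_on_inverseI)
      show "decoder \<xi> (encoder \<xi> y) = y" if "y \<in> ?Y" for y
        using that Y by (intro dec) (rule subsetD)
    qed
    have "sum w F = (\<Sum>y\<in>?Y. sum w {x\<in>F. quantizer \<xi> x = y})"
      using F(1) by (rule sum.image_gen)
    also have "\<dots> = (\<Sum>y\<in>?Y. real (card {x\<in>F. quantizer \<xi> x = y}) * (1/2) ^ length (encoder \<xi> y))"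
    proof (rule sum.cong[OF refl])
      fix y
      have "sum w {x\<in>F. quantizer \<xi> x = y} = (\<Sum>x\<in>{x\<in>F. quantizer \<xi> x = y}. (1/2) ^ length (encoder \<xi> y))"
        by (rule sum.cong) (auto simp: w_def)
      then show "sum w {x\<in>F. quantizer \<xi> x = y} = real (card {x\<in>F. quantizer \<xi> x = y}) * (1/2) ^ length (encoder \<xi> y)"
        by simp
    qed
    also have "\<dots> \<le> (\<Sum>y\<in>?Y. real N * (1/2) ^ length (encoder \<xi> y))"
    proof (intro sum_mono mult_right_mono)
      fix y assume "y \<in> ?Y"
      then have "y \<in> codebook n \<xi>" using Y by (rule subsetD[rotated])
      from N[OF F this] show "real (card {x\<in>F. quantizer \<xi> x = y}) \<le> real N" by simp
    qed auto
    also have "\<dots> = real N * (\<Sum>b\<in>encoder \<xi> ` ?Y. (1/2) ^ length b)"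
      by (subst sum.reindex[OF inj]) (simp add: sum_distrib_left)
    also have "(\<Sum>b\<in>encoder \<xi> ` ?Y. (1/2) ^ length b) \<le> (1::real)"
    proof (rule kraft_finite)
      fix b c assume bc: "b \<in> encoder \<xi> ` ?Y" "c \<in> encoder \<xi> ` ?Y" "b \<noteq> c"
      from bc(1) obtain y where y: "b = encoder \<xi> y" "y \<in> ?Y" by (rule imageE)
      from bc(2) obtain z where z: "c = encoder \<xi> z" "z \<in> ?Y" by (rule imageE)
      have "\<forall>y\<in>codebook n \<xi>. \<forall>z\<in>codebook n \<xi>. y \<noteq> z \<longrightarrow> \<not> prefix (encoder \<xi> y) (encoder \<xi> z)"
        using code unfolding semifaithful_code_def by (elim conjE)
      moreover have "y \<noteq> z" using bc(3) y z by (metis (no_types))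
      ultimately show "\<not> prefix b c" using subsetD[OF Y y(2)] subsetD[OF Y z(2)] y(1) z(1) by simp
    qed (use F in simp)
    finally show ?thesis by (simp add: mult_left_mono)
  qed
  define \<S> where "\<S> = sum w ` {F. finite F \<and> F \<subseteq> words n}"
  have bdd: "bdd_above \<S>" unfolding \<S>_def using bound by (intro bdd_aboveI2[where M = "real N"]) simp
  have ne: "\<S> \<noteq> {}" unfolding \<S>_def by blast
  have "Sup \<S> - \<delta> < Sup \<S>" using \<delta> by simp
  then obtain F0 where F0: "finite F0" "F0 \<subseteq> words n" "Sup \<S> - \<delta> < sum w F0"
    using less_cSup_iff[OF ne bdd] unfolding \<S>_def by blast
  define m where "m = Max (insert 0 (\<Union>(set ` F0)))"
  have m: "a \<le> m" if "x \<in> F0" "a \<in> set x" for a x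
    unfolding m_def using F0(1) that by (intro Max_ge) auto
  show ?thesis
  proof (intro exI[of _ m] allI impI)
    fix F assume F: "finite F" "F \<subseteq> {x\<in>words n. set x \<subseteq> {m<..}}"
    have disj: "F0 \<inter> F = {}"
    proof (rule ccontr)
      assume "F0 \<inter> F \<noteq> {}"
      then obtain x where x: "x \<in> F0" "x \<in> F" by blast
      then have "length x = n" using F(2) unfolding words_def by blast
      \<comment> \<open>Here \<open>1 \<le> n\<close> matters: the empty word would satisfy both
        conditions on its letters vacuously.\<close>
      then have h: "hd x \<in> set x" using n by (cases x) simp_all
      have "set x \<subseteq> {m<..}" using x(2) F(2) by blast
      with h have "m < hd x" by blast
      with m[OF x(1) h] show False by simp
    qed
    have "sum w F0 + sum w F = sum w (F0 \<union> F)"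
      using F0(1) F(1) disj by (rule sum.union_disjoint[symmetric])
    also have "\<dots> \<le> Sup \<S>"
    proof (rule cSup_upper[OF _ bdd])
      have "F0 \<union> F \<in> {F. finite F \<and> F \<subseteq> words n}" using F0 F by blast
      then show "sum w (F0 \<union> F) \<in> \<S>" unfolding \<S>_def by (rule imageI)
    qed
    finally have "sum w F \<le> \<delta>" using F0(3) by linarith
    then show "(\<Sum>x\<in>F. (1/2) ^ length (encoder \<xi> (quantizer \<xi> x))) \<le> \<delta>"
      unfolding w_def .
  qed
qed

lemma finite_shannon_entropy:
  assumes "finite (set_pmf P)"
  shows "shannon_entropy P = ennreal (\<Sum>x\<in>set_pmf P. - (pmf P x * log 2 (pmf P x)))"
proof -
  have "shannon_entropy P = (\<Sum>x\<in>set_pmf P. ennreal (- (pmf P x * log 2 (pmf P x))))"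
    unfolding shannon_entropy_def using assms
    by (intro nn_integral_count_space') (auto simp: set_pmf_iff)
  also have "\<dots> = ennreal (\<Sum>x\<in>set_pmf P. - (pmf P x * log 2 (pmf P x)))"
    by (intro sum_ennreal entropy_summand_nonneg) (auto simp: pmf_le_1)
  finally show ?thesis .
qed

text \<open>Coding without distortion bounds the optimal rate by the entropy per letter, so it
  suffices that the expected length exceeds the entropy by \<open>n * b\<close> bits. Finite support
  keeps both finite, so the source takes part in the supremum.\<close>

lemma infinite_worst_redundancy:
  assumes f_nonneg: "\<forall>x\<in>alphabet. f x \<ge> 0" and dist: "distortion \<rho>" and cons: "euclidean_consistent \<rho>"
    and ns: "\<not> (\<lambda>x. \<bar>f x\<bar>) summable_on alphabet"
    and d: "d > 0" and n: "n \<ge> 1" and code: "semifaithful_code \<rho> d n \<xi>"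
  shows "worst_redundancy \<rho> d n \<xi> (envelope_family f) = \<infinity>"
proof -
  let ?M = "{\<mu>\<in>envelope_family f. \<not> (rate n \<xi> (replicate_pmf n \<mu>) = \<infinity> \<and>
                        optimal_rate \<rho> d n (replicate_pmf n \<mu>) = \<infinity>)}"
  have ex: "\<exists>\<mu>\<in>?M. ereal b \<le> redundancy \<rho> d n \<xi> \<mu>" for b :: real
  proof -
    \<comment> \<open>In Gibbs' inequality, weights of total at most \<open>\<delta>\<close> gain
      \<open>log 2 (1 / \<delta>) = n * b\<close> bits.\<close>
    define \<delta> where "\<delta> = 2 powr (- (real n * b))"
    have \<delta>: "\<delta> > 0" by (simp add: \<delta>_def)
    obtain m where m: "\<forall>F. finite F \<longrightarrow> F \<subseteq> {x\<in>words n. set x \<subseteq> {m<..}} \<longrightarrow>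
      (\<Sum>x\<in>F. (1/2) ^ length (encoder \<xi> (quantizer \<xi> x))) \<le> \<delta>"
      using code_weight_tail[OF code dist cons d n \<delta>] by (rule exE)
    obtain \<mu> where \<mu>: "\<mu> \<in> envelope_family f" "finite (set_pmf \<mu>)" "set_pmf \<mu> \<subseteq> {m<..}"
      using non_summable_source[OF f_nonneg ns, of m 0] by blast
    define P where "P = replicate_pmf n \<mu>"
    define S where "S = set_pmf P"
    define L where "L x = length (encoder \<xi> (quantizer \<xi> x))" for x
    have S: "finite S"
    proof -
      have "S = {xs. set xs \<subseteq> set_pmf \<mu> \<and> length xs = n}"
        by (auto simp: S_def P_def set_replicate_pmf)
      then show ?thesis using finite_lists_length_eq[OF \<mu>(2), of n] by simp
    qed
    have SW: "S \<subseteq> words n"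
      using \<mu>(1) unfolding S_def P_def by (intro set_replicate_pmf_words) (simp add: envelope_family_def)
    have SW': "S \<subseteq> {x\<in>words n. set x \<subseteq> {m<..}}"
      using SW \<mu>(3) by (auto simp: S_def P_def set_replicate_pmf)
    define EL where "EL = (\<Sum>x\<in>S. pmf P x * real (L x))"
    define H where "H = (\<Sum>x\<in>S. - (pmf P x * log 2 (pmf P x)))"
    have "(\<Sum>x\<in>S. - (pmf P x * log 2 (pmf P x)) + pmf P x * log 2 ((1/2) ^ L x / \<delta>) + pmf P x / ln 2)
      \<le> (\<Sum>x\<in>S. (1/2) ^ L x / (\<delta> * ln 2))"
      using \<delta> by (intro sum_mono gibbs_pointwise) auto
    also have "\<dots> = (\<Sum>x\<in>S. (1/2) ^ L x) / (\<delta> * ln 2)"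
      by (simp add: sum_divide_distrib)
    also have "\<dots> \<le> \<delta> / (\<delta> * ln 2)"
      using m[rule_format, OF S SW'] \<delta> by (intro divide_right_mono) (auto simp: L_def)
    also have "\<dots> = 1 / ln 2" using \<delta> by simp
    finally have "(\<Sum>x\<in>S. - (pmf P x * log 2 (pmf P x)) + pmf P x * log 2 ((1/2) ^ L x / \<delta>) + pmf P x / ln 2)
       \<le> 1 / ln 2" .
    moreover have "- (pmf P x * log 2 (pmf P x)) + pmf P x * log 2 ((1/2) ^ L x / \<delta>) + pmf P x / ln 2
      = - (pmf P x * log 2 (pmf P x)) + (real n * b + 1 / ln 2) * pmf P x - pmf P x * real (L x)" for x
    proof -
      have "log 2 ((1/2) ^ L x) = - real (L x)" by (simp add: log_nat_power log_divide)
      moreover have "log 2 \<delta> = - (real n * b)" by (simp add: \<delta>_def)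
      ultimately have "log 2 ((1/2) ^ L x / \<delta>) = real n * b - real (L x)"
        using \<delta> by (subst log_divide) auto
      then show ?thesis by (simp only:) (simp add: algebra_simps)
    qed
    moreover have "(\<Sum>x\<in>S. pmf P x) = 1" using S by (intro sum_pmf_eq_1) (auto simp: S_def)
    ultimately have "H + (real n * b + 1 / ln 2) - EL \<le> 1 / ln 2"
      unfolding H_def EL_def by (simp only: sum.distrib sum_subtractf sum_distrib_left[symmetric]) simp
    then have "H + real n * b - EL \<le> 0" by linarith
    then have ineq: "b \<le> EL / n - H / n" using n by (simp add: field_simps)
    have H0: "0 \<le> H" unfolding H_def by (intro sum_nonneg entropy_summand_nonneg) (auto simp: pmf_le_1)
    have EL0: "0 \<le> EL" unfolding EL_def by (intro sum_nonneg) auto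
    have nn: "(of_nat n :: ennreal) = ennreal (real n)" by (simp add: ennreal_of_nat_eq_real_of_nat)
    have rate: "rate n \<xi> P = ennreal (EL / n)"
    proof -
      have "(\<integral>\<^sup>+ x. of_nat (L x) \<partial>measure_pmf P) = (\<Sum>x\<in>S. of_nat (L x) * ennreal (pmf P x))"
        using S unfolding S_def by (intro nn_integral_measure_pmf_finite) auto
      also have "\<dots> = (\<Sum>x\<in>S. ennreal (pmf P x * real (L x)))"
        by (intro sum.cong refl) (simp add: ennreal_of_nat_eq_real_of_nat ennreal_mult'[symmetric] mult.commute)
      also have "\<dots> = ennreal EL" unfolding EL_def by (intro sum_ennreal) auto
      finally show ?thesis using n EL0 by (simp add: rate_def L_def nn divide_ennreal)
    qed
    have "optimal_rate \<rho> d n P \<le> shannon_entropy P / of_nat n"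
      using optimal_rate_le_shannon_entropy[OF dist d] SW by (simp add: S_def)
    also have "\<dots> = ennreal (H / n)"
      using S H0 n by (simp add: S_def H_def finite_shannon_entropy nn divide_ennreal)
    finally have opt: "optimal_rate \<rho> d n P \<le> ennreal (H / n)" .
    have "ereal b \<le> ereal (EL / n) - ereal (H / n)" using ineq by simp
    also have "\<dots> \<le> enn2ereal (rate n \<xi> P) - enn2ereal (optimal_rate \<rho> d n P)"
    proof (rule ereal_minus_mono)
      show "enn2ereal (optimal_rate \<rho> d n P) \<le> ereal (H / n)"
        using opt H0 by (simp add: less_eq_ennreal.rep_eq)
    qed (use EL0 in \<open>simp add: rate\<close>)
    finally have "ereal b \<le> redundancy \<rho> d n \<xi> \<mu>" by (simp add: redundancy_def P_def)
    moreover have "\<mu> \<in> ?M" using \<mu>(1) rate by (simp add: P_def)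
    ultimately show ?thesis by blast
  qed
  then have ne: "?M \<noteq> {}" by blast
  have "(SUP \<mu>\<in>?M. redundancy \<rho> d n \<xi> \<mu>) = \<infinity>"
  proof (rule ereal_top)
    fix b
    from ex[of b] obtain \<mu> where "\<mu> \<in> ?M" "ereal b \<le> redundancy \<rho> d n \<xi> \<mu>" by blast
    then show "ereal b \<le> (SUP \<mu>\<in>?M. redundancy \<rho> d n \<xi> \<mu>)" by (rule SUP_upper2)
  qed
  then show ?thesis unfolding worst_redundancy_def Let_def using ne by (simp only: if_False)
qed

subsection \<open>Envelope families of bounded entropy\<close>

text \<open>Concavity of \<open>- (x * log 2 x)\<close>: the bounds on \<open>m\<close> make it a
  mixture of \<open>p\<close> and some \<open>r\<close> in the unit interval, whose own nonnegative
  summand is dropped. The tangent at \<open>m\<close> is \<open>gibbs_pointwise\<close> with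
  \<open>t = m\<close>.\<close>

lemma entropy_summand_concave:
  fixes w p m :: real
  assumes w: "0 \<le> w" "w \<le> 1" and p: "0 \<le> p" "p \<le> 1" and m: "w * p \<le> m" "m \<le> w * p + (1 - w)"
  shows "w * - (p * log 2 p) \<le> - (m * log 2 m)"
proof (cases "w = 1 \<or> m = 0")
  case True
  then show ?thesis
  proof
    assume "m = 0"
    then have "w * p = 0" using m w p by (metis mult_nonneg_nonneg order_antisym)
    then show ?thesis using \<open>m = 0\<close> by auto
  qed (use m in auto)
next
  case False
  with w p m have w1: "w < 1" and m0: "m > 0" by (auto simp: less_le intro: order_trans[rotated])
  define r where "r = (m - w * p) / (1 - w)"
  have r: "0 \<le> r" "r \<le> 1" and mr: "m = w * p + (1 - w) * r"
    using m w1 by (auto simp: r_def)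
  have "w * (- (p * log 2 p) + p * log 2 (m / 1) + p / ln 2)
      + (1 - w) * (- (r * log 2 r) + r * log 2 (m / 1) + r / ln 2)
    \<le> w * (m / (1 * ln 2)) + (1 - w) * (m / (1 * ln 2))"
    using w p r m0 by (intro add_mono mult_left_mono gibbs_pointwise) auto
  moreover have "w * (- (p * log 2 p) + p * log 2 (m / 1) + p / ln 2)
      + (1 - w) * (- (r * log 2 r) + r * log 2 (m / 1) + r / ln 2)
    = w * - (p * log 2 p) + (1 - w) * - (r * log 2 r) + (w * p + (1 - w) * r) * (log 2 m + 1 / ln 2)"
    by (simp add: algebra_simps add_divide_distrib diff_divide_distrib)
  ultimately have "w * - (p * log 2 p) + (1 - w) * - (r * log 2 r) + m * (log 2 m + 1 / ln 2) \<le> m / ln 2"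
    unfolding mr[symmetric] by (simp add: algebra_simps diff_divide_distrib)
  moreover have "0 \<le> (1 - w) * - (r * log 2 r)"
    using w1 r entropy_summand_nonneg[OF r] by (intro mult_nonneg_nonneg) auto
  ultimately show ?thesis by (simp add: algebra_simps)
qed

text \<open>The other components of the mixture, of total weight \<open>1 - pmf M k\<close>,
  contribute to each letter a mass between 0 and that weight, which is the situation of
  \<open>entropy_summand_concave\<close>.\<close>

lemma shannon_entropy_bind_ge:
  fixes M :: "'b pmf" and \<mu> :: "'b \<Rightarrow> 'a pmf"
  shows "ennreal (pmf M k) * shannon_entropy (\<mu> k) \<le> shannon_entropy (bind_pmf M \<mu>)"
proof -
  have int: "integrable (measure_pmf M) (\<lambda>j. pmf (\<mu> j) x)" for x
    by (rule measure_pmf.integrable_const_bound[where B = 1]) (auto simp: pmf_le_1)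
  have int': "integrable (measure_pmf M) (\<lambda>j. indicator {k} j * (c::real))" for c
    by (rule measure_pmf.integrable_const_bound[where B = "\<bar>c\<bar>"]) (auto simp: indicator_def)
  have le: "pmf M k * - (pmf (\<mu> k) x * log 2 (pmf (\<mu> k) x))
      \<le> - (pmf (bind_pmf M \<mu>) x * log 2 (pmf (bind_pmf M \<mu>) x))" for x
  proof (rule entropy_summand_concave)
    have "pmf M k * pmf (\<mu> k) x = (\<integral>j. indicator {k} j * pmf (\<mu> k) x \<partial>M)"
      by (simp add: measure_pmf_single)
    also have "\<dots> \<le> (\<integral>j. pmf (\<mu> j) x \<partial>M)"
      by (intro integral_mono int int') (auto simp: indicator_def)
    finally show "pmf M k * pmf (\<mu> k) x \<le> pmf (bind_pmf M \<mu>) x" by (simp add: pmf_bind)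
    have "(\<integral>j. pmf (\<mu> j) x \<partial>M) \<le> (\<integral>j. 1 + indicator {k} j * (pmf (\<mu> k) x - 1) \<partial>M)"
      by (intro integral_mono int Bochner_Integration.integrable_add int') (auto simp: indicator_def pmf_le_1)
    also have "\<dots> = 1 + pmf M k * (pmf (\<mu> k) x - 1)"
      by (subst Bochner_Integration.integral_add[OF _ int']) (auto simp: measure_pmf_single)
    finally show "pmf (bind_pmf M \<mu>) x \<le> pmf M k * pmf (\<mu> k) x + (1 - pmf M k)"
      by (simp add: pmf_bind algebra_simps)
  qed (auto simp: pmf_le_1)
  have "ennreal (pmf M k) * shannon_entropy (\<mu> k)
    = (\<integral>\<^sup>+ x. ennreal (pmf M k * - (pmf (\<mu> k) x * log 2 (pmf (\<mu> k) x))) \<partial>count_space UNIV)"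
    unfolding shannon_entropy_def
    by (subst nn_integral_cmult[symmetric]) (auto simp del: mult_minus_right simp flip: ennreal_mult' intro!: nn_integral_cong)
  also have "\<dots> \<le> shannon_entropy (bind_pmf M \<mu>)"
    unfolding shannon_entropy_def using le by (intro nn_integral_mono ennreal_leI) auto
  finally show ?thesis .
qed

text \<open>If the entropy is unbounded on the envelope family, then a suitable countable mixture of its
  members, which is again a member, has infinite entropy.\<close>

lemma bounded_entropy_iff:
  "(SUP \<mu>\<in>envelope_family f. shannon_entropy \<mu>) < \<infinity> \<longleftrightarrow> envelope_family f \<subseteq> finite_entropy_sources"
proof
  assume *: "(SUP \<mu>\<in>envelope_family f. shannon_entropy \<mu>) < \<infinity>"
  then have "shannon_entropy \<mu> < \<infinity>" if "\<mu> \<in> envelope_family f" for \<mu>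
    using SUP_upper[OF that, of shannon_entropy] by (rule le_less_trans[rotated])
  then show "envelope_family f \<subseteq> finite_entropy_sources"
    by (auto simp: finite_entropy_sources_def envelope_family_def)
next
  assume sub: "envelope_family f \<subseteq> finite_entropy_sources"
  show "(SUP \<mu>\<in>envelope_family f. shannon_entropy \<mu>) < \<infinity>"
  proof (rule ccontr)
    assume "\<not> (SUP \<mu>\<in>envelope_family f. shannon_entropy \<mu>) < \<infinity>"
    then have top: "(SUP \<mu>\<in>envelope_family f. shannon_entropy \<mu>) = top"
      by (metis infinity_ennreal_def less_top)
    \<comment> \<open>The entropies \<open>4 ^ k\<close> outgrow the geometric weights
      \<open>(1/2) ^ (k + 1)\<close> of the mixture.\<close>
    have "\<exists>\<mu>\<in>envelope_family f. of_nat (4 ^ k) < shannon_entropy \<mu>" for k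
    proof -
      have "of_nat (4 ^ k) < (SUP \<mu>\<in>envelope_family f. shannon_entropy \<mu>)"
        unfolding top by (rule of_nat_less_top)
      then show ?thesis by (simp only: less_SUP_iff)
    qed
    then obtain \<nu> where \<nu>: "\<And>k. \<nu> k \<in> envelope_family f" "\<And>k. of_nat (4 ^ k) < shannon_entropy (\<nu> k)"
      by metis
    define \<mu> where "\<mu> = bind_pmf (geometric_pmf (1/2)) \<nu>"
    have "pmf \<mu> x \<le> f x" if "x \<in> alphabet" for x
      unfolding \<mu>_def pmf_bind using \<nu>(1) that
      by (intro measure_pmf.integral_le_const measure_pmf.integrable_const_bound[where B = 1])
         (auto simp: pmf_le_1 envelope_family_def)
    moreover have "set_pmf \<mu> \<subseteq> alphabet"
      using \<nu>(1) by (auto simp: \<mu>_def envelope_family_def)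
    ultimately have "\<mu> \<in> envelope_family f" by (simp add: envelope_family_def)
    with sub have "shannon_entropy \<mu> < top" by (auto simp: finite_entropy_sources_def)
    then obtain N where N: "shannon_entropy \<mu> < of_nat N"
      using ennreal_Ex_less_of_nat by blast
    have "of_nat N \<le> (ennreal (2 ^ N))"
      by (simp add: ennreal_of_nat_eq_real_of_nat less_imp_le)
    \<comment> \<open>Component \<open>N + 1\<close> has weight \<open>(1/2) ^ (N + 2)\<close>;
      times \<open>4 ^ (N + 1)\<close> this is \<open>2 ^ N\<close>, which exceeds
      \<open>N\<close>.\<close>
    also have "(2 ^ N :: real) = pmf (geometric_pmf (1/2)) (N + 1) * 4 ^ (N + 1)"
    proof -
      have "(1/2) ^ (N + 1) * 4 ^ (N + 1) = (2::real) ^ (N + 1)"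
        by (subst power_mult_distrib[symmetric]) simp
      then show ?thesis by (simp add: mult.commute)
    qed
    also have "ennreal \<dots> = ennreal (pmf (geometric_pmf (1/2)) (N + 1)) * of_nat (4 ^ (N + 1))"
      by (subst ennreal_mult') (simp_all add: ennreal_of_nat_eq_real_of_nat del: power_Suc pmf_geometric)
    also have "\<dots> \<le> ennreal (pmf (geometric_pmf (1/2)) (N + 1)) * shannon_entropy (\<nu> (N + 1))"
      by (intro mult_left_mono less_imp_le \<nu>(2)) simp
    also have "\<dots> \<le> shannon_entropy \<mu>" unfolding \<mu>_def by (rule shannon_entropy_bind_ge)
    finally show False using N by simp
  qed
qed

subsection \<open>Codes for classes of words\<close>

lemma pmf_bind_ge: "pmf M x * pmf (F x) y \<le> pmf (bind_pmf M F) y"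
proof -
  have "pmf M x * pmf (F x) y = (\<integral>j. indicator {x} j * pmf (F x) y \<partial>M)"
    by (simp add: measure_pmf_single)
  also have "\<dots> \<le> (\<integral>j. pmf (F j) y \<partial>M)"
    by (intro integral_mono measure_pmf.integrable_const_bound[where B = 1])
       (auto simp: indicator_def pmf_le_1)
  finally show ?thesis by (simp add: pmf_bind)
qed

text \<open>Read as code lengths: describing \<open>x\<close>, and then \<open>y\<close> given
  \<open>x\<close>, is one of the ways to produce \<open>y\<close>, so its length bounds the length
  under the mixture.\<close>

lemma log_pmf_bind:
  assumes "x \<in> set_pmf M" "y \<in> set_pmf (F x)"
  shows "- log 2 (pmf (bind_pmf M F) y) \<le> - log 2 (pmf M x) - log 2 (pmf (F x) y)"
proof -
  have pos: "pmf M x > 0" "pmf (F x) y > 0" using assms by (auto simp: pmf_positive)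
  then have "log 2 (pmf M x * pmf (F x) y) \<le> log 2 (pmf (bind_pmf M F) y)"
    using pmf_bind_ge[of M x F y] by (subst log_le_cancel_iff) (auto intro: less_le_trans[OF mult_pos_pos])
  then show ?thesis using pos by (simp add: log_mult)
qed

lemma pmf_replicate_pmf: "length x = n \<Longrightarrow> pmf (replicate_pmf n p) x = prod_list (map (pmf p) x)"
proof (induction n arbitrary: x)
  case (Suc n)
  then obtain a as where x: "x = a # as" "length as = n" by (cases x) auto
  have "replicate_pmf (Suc n) p = map_pmf (\<lambda>(a, as). a # as) (pair_pmf p (replicate_pmf n p))"
    by (simp add: pair_pmf_def map_bind_pmf)
  moreover have "x = (\<lambda>(a, as). a # as) (a, as)" by (simp add: x)
  ultimately have "pmf (replicate_pmf (Suc n) p) x = pmf (pair_pmf p (replicate_pmf n p)) (a, as)"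
    by (simp only:) (rule pmf_map_inj', auto intro: injI)
  then show ?case using Suc.IH[OF x(2)] by (simp add: pmf_pair x(1))
qed auto

lemma neg_log_pmf_nonneg: "0 \<le> - log 2 (pmf p a)"
proof (cases "pmf p a = 0")
  case False
  then have "0 < pmf p a" by (simp add: less_le)
  then show ?thesis by (simp add: pmf_le_1)
qed (simp add: log_def)

text \<open>The ideal length of \<open>x\<close> under a memoryless code for \<open>p\<close>. Since
  \<open>log 2 0 = 0\<close>, letters outside the support count as free, which is why statements
  about true code lengths carry a support condition.\<close>

definition code_bits :: "'a pmf \<Rightarrow> 'a list \<Rightarrow> real" where
  "code_bits p x = (\<Sum>a\<leftarrow>x. - log 2 (pmf p a))"

lemma log_pmf_replicate_pmf:
  assumes "length x = n" "set x \<subseteq> set_pmf p"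
  shows "- log 2 (pmf (replicate_pmf n p) x) = code_bits p x"
proof -
  have "- log 2 (prod_list (map (pmf p) x)) = code_bits p x \<and> prod_list (map (pmf p) x) > 0"
    using assms(2)
  proof (induction x)
    case (Cons a x)
    then have "pmf p a > 0" by (simp add: pmf_positive)
    with Cons show ?case by (simp add: code_bits_def log_mult)
  qed (simp add: code_bits_def)
  then show ?thesis using assms(1) by (simp add: pmf_replicate_pmf)
qed

lemma code_bits_nonneg: "0 \<le> code_bits p x"
  unfolding code_bits_def using neg_log_pmf_nonneg by (intro sum_list_nonneg) auto

lemma words_nonempty: "replicate n (Suc 0) \<in> words n"
  by (auto simp: words_def)

lemma semifaithful_code_of_pmf:
  assumes q_in: "\<And>x. x \<in> words n \<Longrightarrow> \<phi> x \<in> words n"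
    and q_d: "\<And>x. x \<in> words n \<Longrightarrow> word_distortion \<rho> n x (\<phi> x) \<le> d"
    and q_idem: "\<And>x. x \<in> words n \<Longrightarrow> \<phi> (\<phi> x) = \<phi> x"
    and Q: "\<And>x. x \<in> words n \<Longrightarrow> \<phi> x \<in> set_pmf Q"
  shows "\<exists>\<xi>. semifaithful_code \<rho> d n \<xi> \<and>
    (\<forall>x\<in>words n. real (length (encoder \<xi> (quantizer \<xi> x))) \<le> 2 - log 2 (pmf Q (\<phi> x)))"
proof -
  obtain enc :: "nat list \<Rightarrow> bool list" where enc:
    "\<And>y. y \<in> set_pmf Q \<Longrightarrow> enc y \<noteq> []"
    "\<And>y. y \<in> set_pmf Q \<Longrightarrow> real (length (enc y)) \<le> 2 - log 2 (pmf Q y)"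
    "\<And>y z. y \<in> set_pmf Q \<Longrightarrow> z \<in> set_pmf Q \<Longrightarrow> y \<noteq> z \<Longrightarrow> \<not> prefix (enc y) (enc z)"
    using prefix_code_of_pmf[of Q] by metis
  let ?B = "\<phi> ` words n"
  have B: "?B \<subseteq> set_pmf Q" using Q by blast
  have inj: "inj_on enc ?B"
  proof (rule inj_onI, rule ccontr)
    fix y z assume yz: "y \<in> ?B" "z \<in> ?B" "enc y = enc z" "y \<noteq> z"
    then have "\<not> prefix (enc y) (enc z)" using subsetD[OF B] by (intro enc(3)) simp_all
    then show False using yz(3) by simp
  qed
  \<comment> \<open>Strings that are no codewords must still decode into the codebook; the quantized
    word of ones is the default.\<close>
  define dec where "dec w = (if w \<in> enc ` ?B then inv_into ?B enc w else \<phi> (replicate n (Suc 0)))" for w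
  define \<xi> where "\<xi> = \<lparr>quantizer = \<phi>, encoder = enc, decoder = dec\<rparr>"
  have cb: "codebook n \<xi> = ?B" by (simp add: codebook_def \<xi>_def)
  have "semifaithful_code \<rho> d n \<xi>"
    unfolding semifaithful_code_def cb
  proof (intro conjI ballI allI impI)
    show "?B \<subseteq> words n" using q_in by blast
    show "word_distortion \<rho> n x (quantizer \<xi> x) \<le> d" if "x \<in> words n" for x
      using q_d[OF that] by (simp add: \<xi>_def)
    show "quantizer \<xi> y = y" if "y \<in> ?B" for y
      using that q_idem by (auto simp: \<xi>_def)
    show "encoder \<xi> y \<noteq> []" if "y \<in> ?B" for y
      using enc(1) subsetD[OF B that] by (simp add: \<xi>_def)
    show "\<not> prefix (encoder \<xi> y) (encoder \<xi> z)" if "y \<in> ?B" "z \<in> ?B" "y \<noteq> z" for y z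
      using enc(3) subsetD[OF B that(1)] subsetD[OF B that(2)] that(3) by (simp add: \<xi>_def)
    show "decoder \<xi> w \<in> ?B" for w
      using words_nonempty[of n] by (simp add: \<xi>_def dec_def inv_into_into imageI del: replicate_Suc)
    show "decoder \<xi> (encoder \<xi> y) = y" if "y \<in> ?B" for y
      using that inj by (simp add: \<xi>_def dec_def inv_into_f_f)
  qed
  moreover have "real (length (encoder \<xi> (quantizer \<xi> x))) \<le> 2 - log 2 (pmf Q (\<phi> x))" if "x \<in> words n" for x
    using enc(2)[OF Q[OF that]] by (simp add: \<xi>_def)
  ultimately show ?thesis by blast
qed

text \<open>A weak code on a finite class of words neither needs an idempotent quantizer nor integer
  code lengths.\<close>

definition weak_code ::
  "(nat \<Rightarrow> nat \<Rightarrow> real) \<Rightarrow> real \<Rightarrow> nat \<Rightarrow> nat list set \<Rightarrow> (nat list \<Rightarrow> nat list) \<Rightarrow> nat list pmf \<Rightarrow> bool" where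
  "weak_code \<rho> d n C \<psi> \<Lambda> \<longleftrightarrow>
     (\<forall>x\<in>C. \<psi> x \<in> words n \<and> word_distortion \<rho> n x (\<psi> x) \<le> d \<and> \<psi> x \<in> set_pmf \<Lambda>)"

text \<open>The unnormalised mean length under the uniform distribution on \<open>C\<close>. The
  support condition in \<open>weak_code\<close> prevents impossible codewords from having length
  0.\<close>

definition code_cost :: "nat list set \<Rightarrow> (nat list \<Rightarrow> nat list) \<Rightarrow> nat list pmf \<Rightarrow> real" where
  "code_cost C \<psi> \<Lambda> = (\<Sum>x\<in>C. - log 2 (pmf \<Lambda> (\<psi> x)))"

text \<open>The infimum may not be attained. The slack \<open>card C\<close> is one bit per word,
  hence one bit per block after averaging over \<open>C\<close>.\<close>

lemma near_optimal_weak_code: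
  assumes "finite C" "C \<noteq> {}" and ex: "weak_code \<rho> d n C \<psi>0 \<Lambda>0"
  shows "\<exists>\<psi> \<Lambda>. weak_code \<rho> d n C \<psi> \<Lambda> \<and>
    (\<forall>\<psi>' \<Lambda>'. weak_code \<rho> d n C \<psi>' \<Lambda>' \<longrightarrow> code_cost C \<psi> \<Lambda> \<le> code_cost C \<psi>' \<Lambda>' + real (card C))"
proof -
  let ?V = "{code_cost C \<psi> \<Lambda> |\<psi> \<Lambda>. weak_code \<rho> d n C \<psi> \<Lambda>}"
  have ne: "?V \<noteq> {}" using ex by blast
  have bdd: "bdd_below ?V"
    by (intro bdd_belowI[of _ 0]) (auto simp: code_cost_def intro!: sum_nonneg neg_log_pmf_nonneg)
  have "Inf ?V < Inf ?V + real (card C)" using assms by (simp add: card_gt_0_iff)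
  from cInf_lessD[OF ne this] obtain \<psi> \<Lambda> where *: "weak_code \<rho> d n C \<psi> \<Lambda>"
    "code_cost C \<psi> \<Lambda> < Inf ?V + real (card C)" by blast
  have "code_cost C \<psi> \<Lambda> \<le> code_cost C \<psi>' \<Lambda>' + real (card C)" if "weak_code \<rho> d n C \<psi>' \<Lambda>'" for \<psi>' \<Lambda>'
  proof -
    have "Inf ?V \<le> code_cost C \<psi>' \<Lambda>'" using that by (intro cInf_lower bdd) blast
    with *(2) show ?thesis by simp
  qed
  with *(1) show ?thesis by blast
qed

text \<open>0 is outside the alphabet and stands for an unspecified letter up to
  \<open>K\<close>.\<close>

definition clip :: "nat \<Rightarrow> nat \<Rightarrow> nat" where
  "clip K a = (if a \<le> K then 0 else a)"

text \<open>Every memoryless source is uniform on the words with a given key.\<close>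

definition key :: "nat \<Rightarrow> nat list \<Rightarrow> nat list \<times> nat list" where
  "key K x = (map (clip K) x, map (count_list x) [1..<Suc K])"

definition key_class :: "nat \<Rightarrow> nat \<Rightarrow> nat list \<times> nat list \<Rightarrow> nat list set" where
  "key_class n K k = {x \<in> words n. key K x = k}"

lemma count_list_clip: "a > K \<Longrightarrow> count_list (map (clip K) x) a = count_list x a"
  by (induction x) (auto simp: clip_def)

text \<open>The clipped word determines how often each letter above \<open>K\<close> occurs, the
  counts cover the rest; so the words of a class are permutations of each other.\<close>

lemma mset_eq_if_key_eq:
  assumes x: "x \<in> words n" and y: "y \<in> words n" and k: "key K x = key K y"
  shows "mset x = mset y"
proof (rule multiset_eqI)
  fix a
  consider "a = 0" | "a > K" | "1 \<le> a" "a \<le> K" by linarith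
  then have "count_list x a = count_list y a"
  proof cases
    case 1
    then have "a \<notin> set x" "a \<notin> set y" using x y by (auto simp: words_def)
    then show ?thesis by (simp add: count_list_0_iff)
  next
    case 2
    have "map (clip K) x = map (clip K) y" using k by (simp add: key_def)
    then show ?thesis using count_list_clip[OF 2, of x] count_list_clip[OF 2, of y] by simp
  next
    case 3
    have "map (count_list x) [1..<Suc K] = map (count_list y) [1..<Suc K]" using k by (simp add: key_def)
    then have "\<forall>b\<in>set [1..<Suc K]. count_list x b = count_list y b" unfolding map_eq_conv .
    moreover have "a \<in> set [1..<Suc K]" unfolding set_upt using 3 by simp
    ultimately show ?thesis by (rule bspec)
  qed
  then show "count (mset x) a = count (mset y) a" by (simp add: count_mset)
qed

lemma finite_key_class: "finite (key_class n K k)"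
proof (rule finite_subset)
  show "key_class n K k \<subseteq> {x. set x \<subseteq> {..K} \<union> set (fst k) \<and> length x = n}"
    by (force simp: key_class_def key_def words_def clip_def image_iff)
qed (intro finite_lists_length_eq, simp)

lemma pmf_const_on_key_class:
  assumes "x \<in> key_class n K k" "y \<in> key_class n K k"
  shows "pmf (replicate_pmf n \<mu>) x = pmf (replicate_pmf n \<mu>) y"
proof -
  have "mset x = mset y" using assms by (intro mset_eq_if_key_eq[of _ n _ K]) (auto simp: key_class_def)
  then have "prod_mset (image_mset (pmf \<mu>) (mset x)) = prod_mset (image_mset (pmf \<mu>) (mset y))" by simp
  moreover have "length x = n" "length y = n" using assms by (auto simp: key_class_def words_def)
  ultimately show ?thesis by (simp add: pmf_replicate_pmf prod_mset_prod_list flip: mset_map)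
qed

text \<open>Averaging the bound over each class suffices, because the source is uniform on classes.\<close>

lemma nn_integral_le_by_key_class:
  fixes g h :: "nat list \<Rightarrow> real"
  assumes sup: "set_pmf \<mu> \<subseteq> alphabet" and g: "\<And>x. 0 \<le> g x" and h: "\<And>x. 0 \<le> h x"
    and le: "\<And>x C. x \<in> set_pmf (replicate_pmf n \<mu>) \<Longrightarrow> C = key_class n K (key K x) \<Longrightarrow> C \<subseteq> set_pmf (replicate_pmf n \<mu>)
      \<Longrightarrow> sum g C \<le> sum h C + real (card C)"
  shows "(\<integral>\<^sup>+x. ennreal (g x) \<partial>replicate_pmf n \<mu>) \<le> (\<integral>\<^sup>+x. ennreal (h x) \<partial>replicate_pmf n \<mu>) + 1"
proof -
  define P where "P = replicate_pmf n \<mu>"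
  define C where "C x = key_class n K (key K x)" for x
  have PW: "set_pmf P \<subseteq> words n" unfolding P_def using sup by (rule set_replicate_pmf_words)
  have fin: "finite (C x)" for x unfolding C_def by (rule finite_key_class)
  have self: "x \<in> C x" if "x \<in> words n" for x using that by (simp add: C_def key_class_def)
  have const: "pmf P y = pmf P x" if "y \<in> C x" "x \<in> words n" for x y
    unfolding P_def using that self[OF that(2)] by (intro pmf_const_on_key_class[of _ n K "key K x"]) (simp_all add: C_def)
  have CP: "C x \<subseteq> set_pmf P" if "x \<in> set_pmf P" for x
    using const[of _ x] that PW by (auto simp: set_pmf_iff)
  \<comment> \<open>Drawing a word and redrawing it uniformly within its class leaves the source
    unchanged.\<close>
  have bind: "bind_pmf P (\<lambda>x. pmf_of_set (C x)) = P"
  proof (rule pmf_eqI)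
    fix y
    have "pmf (bind_pmf P (\<lambda>x. pmf_of_set (C x))) y = (\<integral>x. pmf (pmf_of_set (C x)) y \<partial>P)"
      by (rule pmf_bind)
    \<comment> \<open>Lying in the same class is symmetric, which turns the integrand into an
      indicator of the fixed class \<open>C y\<close>.\<close>
    also have "\<dots> = (\<integral>x. (if y \<in> words n then indicator (C y) x / real (card (C y)) else 0) \<partial>P)"
    proof (rule integral_cong_AE)
      show "AE x in P. pmf (pmf_of_set (C x)) y = (if y \<in> words n then indicator (C y) x / real (card (C y)) else 0)"
      proof (unfold AE_measure_pmf_iff, intro ballI)
        fix x assume "x \<in> set_pmf P"
        then have x: "x \<in> words n" using PW by blast
        have "C x \<noteq> {}" using self[OF x] by blast
        then have "pmf (pmf_of_set (C x)) y = indicator (C x) y / real (card (C x))"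
          using fin by (rule pmf_of_set)
        moreover have "y \<in> C x \<longleftrightarrow> y \<in> words n \<and> x \<in> C y" using x by (auto simp: C_def key_class_def)
        moreover have "C x = C y" if "y \<in> C x" using that by (simp add: C_def key_class_def)
        ultimately show "pmf (pmf_of_set (C x)) y = (if y \<in> words n then indicator (C y) x / real (card (C y)) else 0)"
          by (auto simp: indicator_def)
      qed
    qed auto
    also have "\<dots> = pmf P y"
    proof (cases "y \<in> words n")
      case True
      have "measure_pmf.prob P (C y) = (\<Sum>x\<in>C y. pmf P x)" by (rule measure_measure_pmf_finite[OF fin])
      also have "\<dots> = real (card (C y)) * pmf P y" using const[OF _ True] by simp
      finally have *: "measure_pmf.prob P (C y) = real (card (C y)) * pmf P y" .
      have "card (C y) > 0" using self[OF True] fin by (auto simp: card_gt_0_iff)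
      then show ?thesis using True * by simp
    next
      case False
      then have "y \<notin> set_pmf P" using PW by blast
      then show ?thesis using False by (simp add: set_pmf_iff)
    qed
    finally show "pmf (bind_pmf P (\<lambda>x. pmf_of_set (C x))) y = pmf P y" .
  qed
  have avg: "(\<integral>\<^sup>+y. ennreal (u y) \<partial>pmf_of_set (C x)) = ennreal (sum u (C x) / real (card (C x)))"
    if x: "x \<in> words n" and u: "\<And>y. 0 \<le> u y" for x and u :: "nat list \<Rightarrow> real"
  proof -
    have "C x \<noteq> {}" using self[OF x] by blast
    then have "(\<integral>\<^sup>+y. ennreal (u y) \<partial>pmf_of_set (C x)) = (\<Sum>y\<in>C x. ennreal (u y)) / of_nat (card (C x))"
      using fin by (rule nn_integral_pmf_of_set)
    also have "\<dots> = ennreal (sum u (C x)) / ennreal (real (card (C x)))"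
      using u by (simp add: ennreal_of_nat_eq_real_of_nat)
    also have "\<dots> = ennreal (sum u (C x) / real (card (C x)))"
      using \<open>C x \<noteq> {}\<close> fin u by (intro divide_ennreal) (auto intro: sum_nonneg simp: card_gt_0_iff)
    finally show ?thesis .
  qed
  have "(\<integral>\<^sup>+x. ennreal (g x) \<partial>P) = (\<integral>\<^sup>+x. \<integral>\<^sup>+y. ennreal (g y) \<partial>pmf_of_set (C x) \<partial>P)"
    by (subst bind[symmetric]) simp
  also have "\<dots> \<le> (\<integral>\<^sup>+x. (\<integral>\<^sup>+y. ennreal (h y) \<partial>pmf_of_set (C x)) + 1 \<partial>P)"
  proof (rule nn_integral_mono_AE, unfold AE_measure_pmf_iff, intro ballI)
    fix x assume x: "x \<in> set_pmf P"
    then have xw: "x \<in> words n" using PW by blast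
    have c: "real (card (C x)) > 0" using self[OF xw] fin by (auto simp: card_gt_0_iff)
    have "sum g (C x) \<le> sum h (C x) + real (card (C x))"
      using x CP[OF x] by (intro le[of x]) (auto simp: P_def C_def)
    then have "sum g (C x) / real (card (C x)) \<le> sum h (C x) / real (card (C x)) + 1"
      using c by (simp add: field_simps)
    then have "ennreal (sum g (C x) / real (card (C x))) \<le> ennreal (sum h (C x) / real (card (C x)) + 1)"
      by (rule ennreal_leI)
    also have "\<dots> = ennreal (sum h (C x) / real (card (C x))) + 1"
      using h by (subst ennreal_plus) (auto intro!: divide_nonneg_nonneg sum_nonneg)
    finally show "(\<integral>\<^sup>+y. ennreal (g y) \<partial>pmf_of_set (C x)) \<le> (\<integral>\<^sup>+y. ennreal (h y) \<partial>pmf_of_set (C x)) + 1"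
      by (simp add: avg[OF xw] g h)
  qed
  also have "\<dots> = (\<integral>\<^sup>+x. \<integral>\<^sup>+y. ennreal (h y) \<partial>pmf_of_set (C x) \<partial>P) + 1"
    by (subst nn_integral_add) auto
  also have "(\<integral>\<^sup>+x. \<integral>\<^sup>+y. ennreal (h y) \<partial>pmf_of_set (C x) \<partial>P) = (\<integral>\<^sup>+x. ennreal (h x) \<partial>P)"
    by (subst (2) bind[symmetric]) simp
  finally show ?thesis unfolding P_def .
qed

subsection \<open>Splicing words\<close>

lemma replicate_pmf_map: "replicate_pmf n (map_pmf h p) = map_pmf (map h) (replicate_pmf n p)"
  by (induction n) (simp_all add: map_pmf_def bind_assoc_pmf bind_return_pmf)

text \<open>A mark repeating one letter would be a likely start for a source concentrated on it; a
  pair of two different letters has probability at most 1/4 under every source.\<close>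

definition mark_word :: "nat \<Rightarrow> nat list" where
  "mark_word t = concat (replicate t [1, 2])"

lemma length_mark_word: "length (mark_word t) = 2 * t"
  by (induction t) (auto simp: mark_word_def)

lemma set_mark_word: "set (mark_word t) \<subseteq> {1, 2}"
  by (auto simp: mark_word_def)

text \<open>Starts with a letter above \<open>K\<close> are exempt as well: overwriting such a
  letter could cost an unbounded distortion.\<close>

definition bad_start :: "nat \<Rightarrow> nat \<Rightarrow> nat list \<Rightarrow> bool" where
  "bad_start K t u \<longleftrightarrow> u = mark_word t \<or> \<not> set u \<subseteq> {..K}"

text \<open>The letters \<open>z\<close> are a parameter because the quantizer takes them from the
  word itself, while the code distribution rebuilds them from transmitted data. The mark takes
  precedence, so it always appears intact.\<close>

definition splice_word :: "nat \<Rightarrow> nat list \<Rightarrow> nat \<Rightarrow> nat \<Rightarrow> (nat \<Rightarrow> nat) \<Rightarrow> nat list \<Rightarrow> nat list" where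
  "splice_word n m r a z w =
     map (\<lambda>i. if i < length m then m ! i else if i mod r = a then z i else w ! i) [0..<n]"

lemma take_splice_word: "length m \<le> n \<Longrightarrow> take (length m) (splice_word n m r a z w) = m"
  by (intro nth_equalityI) (auto simp: splice_word_def)

text \<open>The residue classes partition the positions, so one of them carries at least the average
  share.\<close>

lemma exists_heavy_residue:
  fixes D :: "nat \<Rightarrow> real"
  assumes "r \<ge> 1"
  shows "\<exists>a<r. (\<Sum>i<n. D i) \<le> real r * (\<Sum>i<n. if i mod r = a then D i else 0)"
proof (rule ccontr)
  assume "\<not> ?thesis"
  then have lt: "real r * (\<Sum>i<n. if i mod r = a then D i else 0) < (\<Sum>i<n. D i)" if "a < r" for a
    using that by (auto simp: not_le)
  have "(\<Sum>i<n. D i) = (\<Sum>i<n. \<Sum>a<r. if i mod r = a then D i else 0)"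
    using assms by (intro sum.cong) (auto simp: sum.delta)
  also have "\<dots> = (\<Sum>a<r. \<Sum>i<n. if i mod r = a then D i else 0)" by (rule sum.swap)
  finally have "real r * (\<Sum>i<n. D i) = (\<Sum>a<r. real r * (\<Sum>i<n. if i mod r = a then D i else 0))"
    by (simp add: sum_distrib_left)
  also have "\<dots> < (\<Sum>a<r. (\<Sum>i<n. D i))"
    using assms lt by (intro sum_strict_mono) (auto simp: lessThan_empty_iff)
  also have "\<dots> = real r * (\<Sum>i<n. D i)" by simp
  finally show False by simp
qed

text \<open>Sending the heavy residue class exactly leaves at most the fraction
  \<open>1 - 1 / r\<close> of the budget in use; \<open>slack\<close> says that the mark fits into
  the freed \<open>n * d / r\<close>.\<close>

lemma splice_word_distortion:
  assumes dist: "distortion \<rho>" and n: "n \<ge> 1"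
    and x: "x \<in> words n" and y: "y \<in> words n" and xy: "word_distortion \<rho> n x y \<le> d"
    and m: "length m \<le> n" and small: "\<And>i. i < length m \<Longrightarrow> \<rho> (x ! i) (m ! i) \<le> M" and M: "M \<ge> 0"
    and r: "r \<ge> 1" and slack: "real (length m) * M \<le> real n * d / real r"
    and a: "(\<Sum>i<n. \<rho> (x ! i) (y ! i)) \<le> real r * (\<Sum>i<n. if i mod r = a then \<rho> (x ! i) (y ! i) else 0)"
  shows "word_distortion \<rho> n x (splice_word n m r a (\<lambda>i. x ! i) y) \<le> d"
proof -
  let ?D = "\<lambda>i. \<rho> (x ! i) (y ! i)" and ?w = "splice_word n m r a (\<lambda>i. x ! i) y"
  have D0: "?D i \<ge> 0" and D1: "\<rho> (x ! i) (x ! i) = 0" if "i < n" for i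
    using dist words_nth[OF x that] words_nth[OF y that] by (auto simp: distortion_def)
  have "(\<Sum>i<n. \<rho> (x ! i) (?w ! i)) \<le> (\<Sum>i<n. (if i < length m then M else 0) + (?D i - (if i mod r = a then ?D i else 0)))"
  proof (intro sum_mono)
    fix i assume i: "i \<in> {..<n}"
    then have "0 \<le> ?D i - (if i mod r = a then ?D i else 0)" using D0 by auto
    then show "\<rho> (x ! i) (?w ! i) \<le> (if i < length m then M else 0) + (?D i - (if i mod r = a then ?D i else 0))"
      using small[of i] i D1[of i] by (auto simp: splice_word_def)
  qed
  also have "\<dots> = (\<Sum>i<n. if i < length m then M else 0) + ((\<Sum>i<n. ?D i) - (\<Sum>i<n. if i mod r = a then ?D i else 0))"
    by (simp add: sum.distrib sum_subtractf)
  also have "(\<Sum>i<n. if i < length m then M else 0) = real (length m) * M"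
  proof -
    have "(\<Sum>i<n. if i < length m then M else 0) = (\<Sum>i\<in>{..<n} \<inter> {i. i < length m}. M)"
      by (subst sum.inter_restrict) auto
    also have "{..<n} \<inter> {i. i < length m} = {..<length m}" using m by auto
    finally show ?thesis by simp
  qed
  also have "(\<Sum>i<n. ?D i) - (\<Sum>i<n. if i mod r = a then ?D i else 0) \<le> (\<Sum>i<n. ?D i) * (1 - 1 / real r)"
    using a r by (simp add: field_simps)
  also have "\<dots> \<le> real n * d * (1 - 1 / real r)"
    using xy n r by (intro mult_right_mono) (auto simp: word_distortion_def field_simps)
  finally have "(\<Sum>i<n. \<rho> (x ! i) (?w ! i)) \<le> real (length m) * M + real n * d * (1 - 1 / real r)" by simp
  also have "\<dots> \<le> real n * d" using slack by (simp add: algebra_simps)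
  finally show ?thesis using n by (simp add: word_distortion_def field_simps)
qed

text \<open>The distribution for which spliced words are coded. The pair \<open>(e, t)\<close> is
  the key, \<open>w\<close> the codeword in its class, and \<open>v\<close> holds the letters up to
  \<open>K\<close> in the residue class \<open>a\<close>, the larger ones being known from
  \<open>e\<close>. A residue class has at most \<open>n div r + 1\<close> positions below
  \<open>n\<close>.\<close>

definition splice_source ::
  "nat pmf \<Rightarrow> nat \<Rightarrow> nat \<Rightarrow> nat \<Rightarrow> nat list \<Rightarrow> (nat list \<times> nat list \<Rightarrow> nat list pmf) \<Rightarrow> nat list pmf" where
  "splice_source q n K r m \<Lambda> = do {
     e \<leftarrow> replicate_pmf n (map_pmf (clip K) q);
     t \<leftarrow> pmf_of_set {t. set t \<subseteq> {..n} \<and> length t = K};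
     w \<leftarrow> \<Lambda> (e, t);
     a \<leftarrow> pmf_of_set {..<r};
     v \<leftarrow> pmf_of_set {v. set v \<subseteq> {1..K} \<and> length v = n div r + 1};
     return_pmf (splice_word n m r a (\<lambda>i. if e ! i > 0 then e ! i else v ! (i div r)) w)}"

lemma log_pmf_of_set:
  assumes "finite A" "x \<in> A"
  shows "x \<in> set_pmf (pmf_of_set A)" "- log 2 (pmf (pmf_of_set A) x) = log 2 (real (card A))"
proof -
  have "A \<noteq> {}" using assms by blast
  then show "x \<in> set_pmf (pmf_of_set A)" "- log 2 (pmf (pmf_of_set A) x) = log 2 (real (card A))"
    using assms by (auto simp: log_divide card_gt_0_iff)
qed

lemma splice_source_bits:
  fixes m :: "nat list"
  assumes x: "x \<in> words n" and q: "set_pmf q = alphabet" and K: "K \<ge> 1"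
    and a: "a < r" and w: "w \<in> set_pmf (\<Lambda> (key K x))"
  defines "y \<equiv> splice_word n m r a (\<lambda>i. x ! i) w"
  shows "y \<in> set_pmf (splice_source q n K r m \<Lambda>)" (is "?Y")
    and "- log 2 (pmf (splice_source q n K r m \<Lambda>) y) \<le>
      code_bits (map_pmf (clip K) q) (map (clip K) x) + real K * log 2 (real n + 1)
      - log 2 (pmf (\<Lambda> (key K x)) w) + log 2 (real r) + real (n div r + 1) * log 2 (real K)" (is ?bits)
proof -
  define e where "e = map (clip K) x"
  define t where "t = map (count_list x) [1..<Suc K]"
  \<comment> \<open>The default 1 fills entries whose position lies beyond the word or carries a
    letter above \<open>K\<close>.\<close>
  define g where "g j = (if j * r + a < n \<and> x ! (j * r + a) \<le> K then x ! (j * r + a) else 1)" for j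
  define v where "v = map g [0..<n div r + 1]"
  define T where "T = {t. set t \<subseteq> {..n} \<and> length t = K}"
  define V where "V = {v. set v \<subseteq> {1..K} \<and> length v = n div r + 1}"
  define z where "z v i = (if e ! i > 0 then e ! i else v ! (i div r))" for v i
  have xl: "length x = n" using x by (simp add: words_def)
  have key: "key K x = (e, t)" by (simp add: key_def e_def t_def)
  have "clip K ` set x \<subseteq> clip K ` alphabet" using x by (intro image_mono) (simp add: words_def)
  then have e_sub: "set e \<subseteq> set_pmf (map_pmf (clip K) q)" using q by (simp add: e_def)
  have e: "e \<in> set_pmf (replicate_pmf n (map_pmf (clip K) q))"
    using e_sub xl by (simp add: set_replicate_pmf e_def lists_eq_set)
  have e_bits: "- log 2 (pmf (replicate_pmf n (map_pmf (clip K) q)) e) = code_bits (map_pmf (clip K) q) e"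
    using e_sub xl by (intro log_pmf_replicate_pmf) (simp_all add: e_def)
  have T: "finite T" unfolding T_def by (rule finite_lists_length_eq) simp
  have t: "t \<in> T" using count_le_length[of x] by (auto simp: T_def t_def xl)
  have T_bits: "log 2 (real (card T)) = real K * log 2 (real n + 1)"
    unfolding T_def by (subst card_lists_length_eq) (auto simp: log_nat_power add.commute)
  have V: "finite V" unfolding V_def by (rule finite_lists_length_eq) simp
  have "g j \<in> {1..K}" for j
    using K words_nth[OF x, of "j * r + a"] by (auto simp: g_def)
  then have v: "v \<in> V" unfolding V_def v_def by (simp add: image_subset_iff del: upt_Suc)
  have V_bits: "log 2 (real (card V)) = real (n div r + 1) * log 2 (real K)"
    unfolding V_def using K by (subst card_lists_length_eq) (auto simp: log_nat_power simp del: power_Suc)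
  have "y = splice_word n m r a (z v) w"
    unfolding y_def splice_word_def
  proof (intro map_cong refl if_cong)
    fix i assume i: "i \<in> set [0..<n]" "i mod r = a"
    then have "i div r * r + a = i" by (metis div_mult_mod_eq)
    moreover have "i div r < n div r + 1" using i(1) div_le_mono[of i n r] by simp
    ultimately have "v ! (i div r) = (if x ! i \<le> K then x ! i else 1)"
      using i by (simp add: v_def g_def del: upt_Suc)
    then show "x ! i = z v i" using i xl by (auto simp: z_def e_def clip_def)
  qed
  \<comment> \<open>\<open>F1\<close> to \<open>F5\<close> name the remainders of the program after
    each draw, so that \<open>log_pmf_bind\<close> handles one draw at a time.\<close>
  define F5 where "F5 a v = return_pmf (splice_word n m r a (z v) w)" for a v
  define F4 where "F4 a = bind_pmf (pmf_of_set V) (F5 a)" for a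
  define F3 where "F3 w = (do {a \<leftarrow> pmf_of_set {..<r}; v \<leftarrow> pmf_of_set V; return_pmf (splice_word n m r a (z v) w)})" for w
  define F2 where "F2 t = bind_pmf (\<Lambda> (e, t)) F3" for t
  define F1 where "F1 e = (do {t \<leftarrow> pmf_of_set T; w \<leftarrow> \<Lambda> (e, t); a \<leftarrow> pmf_of_set {..<r}; v \<leftarrow> pmf_of_set V;
    return_pmf (splice_word n m r a (\<lambda>i. if e ! i > 0 then e ! i else v ! (i div r)) w)})" for e
  have src: "splice_source q n K r m \<Lambda> = bind_pmf (replicate_pmf n (map_pmf (clip K) q)) F1"
    unfolding splice_source_def F1_def T_def V_def ..
  have F1: "F1 e = bind_pmf (pmf_of_set T) F2" unfolding F1_def F2_def F3_def z_def ..
  have F3: "F3 w = bind_pmf (pmf_of_set {..<r}) F4" unfolding F3_def F4_def F5_def ..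
  have s5: "y \<in> set_pmf (F5 a v)" and b5: "- log 2 (pmf (F5 a v) y) = 0"
    using \<open>y = splice_word n m r a (z v) w\<close> by (simp_all add: F5_def)
  note sV = log_pmf_of_set[OF V v] and sT = log_pmf_of_set[OF T t]
  have a': "a \<in> {..<r}" using a by simp
  note sr = log_pmf_of_set[OF finite_lessThan a']
  have s4: "y \<in> set_pmf (F4 a)" using sV(1) s5 by (auto simp: F4_def)
  have s3: "y \<in> set_pmf (F3 w)" using sr(1) s4 unfolding F3 set_bind_pmf by blast
  have s2: "y \<in> set_pmf (F2 t)" using w s3 unfolding F2_def key set_bind_pmf by blast
  have s1: "y \<in> set_pmf (F1 e)" using sT(1) s2 unfolding F1 set_bind_pmf by blast
  show ?Y using e s1 unfolding src set_bind_pmf by blast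
  have b4: "- log 2 (pmf (F4 a) y) \<le> - log 2 (pmf (pmf_of_set V) v) - log 2 (pmf (F5 a v) y)"
    unfolding F4_def using sV(1) s5 by (rule log_pmf_bind)
  have b3: "- log 2 (pmf (F3 w) y) \<le> - log 2 (pmf (pmf_of_set {..<r}) a) - log 2 (pmf (F4 a) y)"
    unfolding F3 using sr(1) s4 by (rule log_pmf_bind)
  have b2: "- log 2 (pmf (F2 t) y) \<le> - log 2 (pmf (\<Lambda> (e, t)) w) - log 2 (pmf (F3 w) y)"
    unfolding F2_def using w[unfolded key] s3 by (rule log_pmf_bind)
  have b1: "- log 2 (pmf (F1 e) y) \<le> - log 2 (pmf (pmf_of_set T) t) - log 2 (pmf (F2 t) y)"
    unfolding F1 using sT(1) s2 by (rule log_pmf_bind)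
  have b0: "- log 2 (pmf (splice_source q n K r m \<Lambda>) y)
      \<le> - log 2 (pmf (replicate_pmf n (map_pmf (clip K) q)) e) - log 2 (pmf (F1 e) y)"
    unfolding src using e s1 by (rule log_pmf_bind)
  show ?bits
    using b0 b1 b2 b3 b4 b5 sV(2) sr(2) sT(2) T_bits V_bits e_bits
    unfolding key e_def[symmetric] by simp
qed

subsection \<open>The universal code\<close>

text \<open>Overwriting the first letters by a fixed mark makes the quantizer idempotent, at the price of
  coding the few words that start with the mark without distortion. The distortion caused by the mark is
  recovered by transmitting a residue class of positions without distortion.\<close>

lemma spliced_code:
  assumes dist: "distortion \<rho>" and d: "d > 0" and n: "n \<ge> 1" and q: "set_pmf q = alphabet"
    and K: "K \<ge> 2" and t: "2 * t \<le> n" and r: "r \<ge> 1" and M: "M \<ge> 0"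
    and M_bound: "\<forall>a\<in>{1..K}. \<forall>b\<in>{1..K}. \<rho> a b \<le> M"
    and slack: "real (2 * t) * M \<le> real n * d / real r"
  shows "\<exists>\<xi> g. semifaithful_code \<rho> d n \<xi> \<and> (\<forall>x. 0 \<le> g x) \<and>
    (\<forall>x\<in>words n. real (length (encoder \<xi> (quantizer \<xi> x))) \<le>
       (if bad_start K t (take (2 * t) x) then 3 + code_bits q x
        else 3 + code_bits (map_pmf (clip K) q) (map (clip K) x) + real K * log 2 (real n + 1)
          + g x + log 2 (real r) + real (n div r + 1) * log 2 (real K))) \<and>
    (\<forall>x\<in>words n. \<forall>\<psi> \<Lambda>. weak_code \<rho> d n (key_class n K (key K x)) \<psi> \<Lambda> \<longrightarrow>
       sum g (key_class n K (key K x)) \<le>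
         code_cost (key_class n K (key K x)) \<psi> \<Lambda> + real (card (key_class n K (key K x))))"
proof -
  \<comment> \<open>A distribution with full support on the words: it codes the exempt words and
    shows that every nonempty class has some weak code.\<close>
  define W where "W = replicate_pmf n q"
  have W: "set_pmf W = words n" using q by (auto simp: W_def set_replicate_pmf words_def)
  have self: "word_distortion \<rho> n x x \<le> d" if "x \<in> words n" for x
    using word_distortion_self[OF dist that] d by simp
  have "\<exists>\<psi> \<Lambda>. key_class n K k \<noteq> {} \<longrightarrow> weak_code \<rho> d n (key_class n K k) \<psi> \<Lambda> \<and>
    (\<forall>\<psi>' \<Lambda>'. weak_code \<rho> d n (key_class n K k) \<psi>' \<Lambda>' \<longrightarrow>
      code_cost (key_class n K k) \<psi> \<Lambda> \<le> code_cost (key_class n K k) \<psi>' \<Lambda>' + real (card (key_class n K k)))" for k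
  proof (cases "key_class n K k = {}")
    case False
    have "weak_code \<rho> d n (key_class n K k) (\<lambda>x. x) W"
      using self by (auto simp: weak_code_def W key_class_def)
    from near_optimal_weak_code[OF finite_key_class False this] show ?thesis by blast
  qed blast
  then obtain \<Psi> \<Lambda> where opt: "\<And>k. key_class n K k \<noteq> {} \<longrightarrow> weak_code \<rho> d n (key_class n K k) (\<Psi> k) (\<Lambda> k) \<and>
    (\<forall>\<psi>' \<Lambda>'. weak_code \<rho> d n (key_class n K k) \<psi>' \<Lambda>' \<longrightarrow>
      code_cost (key_class n K k) (\<Psi> k) (\<Lambda> k) \<le> code_cost (key_class n K k) \<psi>' \<Lambda>' + real (card (key_class n K k)))"
    by metis
  have self_class: "x \<in> key_class n K (key K x)" if "x \<in> words n" for x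
    using that by (simp add: key_class_def)
  define w where "w x = \<Psi> (key K x) x" for x
  have w: "w x \<in> words n" "word_distortion \<rho> n x (w x) \<le> d" "w x \<in> set_pmf (\<Lambda> (key K x))"
    if "x \<in> words n" for x
    using opt[of "key K x"] self_class[OF that] by (auto simp: weak_code_def w_def)
  define m where "m = mark_word t"
  have m: "length m = 2 * t" "set m \<subseteq> {1, 2}"
    unfolding m_def using length_mark_word set_mark_word by auto
  define bad where "bad x = bad_start K t (take (2 * t) x)" for x
  have "\<exists>a. a < r \<and> (\<Sum>i<n. \<rho> (x ! i) (w x ! i)) \<le> real r * (\<Sum>i<n. if i mod r = a then \<rho> (x ! i) (w x ! i) else 0)" for x
    using exists_heavy_residue[OF r] by simp
  then have "\<exists>a. \<forall>x. a x < r \<and>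
    (\<Sum>i<n. \<rho> (x ! i) (w x ! i)) \<le> real r * (\<Sum>i<n. if i mod r = a x then \<rho> (x ! i) (w x ! i) else 0)"
    by (intro choice) (rule allI)
  then obtain a where a': "\<forall>x. a x < r \<and>
    (\<Sum>i<n. \<rho> (x ! i) (w x ! i)) \<le> real r * (\<Sum>i<n. if i mod r = a x then \<rho> (x ! i) (w x ! i) else 0)"
    by (rule exE)
  note a = a'[rule_format, THEN conjunct1] a'[rule_format, THEN conjunct2]
  define \<phi> where "\<phi> x = (if bad x then x else splice_word n m r (a x) (\<lambda>i. x ! i) (w x))" for x
  define g where "g x = - log 2 (pmf (\<Lambda> (key K x)) (w x))" for x
  \<comment> \<open>The coin separates the two codes for one bit; with the two bits of
    \<open>prefix_code_of_pmf\<close> this gives the constant 3.\<close>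
  define Q where "Q = bind_pmf (bernoulli_pmf (1/2)) (\<lambda>b. if b then W else splice_source q n K r m \<Lambda>)"
  have half: "- log 2 (pmf (bernoulli_pmf (1/2)) b) = 1" "b \<in> set_pmf (bernoulli_pmf (1/2))" for b
    by (cases b; simp add: set_pmf_bernoulli log_divide)+
  have \<phi>_in: "\<phi> x \<in> words n" if x: "x \<in> words n" for x
  proof -
    have "splice_word n m r (a x) (\<lambda>i. x ! i) (w x) \<in> words n"
    proof -
      have "(if i < length m then m ! i else if i mod r = a x then x ! i else w x ! i) \<in> alphabet" if "i < n" for i
        using subsetD[OF m(2) nth_mem[of i m]] words_nth[OF x that] words_nth[OF w(1)[OF x] that] by auto
      note letter = this
      have "set (splice_word n m r (a x) (\<lambda>i. x ! i) (w x)) \<subseteq> alphabet"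
        unfolding splice_word_def set_map set_upt
      proof (rule image_subsetI)
        fix i assume "i \<in> {0..<n}"
        then show "(if i < length m then m ! i else if i mod r = a x then x ! i else w x ! i) \<in> alphabet"
          using letter[of i] by simp
      qed
      then show ?thesis by (simp add: words_def splice_word_def)
    qed
    then show ?thesis using x by (simp add: \<phi>_def)
  qed
  have \<phi>_d: "word_distortion \<rho> n x (\<phi> x) \<le> d" if x: "x \<in> words n" for x
  proof (cases "bad x")
    case False
    \<comment> \<open>Outside the exempt starts all overwritten letters are at most
      \<open>K\<close>, as are those of the mark, so \<open>M\<close> applies.\<close>
    have small: "\<rho> (x ! i) (m ! i) \<le> M" if i: "i < length m" for i
    proof (rule M_bound[rule_format])
      have "i < length (take (2 * t) x)" using x i m t by (simp add: words_def)
      then have "take (2 * t) x ! i \<in> set (take (2 * t) x)" by (rule nth_mem)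
      then have "x ! i \<le> K" using False i m by (auto simp: bad_def bad_start_def)
      then show "x ! i \<in> {1..K}" using words_nth[OF x, of i] i m t by simp
      show "m ! i \<in> {1..K}" using nth_mem[OF i] m(2) K by auto
    qed
    have "word_distortion \<rho> n x (splice_word n m r (a x) (\<lambda>i. x ! i) (w x)) \<le> d"
      by (rule splice_word_distortion[OF dist n x w(1,2)[OF x] _ small M r _ a(2)]) (use m t slack in auto)
    then show ?thesis using False by (simp add: \<phi>_def)
  qed (use self[OF x] in \<open>simp add: \<phi>_def\<close>)
  \<comment> \<open>A value of the quantizer is an exempt word itself or starts with the mark;
    either way it is exempt, hence a fixed point.\<close>
  have bad_\<phi>: "bad (\<phi> x)" for x
  proof (cases "bad x")
    case False
    have "take (2 * t) (\<phi> x) = m" using False take_splice_word[of m n] m t by (simp add: \<phi>_def)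
    then show ?thesis by (simp add: bad_def bad_start_def m_def)
  qed (simp add: \<phi>_def)
  have \<phi>_idem: "\<phi> (\<phi> x) = \<phi> x" for x using bad_\<phi>[of x] by (subst \<phi>_def) simp
  have Q_bits: "\<phi> x \<in> set_pmf Q \<and> - log 2 (pmf Q (\<phi> x)) \<le> (if bad x then 1 + code_bits q x
        else 1 + code_bits (map_pmf (clip K) q) (map (clip K) x) + real K * log 2 (real n + 1)
          + g x + log 2 (real r) + real (n div r + 1) * log 2 (real K))" if x: "x \<in> words n" for x
  proof (cases "bad x")
    case True
    have xW: "x \<in> set_pmf (if True then W else splice_source q n K r m \<Lambda>)" using x W by simp
    have "- log 2 (pmf Q x) \<le> - log 2 (pmf (bernoulli_pmf (1/2)) True) - log 2 (pmf (if True then W else splice_source q n K r m \<Lambda>) x)"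
      unfolding Q_def using half(2) xW by (rule log_pmf_bind)
    moreover have "- log 2 (pmf W x) = code_bits q x"
      unfolding W_def using x q by (intro log_pmf_replicate_pmf) (auto simp: words_def)
    moreover have "x \<in> set_pmf Q" unfolding Q_def set_bind_pmf using half(2)[of True] xW by blast
    ultimately show ?thesis using True half(1)[of True] by (simp add: \<phi>_def)
  next
    case False
    have K1: "K \<ge> 1" using K by simp
    let ?y = "splice_word n m r (a x) (\<lambda>i. x ! i) (w x)"
    note bits = splice_source_bits[where m = m and \<Lambda> = \<Lambda>, OF x q K1 a(1)[of x] w(3)[OF x]]
    have yW: "?y \<in> set_pmf (if False then W else splice_source q n K r m \<Lambda>)" using bits(1) by simp
    have "- log 2 (pmf Q ?y) \<le> - log 2 (pmf (bernoulli_pmf (1/2)) False) - log 2 (pmf (if False then W else splice_source q n K r m \<Lambda>) ?y)"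
      unfolding Q_def using half(2) yW by (rule log_pmf_bind)
    moreover have "?y \<in> set_pmf Q" unfolding Q_def set_bind_pmf using half(2)[of False] yW by blast
    ultimately show ?thesis using False half(1)[of False] bits(2) by (simp add: \<phi>_def g_def)
  qed
  have "\<exists>\<xi>. semifaithful_code \<rho> d n \<xi> \<and>
    (\<forall>x\<in>words n. real (length (encoder \<xi> (quantizer \<xi> x))) \<le> 2 - log 2 (pmf Q (\<phi> x)))"
    using \<phi>_in \<phi>_d \<phi>_idem Q_bits by (intro semifaithful_code_of_pmf) blast+
  then obtain \<xi> where \<xi>: "semifaithful_code \<rho> d n \<xi>"
    "\<And>x. x \<in> words n \<Longrightarrow> real (length (encoder \<xi> (quantizer \<xi> x))) \<le> 2 - log 2 (pmf Q (\<phi> x))" by blast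
  show ?thesis
  proof (intro exI[of _ \<xi>] exI[of _ g] conjI allI ballI impI \<xi>(1))
    show "0 \<le> g x" for x unfolding g_def by (rule neg_log_pmf_nonneg)
  next
    fix x assume x: "x \<in> words n"
    show "real (length (encoder \<xi> (quantizer \<xi> x))) \<le>
       (if bad_start K t (take (2 * t) x) then 3 + code_bits q x
        else 3 + code_bits (map_pmf (clip K) q) (map (clip K) x) + real K * log 2 (real n + 1)
          + g x + log 2 (real r) + real (n div r + 1) * log 2 (real K))"
      using \<xi>(2)[OF x] Q_bits[OF x] unfolding bad_def[symmetric] by (cases "bad x") auto
  next
    fix x \<psi> \<Lambda>'
    let ?C = "key_class n K (key K x)"
    assume x: "x \<in> words n" and wc: "weak_code \<rho> d n ?C \<psi> \<Lambda>'"
    have "sum g ?C = code_cost ?C (\<Psi> (key K x)) (\<Lambda> (key K x))"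
      unfolding code_cost_def by (intro sum.cong) (auto simp: g_def w_def key_class_def)
    also have "\<dots> \<le> code_cost ?C \<psi> \<Lambda>' + real (card ?C)"
      using opt[of "key K x"] self_class[OF x] wc by blast
    finally show "sum g ?C \<le> code_cost ?C \<psi> \<Lambda>' + real (card ?C)" .
  qed
qed

section \<open>Expected code lengths under a memoryless source\<close>

lemma nn_integral_sum_list:
  fixes h :: "'a \<Rightarrow> ennreal"
  shows "(\<integral>\<^sup>+x. (\<Sum>a\<leftarrow>x. h a) \<partial>replicate_pmf n \<mu>) = of_nat n * (\<integral>\<^sup>+a. h a \<partial>\<mu>)"
proof (induction n)
  case (Suc n)
  have "(\<integral>\<^sup>+x. (\<Sum>a\<leftarrow>x. h a) \<partial>replicate_pmf (Suc n) \<mu>)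
    = (\<integral>\<^sup>+a. \<integral>\<^sup>+x. h a + (\<Sum>a\<leftarrow>x. h a) \<partial>replicate_pmf n \<mu> \<partial>\<mu>)"
    by simp
  also have "\<dots> = (\<integral>\<^sup>+a. h a + (\<integral>\<^sup>+x. (\<Sum>a\<leftarrow>x. h a) \<partial>replicate_pmf n \<mu>) \<partial>\<mu>)"
    by (intro nn_integral_cong, subst nn_integral_add) auto
  also have "\<dots> = (\<integral>\<^sup>+a. h a \<partial>\<mu>) + (\<integral>\<^sup>+x. (\<Sum>a\<leftarrow>x. h a) \<partial>replicate_pmf n \<mu>)"
    by (subst nn_integral_add) auto
  finally show ?case by (simp add: Suc.IH algebra_simps)
qed auto

lemma ennreal_code_bits: "ennreal (code_bits p x) = (\<Sum>a\<leftarrow>x. ennreal (- log 2 (pmf p a)))"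
proof (induction x)
  case (Cons a x)
  have "code_bits p (a # x) = - log 2 (pmf p a) + code_bits p x" by (simp add: code_bits_def)
  then have "ennreal (code_bits p (a # x)) = ennreal (- log 2 (pmf p a)) + ennreal (code_bits p x)"
    using ennreal_plus[OF neg_log_pmf_nonneg[of p a] code_bits_nonneg[of p x]] by simp
  then show ?case using Cons.IH by simp
qed (simp add: code_bits_def)

text \<open>The cross entropy of \<open>\<mu>\<close> relative to \<open>p\<close>, possibly
  infinite.\<close>

definition letter_bits :: "'a pmf \<Rightarrow> 'a pmf \<Rightarrow> ennreal" where
  "letter_bits p \<mu> = (\<integral>\<^sup>+a. ennreal (- log 2 (pmf p a)) \<partial>\<mu>)"

lemma nn_integral_code_bits:
  "(\<integral>\<^sup>+x. ennreal (code_bits p x) \<partial>replicate_pmf n \<mu>) = of_nat n * letter_bits p \<mu>"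
  unfolding ennreal_code_bits letter_bits_def by (rule nn_integral_sum_list)

lemma prob_bad_start:
  assumes "K \<ge> 2"
  shows "emeasure (replicate_pmf (2 * t) \<mu>) {u. bad_start K t u} \<le>
    ennreal ((1/4) ^ t) + of_nat (2 * t) * emeasure \<mu> {K<..}"
proof -
  let ?P = "replicate_pmf (2 * t) \<mu>"
  have "emeasure ?P {mark_word t} = ennreal ((pmf \<mu> 1 * pmf \<mu> 2) ^ t)"
  proof -
    have "prod_list (map (pmf \<mu>) (mark_word t)) = (pmf \<mu> 1 * pmf \<mu> 2) ^ t"
      by (induction t) (simp_all add: mark_word_def)
    then show ?thesis by (simp add: emeasure_pmf_single pmf_replicate_pmf length_mark_word)
  qed
  also have "\<dots> \<le> ennreal ((1/4) ^ t)"
  proof (intro ennreal_leI power_mono)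
    have "pmf \<mu> 1 + pmf \<mu> 2 = measure_pmf.prob \<mu> {1, 2}" by (simp add: measure_measure_pmf_finite)
    then have "pmf \<mu> 1 + pmf \<mu> 2 \<le> 1" by simp
    then have "pmf \<mu> 1 * pmf \<mu> 2 \<le> pmf \<mu> 1 * (1 - pmf \<mu> 1)" by (intro mult_left_mono) auto
    also have "\<dots> = 1/4 - (pmf \<mu> 1 - 1/2)\<^sup>2" by (simp add: power2_eq_square algebra_simps)
    finally show "pmf \<mu> 1 * pmf \<mu> 2 \<le> 1/4" using zero_le_power2[of "pmf \<mu> 1 - 1/2"] by linarith
  qed simp
  finally have mark: "emeasure ?P {mark_word t} \<le> ennreal ((1/4) ^ t)" .
  have "emeasure ?P {u. \<not> set u \<subseteq> {..K}} = (\<integral>\<^sup>+u. indicator {u. \<not> set u \<subseteq> {..K}} u \<partial>?P)"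
    by simp
  also have "\<dots> \<le> (\<integral>\<^sup>+u. (\<Sum>a\<leftarrow>u. indicator {K<..} a) \<partial>?P)"
  proof (intro nn_integral_mono)
    fix u :: "nat list"
    show "indicator {u. \<not> set u \<subseteq> {..K}} u \<le> (\<Sum>a\<leftarrow>u. indicator {K<..} a :: ennreal)"
    proof (cases "set u \<subseteq> {..K}")
      case False
      then obtain b where b: "b \<in> set u" "b > K" by (meson atMost_iff not_le subsetI)
      then have "(indicator {K<..} b :: ennreal) \<le> (\<Sum>a\<leftarrow>u. indicator {K<..} a)"
        by (intro member_le_sum_list) (auto intro!: image_eqI[of _ _ b])
      then show ?thesis using b(2) False by simp
    qed simp
  qed
  also have "\<dots> = of_nat (2 * t) * emeasure \<mu> {K<..}" by (simp add: nn_integral_sum_list)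
  finally have large: "emeasure ?P {u. \<not> set u \<subseteq> {..K}} \<le> of_nat (2 * t) * emeasure \<mu> {K<..}" .
  have "{u. bad_start K t u} = {mark_word t} \<union> {u. \<not> set u \<subseteq> {..K}}"
    by (auto simp: bad_start_def)
  then have "emeasure ?P {u. bad_start K t u} \<le> emeasure ?P {mark_word t} + emeasure ?P {u. \<not> set u \<subseteq> {..K}}"
    using emeasure_subadditive[of "{mark_word t}" ?P "{u. \<not> set u \<subseteq> {..K}}"] by simp
  also have "\<dots> \<le> ennreal ((1/4) ^ t) + of_nat (2 * t) * emeasure \<mu> {K<..}"
    using mark large by (rule add_mono)
  finally show ?thesis .
qed

text \<open>The event concerns only the first \<open>s\<close> letters. Their own length is counted
  in full; the other letters are independent of the event, so their expected length is multiplied by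
  its probability. Thus the first moment of the code length of a letter suffices.\<close>

lemma nn_integral_bad_code_bits:
  assumes "s \<le> n"
  shows "(\<integral>\<^sup>+x. indicator B (take s x) * ennreal (code_bits q x) \<partial>replicate_pmf n \<mu>)
    \<le> (of_nat s + of_nat n * emeasure (replicate_pmf s \<mu>) B) * letter_bits q \<mu>"
proof -
  obtain k where n: "n = s + k" using assms le_Suc_ex by blast
  have app: "ennreal (code_bits q (u @ v)) = ennreal (code_bits q u) + ennreal (code_bits q v)" for u v
    by (simp add: ennreal_code_bits)
  have "(\<integral>\<^sup>+x. indicator B (take s x) * ennreal (code_bits q x) \<partial>replicate_pmf n \<mu>)
    = (\<integral>\<^sup>+u. \<integral>\<^sup>+v. indicator B (take s (u @ v)) * ennreal (code_bits q (u @ v)) \<partial>replicate_pmf k \<mu> \<partial>replicate_pmf s \<mu>)"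
    unfolding n replicate_pmf_distrib by simp
  also have "\<dots> \<le> (\<integral>\<^sup>+u. \<integral>\<^sup>+v. ennreal (code_bits q u) + indicator B u * ennreal (code_bits q v) \<partial>replicate_pmf k \<mu> \<partial>replicate_pmf s \<mu>)"
  proof (intro nn_integral_mono_AE, unfold AE_measure_pmf_iff, intro ballI)
    fix u assume "u \<in> set_pmf (replicate_pmf s \<mu>)"
    then have u: "length u = s" by (simp add: set_replicate_pmf)
    show "(\<integral>\<^sup>+v. indicator B (take s (u @ v)) * ennreal (code_bits q (u @ v)) \<partial>replicate_pmf k \<mu>)
      \<le> (\<integral>\<^sup>+v. ennreal (code_bits q u) + indicator B u * ennreal (code_bits q v) \<partial>replicate_pmf k \<mu>)"
      by (intro nn_integral_mono) (auto simp: app u indicator_def)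
  qed
  also have "\<dots> = (\<integral>\<^sup>+u. ennreal (code_bits q u) + indicator B u * (of_nat k * letter_bits q \<mu>) \<partial>replicate_pmf s \<mu>)"
    by (intro nn_integral_cong) (simp add: nn_integral_add nn_integral_cmult nn_integral_code_bits)
  also have "\<dots> = of_nat s * letter_bits q \<mu> + emeasure (replicate_pmf s \<mu>) B * (of_nat k * letter_bits q \<mu>)"
    by (simp add: nn_integral_add nn_integral_multc nn_integral_code_bits)
  also have "\<dots> \<le> of_nat s * letter_bits q \<mu> + emeasure (replicate_pmf s \<mu>) B * (of_nat n * letter_bits q \<mu>)"
    unfolding n by (intro add_left_mono mult_left_mono mult_right_mono) auto
  finally show ?thesis by (simp add: algebra_simps)
qed

lemma le_INF_add_const:
  fixes x c :: ennreal
  assumes "\<And>i. i \<in> I \<Longrightarrow> x \<le> f i + c"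
  shows "x \<le> (INF i\<in>I. f i) + c"
proof (cases "c = top")
  case False
  have "x - c \<le> (INF i\<in>I. f i)"
    using assms False by (intro INF_greatest) (auto simp: ennreal_minus_le_iff add.commute)
  then show ?thesis using False by (simp add: ennreal_minus_le_iff add.commute)
qed simp

text \<open>A partition provides a competitor on every class: words go to the centre of their cell,
  coded with the distribution of the centre under the source itself. \<open>opt\<close> covers it
  because it admits every distribution on codewords.\<close>

lemma class_bits_le_partition_entropy:
  assumes sup: "set_pmf \<mu> \<subseteq> alphabet" and g: "\<And>x. 0 \<le> g x"
    and opt: "\<And>x \<psi> \<Lambda>. x \<in> words n \<Longrightarrow> weak_code \<rho> d n (key_class n K (key K x)) \<psi> \<Lambda> \<Longrightarrow>
       sum g (key_class n K (key K x)) \<le>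
         code_cost (key_class n K (key K x)) \<psi> \<Lambda> + real (card (key_class n K (key K x)))"
    and \<pi>: "\<pi> \<in> admissible_partitions \<rho> d n"
  shows "(\<integral>\<^sup>+x. ennreal (g x) \<partial>replicate_pmf n \<mu>) \<le> partition_entropy \<pi> (replicate_pmf n \<mu>) + 1"
proof -
  define P where "P = replicate_pmf n \<mu>"
  have PW: "set_pmf P \<subseteq> words n" unfolding P_def using sup by (rule set_replicate_pmf_words)
  have part: "partition_on (words n) \<pi>" using \<pi> by (simp add: admissible_partitions_def)
  define cell where "cell x = (THE A. A \<in> \<pi> \<and> x \<in> A)" for x
  have cell_eq: "cell x = A" if "A \<in> \<pi>" "x \<in> A" for x A
    unfolding cell_def using part that by (intro the_equality) (auto simp: partition_on_def disjoint_def)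
  have cell: "cell x \<in> \<pi> \<and> x \<in> cell x" if "x \<in> words n" for x
  proof -
    from that part obtain A where "A \<in> \<pi>" "x \<in> A" by (auto simp: partition_on_def)
    with cell_eq[OF this] show ?thesis by simp
  qed
  have "\<exists>y\<in>A. \<forall>x\<in>A. word_distortion \<rho> n x y \<le> d" if A: "A \<in> \<pi>" for A
  proof -
    from \<pi> A obtain y where y: "y \<in> A" "(SUP x\<in>A. ereal (word_distortion \<rho> n x y)) \<le> ereal d"
      by (auto simp: admissible_partitions_def)
    then have "ereal (word_distortion \<rho> n x y) \<le> ereal d" if "x \<in> A" for x
      using that by (simp add: SUP_le_iff)
    with y(1) show ?thesis by auto
  qed
  then obtain ctr where ctr: "\<And>A. A \<in> \<pi> \<Longrightarrow> ctr A \<in> A" "\<And>A x. A \<in> \<pi> \<Longrightarrow> x \<in> A \<Longrightarrow> word_distortion \<rho> n x (ctr A) \<le> d"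
    by metis
  define \<psi> where "\<psi> x = ctr (cell x)" for x
  define h where "h x = - log 2 (measure_pmf.prob P (cell x))" for x
  have h: "0 \<le> h x" for x
  proof (cases "measure_pmf.prob P (cell x) = 0")
    case False
    then have "0 < measure_pmf.prob P (cell x)" by (simp add: less_le)
    then show ?thesis by (simp add: h_def)
  qed (simp add: h_def log_def)
  have "(\<integral>\<^sup>+x. ennreal (g x) \<partial>replicate_pmf n \<mu>) \<le> (\<integral>\<^sup>+x. ennreal (h x) \<partial>replicate_pmf n \<mu>) + 1"
  proof (rule nn_integral_le_by_key_class[OF sup g h])
    fix x C assume x: "x \<in> set_pmf (replicate_pmf n \<mu>)" and C: "C = key_class n K (key K x)"
      and CP: "C \<subseteq> set_pmf (replicate_pmf n \<mu>)"
    have xw: "x \<in> words n" using x PW by (auto simp: P_def)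
    have CW: "y \<in> words n" "y \<in> set_pmf P" if "y \<in> C" for y
      using that CP PW by (auto simp: P_def)
    have "weak_code \<rho> d n C \<psi> (map_pmf \<psi> P)"
      unfolding weak_code_def
    proof (intro ballI conjI)
      fix y assume y: "y \<in> C"
      note cy = cell[OF CW(1)[OF y]]
      show "\<psi> y \<in> words n" using ctr(1)[of "cell y"] cy part by (auto simp: \<psi>_def partition_on_def)
      show "word_distortion \<rho> n y (\<psi> y) \<le> d" using ctr(2)[of "cell y" y] cy by (simp add: \<psi>_def)
      show "\<psi> y \<in> set_pmf (map_pmf \<psi> P)" using CW(2)[OF y] by simp
    qed
    then have "sum g C \<le> code_cost C \<psi> (map_pmf \<psi> P) + real (card C)"
      using opt[OF xw] by (simp add: C)
    also have "code_cost C \<psi> (map_pmf \<psi> P) \<le> sum h C"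
      unfolding code_cost_def
    proof (intro sum_mono)
      fix y assume y: "y \<in> C"
      have "0 < pmf P y" using CW(2)[OF y] by (simp add: pmf_positive)
      also have "pmf P y \<le> measure_pmf.prob P (cell y)"
        using cell[OF CW(1)[OF y]] by (simp flip: measure_pmf_single) (intro measure_pmf.finite_measure_mono, auto)
      finally have pos: "0 < measure_pmf.prob P (cell y)" .
      \<comment> \<open>Words of one cell share their centre, so the centre is at least as likely as
        the cell.\<close>
      have "measure_pmf.prob P (cell y) \<le> measure_pmf.prob P (\<psi> -` {\<psi> y})"
      proof (intro measure_pmf.finite_measure_mono subsetI)
        fix z assume "z \<in> cell y"
        then have "cell z = cell y" using cell[OF CW(1)[OF y]] by (intro cell_eq) auto
        then show "z \<in> \<psi> -` {\<psi> y}" by (simp add: \<psi>_def)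
      qed simp
      then show "- log 2 (pmf (map_pmf \<psi> P) (\<psi> y)) \<le> h y"
        using pos unfolding h_def pmf_map by simp
    qed
    finally show "sum g C \<le> sum h C + real (card C)" by simp
  qed
  also have "(\<integral>\<^sup>+x. ennreal (h x) \<partial>replicate_pmf n \<mu>) \<le> partition_entropy \<pi> P"
  proof -
    have "(\<integral>\<^sup>+x. ennreal (h x) \<partial>P) = (\<integral>\<^sup>+A. ennreal (- log 2 (measure_pmf.prob P A)) \<partial>map_pmf cell P)"
      by (simp add: h_def)
    also have "\<dots> = (\<integral>\<^sup>+A. ennreal (pmf (map_pmf cell P) A) * ennreal (- log 2 (measure_pmf.prob P A)) \<partial>count_space UNIV)"
      by (rule nn_integral_measure_pmf)
    also have "\<dots> = (\<integral>\<^sup>+A. ennreal (- (measure_pmf.prob P A * log 2 (measure_pmf.prob P A))) * indicator \<pi> A \<partial>count_space UNIV)"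
    proof (intro nn_integral_cong)
      fix A :: "nat list set"
      show "ennreal (pmf (map_pmf cell P) A) * ennreal (- log 2 (measure_pmf.prob P A))
        = ennreal (- (measure_pmf.prob P A * log 2 (measure_pmf.prob P A))) * indicator \<pi> A"
      proof (cases "A \<in> \<pi>")
        case True
        have "pmf (map_pmf cell P) A = measure_pmf.prob P A"
          unfolding pmf_map
        proof (rule measure_pmf.finite_measure_eq_AE)
          show "AE x in measure_pmf P. (x \<in> cell -` {A}) = (x \<in> A)"
            unfolding AE_measure_pmf_iff using cell cell_eq[OF True] PW by blast
        qed auto
        then have "ennreal (pmf (map_pmf cell P) A) * ennreal (- log 2 (measure_pmf.prob P A))
          = ennreal (measure_pmf.prob P A * - log 2 (measure_pmf.prob P A))"
          by (simp only: ennreal_mult'[OF measure_nonneg])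
        then show ?thesis using True by simp
      next
        case False
        have "A \<notin> cell ` set_pmf P" using cell PW False by blast
        then have "pmf (map_pmf cell P) A = 0" by (rule pmf_map_outside)
        then show ?thesis using False by simp
      qed
    qed
    also have "\<dots> = partition_entropy \<pi> P"
      unfolding partition_entropy_def by (rule nn_integral_count_space_indicator[symmetric]) simp
    finally show ?thesis by (simp add: P_def)
  qed
  finally show ?thesis by (simp add: P_def add_right_mono)
qed

lemma spliced_code_rate:
  assumes dist: "distortion \<rho>" and d: "d > 0" and n: "n \<ge> 1" and q: "set_pmf q = alphabet"
    and K: "K \<ge> 2" and t: "2 * t \<le> n" and r: "r \<ge> 1" and M: "M \<ge> 0"
    and M_bound: "\<forall>a\<in>{1..K}. \<forall>b\<in>{1..K}. \<rho> a b \<le> M"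
    and slack: "real (2 * t) * M \<le> real n * d / real r"
  shows "\<exists>\<xi>. semifaithful_code \<rho> d n \<xi> \<and> (\<forall>\<mu>. set_pmf \<mu> \<subseteq> alphabet \<longrightarrow>
    rate n \<xi> (replicate_pmf n \<mu>) \<le> optimal_rate \<rho> d n (replicate_pmf n \<mu>) +
      (ennreal (4 + real K * log 2 (real n + 1) + log 2 (real r) + real (n div r + 1) * log 2 (real K))
       + of_nat n * letter_bits (map_pmf (clip K) q) (map_pmf (clip K) \<mu>)
       + (of_nat (2 * t) + of_nat n * (ennreal ((1/4) ^ t) + of_nat (2 * t) * emeasure \<mu> {K<..})) * letter_bits q \<mu>)
      / of_nat n)"
proof -
  obtain \<xi> g where \<xi>: "semifaithful_code \<rho> d n \<xi>" and g: "\<And>x. 0 \<le> g x"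
    and len: "\<And>x. x \<in> words n \<Longrightarrow> real (length (encoder \<xi> (quantizer \<xi> x))) \<le>
       (if bad_start K t (take (2 * t) x) then 3 + code_bits q x
        else 3 + code_bits (map_pmf (clip K) q) (map (clip K) x) + real K * log 2 (real n + 1)
          + g x + log 2 (real r) + real (n div r + 1) * log 2 (real K))"
    and opt: "\<And>x \<psi> \<Lambda>. x \<in> words n \<Longrightarrow> weak_code \<rho> d n (key_class n K (key K x)) \<psi> \<Lambda> \<Longrightarrow>
       sum g (key_class n K (key K x)) \<le>
         code_cost (key_class n K (key K x)) \<psi> \<Lambda> + real (card (key_class n K (key K x)))"
    using spliced_code[OF dist d n q K t r M M_bound slack] by (elim exE conjE) (rule that; blast)
  \<comment> \<open>The 4 of the statement is this 3 plus the bit lost in averaging over the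
    classes.\<close>
  define c where "c = 3 + real K * log 2 (real n + 1) + log 2 (real r) + real (n div r + 1) * log 2 (real K)"
  have c0: "0 \<le> real K * log 2 (real n + 1)" "0 \<le> log 2 (real r)" "0 \<le> real (n div r + 1) * log 2 (real K)"
    using r K by auto
  then have c: "3 \<le> c" unfolding c_def by linarith
  have "rate n \<xi> (replicate_pmf n \<mu>) \<le> optimal_rate \<rho> d n (replicate_pmf n \<mu>) +
      (ennreal (c + 1)
       + of_nat n * letter_bits (map_pmf (clip K) q) (map_pmf (clip K) \<mu>)
       + (of_nat (2 * t) + of_nat n * (ennreal ((1/4) ^ t) + of_nat (2 * t) * emeasure \<mu> {K<..})) * letter_bits q \<mu>)
      / of_nat n" (is "_ \<le> _ + ?R / _") if sup: "set_pmf \<mu> \<subseteq> alphabet" for \<mu>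
  proof -
    define P where "P = replicate_pmf n \<mu>"
    let ?B = "{u. bad_start K t u}"
    have PW: "set_pmf P \<subseteq> words n" unfolding P_def using sup by (rule set_replicate_pmf_words)
    have pw: "of_nat (length (encoder \<xi> (quantizer \<xi> x))) \<le> ennreal c
        + ennreal (code_bits (map_pmf (clip K) q) (map (clip K) x)) + ennreal (g x)
        + indicator ?B (take (2 * t) x) * ennreal (code_bits q x)" if x: "x \<in> words n" for x
    proof -
      let ?e = "code_bits (map_pmf (clip K) q) (map (clip K) x)"
      let ?b = "indicator ?B (take (2 * t) x) * code_bits q x"
      have nn: "0 \<le> ?e" "0 \<le> code_bits q x" by (rule code_bits_nonneg)+
      have "real (length (encoder \<xi> (quantizer \<xi> x))) \<le> c + ?e + g x + ?b"
        using len[OF x] nn g[of x] c by (cases "bad_start K t (take (2 * t) x)") (simp_all add: c_def)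
      then have "of_nat (length (encoder \<xi> (quantizer \<xi> x))) \<le> ennreal (c + ?e + g x + ?b)"
        unfolding ennreal_of_nat_eq_real_of_nat by (rule ennreal_leI)
      also have "\<dots> = ennreal c + ennreal ?e + ennreal (g x) + ennreal ?b"
        using nn g[of x] c by (simp add: ennreal_plus)
      also have "ennreal ?b = indicator ?B (take (2 * t) x) * ennreal (code_bits q x)"
        by (simp add: indicator_def)
      finally show ?thesis .
    qed
    have "(\<integral>\<^sup>+x. of_nat (length (encoder \<xi> (quantizer \<xi> x))) \<partial>P)
      \<le> (\<integral>\<^sup>+x. ennreal c + ennreal (code_bits (map_pmf (clip K) q) (map (clip K) x)) + ennreal (g x)
        + indicator ?B (take (2 * t) x) * ennreal (code_bits q x) \<partial>P)"
      using pw PW by (intro nn_integral_mono_AE) (auto simp: AE_measure_pmf_iff)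
    also have "\<dots> = ennreal c + (\<integral>\<^sup>+x. ennreal (code_bits (map_pmf (clip K) q) (map (clip K) x)) \<partial>P)
        + (\<integral>\<^sup>+x. ennreal (g x) \<partial>P) + (\<integral>\<^sup>+x. indicator ?B (take (2 * t) x) * ennreal (code_bits q x) \<partial>P)"
      by (simp add: nn_integral_add)
    also have "(\<integral>\<^sup>+x. ennreal (code_bits (map_pmf (clip K) q) (map (clip K) x)) \<partial>P)
        = (\<integral>\<^sup>+x. ennreal (code_bits (map_pmf (clip K) q) x) \<partial>replicate_pmf n (map_pmf (clip K) \<mu>))"
      unfolding replicate_pmf_map P_def by simp
    also have "\<dots> = of_nat n * letter_bits (map_pmf (clip K) q) (map_pmf (clip K) \<mu>)"
      by (rule nn_integral_code_bits)
    finally have 1: "(\<integral>\<^sup>+x. of_nat (length (encoder \<xi> (quantizer \<xi> x))) \<partial>P)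
      \<le> ennreal c + of_nat n * letter_bits (map_pmf (clip K) q) (map_pmf (clip K) \<mu>)
        + (\<integral>\<^sup>+x. ennreal (g x) \<partial>P) + (\<integral>\<^sup>+x. indicator ?B (take (2 * t) x) * ennreal (code_bits q x) \<partial>P)" .
    have "(\<integral>\<^sup>+x. indicator ?B (take (2 * t) x) * ennreal (code_bits q x) \<partial>P)
      \<le> (of_nat (2 * t) + of_nat n * emeasure (replicate_pmf (2 * t) \<mu>) ?B) * letter_bits q \<mu>"
      unfolding P_def by (rule nn_integral_bad_code_bits[OF t])
    also have "\<dots> \<le> (of_nat (2 * t) + of_nat n * (ennreal ((1/4) ^ t) + of_nat (2 * t) * emeasure \<mu> {K<..})) * letter_bits q \<mu>"
      by (intro mult_right_mono add_left_mono mult_left_mono prob_bad_start K) auto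
    finally have 2: "(\<integral>\<^sup>+x. indicator ?B (take (2 * t) x) * ennreal (code_bits q x) \<partial>P) \<le> \<dots>" .
    have "(\<integral>\<^sup>+x. of_nat (length (encoder \<xi> (quantizer \<xi> x))) \<partial>P) / of_nat n
        \<le> partition_entropy \<pi> P / of_nat n + ?R / of_nat n" if \<pi>: "\<pi> \<in> admissible_partitions \<rho> d n" for \<pi>
    proof -
      have 3: "(\<integral>\<^sup>+x. ennreal (g x) \<partial>P) \<le> partition_entropy \<pi> P + 1"
        unfolding P_def by (rule class_bits_le_partition_entropy[OF sup g opt \<pi>])
      have "(\<integral>\<^sup>+x. of_nat (length (encoder \<xi> (quantizer \<xi> x))) \<partial>P)
        \<le> ennreal c + of_nat n * letter_bits (map_pmf (clip K) q) (map_pmf (clip K) \<mu>)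
        + (partition_entropy \<pi> P + 1)
        + (of_nat (2 * t) + of_nat n * (ennreal ((1/4) ^ t) + of_nat (2 * t) * emeasure \<mu> {K<..})) * letter_bits q \<mu>"
        by (rule order_trans[OF 1]) (intro add_mono order_refl 2 3)
      also have "\<dots> = partition_entropy \<pi> P + ?R"
      proof -
        have "ennreal (c + 1) = ennreal c + 1" using c by (simp add: ennreal_plus)
        then show ?thesis by (simp only: ac_simps)
      qed
      finally show ?thesis
        unfolding add_divide_distrib_ennreal[symmetric] by (rule divide_right_mono_ennreal)
    qed
    then show ?thesis
      unfolding rate_def optimal_rate_def P_def[symmetric] by (rule le_INF_add_const)
  qed
  with \<xi> show ?thesis by (intro exI[of _ \<xi>]) (simp add: c_def add.commute add.left_commute)
qed

subsection \<open>Vanishing redundancy\<close>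

definition tail_sum :: "(nat \<Rightarrow> ennreal) \<Rightarrow> nat \<Rightarrow> ennreal" where
  "tail_sum h K = (\<integral>\<^sup>+x. indicator {K<..} x * h x \<partial>count_space UNIV)"

lemma tail_sum_antimono: "K \<le> L \<Longrightarrow> tail_sum h L \<le> tail_sum h K"
  unfolding tail_sum_def by (intro nn_integral_mono mult_right_mono) (auto simp: indicator_def)

lemma tail_sum_mono: "(\<And>x. x > K \<Longrightarrow> g x \<le> h x) \<Longrightarrow> tail_sum g K \<le> tail_sum h K"
  unfolding tail_sum_def by (intro nn_integral_mono) (auto simp: indicator_def)

text \<open>Dominated convergence with the summands beyond \<open>N\<close> as majorant. Allowing
  any \<open>N\<close> matters where a bound is available only far out.\<close>

lemma tail_sum_tendsto_0:
  assumes "tail_sum h N < \<infinity>"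
  shows "tail_sum h \<longlonglongrightarrow> 0"
proof -
  have "(\<lambda>j. tail_sum h (j + N)) \<longlonglongrightarrow> (\<integral>\<^sup>+x. 0 \<partial>count_space (UNIV :: nat set))"
    unfolding tail_sum_def
  proof (rule nn_integral_dominated_convergence)
    show "(\<integral>\<^sup>+x. indicator {N<..} x * h x \<partial>count_space UNIV) < \<infinity>"
      using assms by (simp add: tail_sum_def)
    show "AE x in count_space UNIV. (\<lambda>j. indicator {j + N<..} x * h x) \<longlonglongrightarrow> 0"
    proof (rule AE_I2)
      fix x :: nat
      have "eventually (\<lambda>j. indicator {j + N<..} x * h x = 0) sequentially"
        using eventually_ge_at_top[of x] by eventually_elim simp
      then show "(\<lambda>j. indicator {j + N<..} x * h x) \<longlonglongrightarrow> 0" by (rule tendsto_eventually)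
    qed
    show "AE x in count_space UNIV. indicator {j + N<..} x * h x \<le> indicator {N<..} x * h x" for j
      by (intro AE_I2 mult_right_mono) (auto simp: indicator_def)
  qed auto
  then have "(\<lambda>j. tail_sum h (j + N)) \<longlonglongrightarrow> 0" by simp
  then show ?thesis by (rule LIMSEQ_offset)
qed

text \<open>Bits per letter, in this order: side information and constants; the symbol 0 of the
  clipped word; the letters above \<open>j\<close>; the words with an exempt start. \<open>T\<close>
  and \<open>C\<close> are the tail and the total of a cross entropy, or uniform majorants of
  them.\<close>

definition redundancy_bound :: "nat pmf \<Rightarrow> (nat \<Rightarrow> ennreal) \<Rightarrow> ennreal \<Rightarrow> nat \<Rightarrow> ennreal" where
  "redundancy_bound q T C j = ennreal (2 / real j) + ennreal (- log 2 (measure_pmf.prob q {..j})) + T j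
     + ennreal (3 / real j) * C"

lemma redundancy_bound_tendsto_0:
  assumes T: "T \<longlonglongrightarrow> 0" and C: "C < \<infinity>"
  shows "redundancy_bound q T C \<longlonglongrightarrow> 0"
proof -
  have "(\<lambda>j. measure_pmf.prob q {..j}) \<longlonglongrightarrow> measure_pmf.prob q (\<Union>j. {..j})"
    by (intro measure_pmf.finite_Lim_measure_incseq) (auto simp: incseq_def)
  moreover have "(\<Union>j. {..j}) = (UNIV :: nat set)" by auto
  ultimately have "(\<lambda>j. measure_pmf.prob q {..j}) \<longlonglongrightarrow> 1" by simp
  then have "(\<lambda>j. - log 2 (measure_pmf.prob q {..j})) \<longlonglongrightarrow> - log 2 1"
    by (intro tendsto_intros) auto
  then have "(\<lambda>j. ennreal (- log 2 (measure_pmf.prob q {..j}))) \<longlonglongrightarrow> ennreal (- log 2 1)"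
    by (rule tendsto_ennrealI)
  moreover have "(\<lambda>j. ennreal (2 / real j)) \<longlonglongrightarrow> ennreal 0"
    by (intro tendsto_ennrealI) real_asymp
  moreover have "(\<lambda>j. C * ennreal (3 / real j)) \<longlonglongrightarrow> C * ennreal 0"
    using C by (intro ennreal_tendsto_cmult tendsto_ennrealI) (simp, real_asymp)
  ultimately have "(\<lambda>j. ennreal (2 / real j) + ennreal (- log 2 (measure_pmf.prob q {..j})) + T j
     + C * ennreal (3 / real j)) \<longlonglongrightarrow> ennreal 0 + ennreal (- log 2 1) + 0 + C * ennreal 0"
    using T by (intro tendsto_add)
  then show ?thesis by (simp add: redundancy_bound_def[abs_def] mult.commute)
qed

definition tail_bits :: "nat pmf \<Rightarrow> nat pmf \<Rightarrow> nat \<Rightarrow> ennreal" where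
  "tail_bits q \<mu> = tail_sum (\<lambda>x. ennreal (pmf \<mu> x) * ennreal (- log 2 (pmf q x)))"

lemma tail_bits_le_letter_bits: "tail_bits q \<mu> K \<le> letter_bits q \<mu>"
  unfolding tail_bits_def tail_sum_def letter_bits_def nn_integral_measure_pmf
  by (intro nn_integral_mono) (auto simp: indicator_def)

text \<open>A clipped letter costs either the bits of the symbol 0, which has the probability of
  \<open>{..K}\<close> under \<open>q\<close>, or its own bits under \<open>q\<close>; the sum
  covers both cases.\<close>

lemma letter_bits_clip_le:
  assumes q: "set_pmf q = alphabet" and sup: "set_pmf \<mu> \<subseteq> alphabet"
  shows "letter_bits (map_pmf (clip K) q) (map_pmf (clip K) \<mu>)
    \<le> ennreal (- log 2 (measure_pmf.prob q {..K})) + tail_bits q \<mu> K"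
proof -
  have small: "pmf (map_pmf (clip K) q) 0 = measure_pmf.prob q {..K}"
  proof -
    have "clip K -` {0} = {..K}" by (auto simp: clip_def split: if_splits)
    then show ?thesis by (simp add: pmf_map)
  qed
  have large: "pmf (map_pmf (clip K) q) a = pmf q a" if "a > K" for a
  proof -
    have "clip K -` {a} = {a}" using that by (auto simp: clip_def split: if_splits)
    then show ?thesis by (simp add: pmf_map measure_pmf_single)
  qed
  have "letter_bits (map_pmf (clip K) q) (map_pmf (clip K) \<mu>)
    = (\<integral>\<^sup>+a. ennreal (- log 2 (pmf (map_pmf (clip K) q) (clip K a))) \<partial>\<mu>)"
    by (simp add: letter_bits_def)
  also have "\<dots> \<le> (\<integral>\<^sup>+a. ennreal (- log 2 (measure_pmf.prob q {..K}))
      + indicator {K<..} a * ennreal (- log 2 (pmf q a)) \<partial>\<mu>)"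
  proof (intro nn_integral_mono)
    fix a
    show "ennreal (- log 2 (pmf (map_pmf (clip K) q) (clip K a)))
      \<le> ennreal (- log 2 (measure_pmf.prob q {..K})) + indicator {K<..} a * ennreal (- log 2 (pmf q a))"
      by (cases "a \<le> K") (auto simp: clip_def small large)
  qed
  also have "\<dots> = ennreal (- log 2 (measure_pmf.prob q {..K}))
      + (\<integral>\<^sup>+a. indicator {K<..} a * ennreal (- log 2 (pmf q a)) \<partial>\<mu>)"
    by (simp add: nn_integral_add)
  also have "(\<integral>\<^sup>+a. indicator {K<..} a * ennreal (- log 2 (pmf q a)) \<partial>\<mu>) = tail_bits q \<mu> K"
    unfolding tail_bits_def tail_sum_def nn_integral_measure_pmf by (simp add: ac_simps)
  finally show ?thesis .
qed

lemma envelope_tail: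
  assumes "\<mu> \<in> envelope_family f"
  shows "emeasure \<mu> {K<..} \<le> tail_sum (\<lambda>x. ennreal (f x)) K"
proof -
  have "emeasure \<mu> {K<..} = (\<integral>\<^sup>+x. indicator {K<..} x \<partial>\<mu>)" by simp
  also have "\<dots> = tail_sum (\<lambda>x. ennreal (pmf \<mu> x)) K"
    unfolding nn_integral_measure_pmf tail_sum_def by (simp add: mult.commute)
  also have "\<dots> \<le> tail_sum (\<lambda>x. ennreal (f x)) K"
    using assms by (intro tail_sum_mono ennreal_leI) (auto simp: envelope_family_def)
  finally show ?thesis .
qed

text \<open>An exempt start has probability at most \<open>1 / j + 2 * j / (2 * j^2) = 2 / j\<close>
  by the choice of \<open>K\<close>, and the first \<open>2 * j\<close> letters are a fraction of at
  most \<open>1 / j\<close> of the word: hence the 3 in the bound. Side information takes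
  \<open>1 / j\<close> for the exact positions and \<open>1 / j\<close> for everything of order
  \<open>log n\<close>, hence the 2.\<close>

lemma eventually_good_code:
  assumes dist: "distortion \<rho>" and d: "d > 0" and q: "set_pmf q = alphabet"
    and F: "tail_sum (\<lambda>x. ennreal (f x)) 0 < \<infinity>" and j: "j \<ge> 1"
  shows "eventually (\<lambda>n. \<exists>\<xi>. semifaithful_code \<rho> d n \<xi> \<and> (\<forall>\<mu>\<in>envelope_family f.
    rate n \<xi> (replicate_pmf n \<mu>) \<le> optimal_rate \<rho> d n (replicate_pmf n \<mu>)
      + redundancy_bound q (tail_bits q \<mu>) (letter_bits q \<mu>) j)) sequentially"
proof -
  have "tail_sum (\<lambda>x. ennreal (f x)) \<longlonglongrightarrow> 0" by (rule tail_sum_tendsto_0[OF F])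
  moreover have "(0::ennreal) < ennreal (1 / (2 * real j ^ 2))" using j by simp
  ultimately have "eventually (\<lambda>K. tail_sum (\<lambda>x. ennreal (f x)) K < ennreal (1 / (2 * real j ^ 2))) sequentially"
    by (rule order_tendstoD)
  \<comment> \<open>\<open>K \<ge> j\<close> lets the final bound be stated in \<open>j\<close>
    alone, since tails decrease.\<close>
  then have "eventually (\<lambda>K. tail_sum (\<lambda>x. ennreal (f x)) K < ennreal (1 / (2 * real j ^ 2)) \<and> K \<ge> 2 \<and> K \<ge> j) sequentially"
    using eventually_ge_at_top[of 2] eventually_ge_at_top[of j] by eventually_elim simp
  then obtain K where K: "tail_sum (\<lambda>x. ennreal (f x)) K < ennreal (1 / (2 * real j ^ 2))" "K \<ge> 2" "K \<ge> j"
    by (auto dest: eventually_happens)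
  define M where "M = (\<Sum>a\<in>{1..K}. \<Sum>b\<in>{1..K}. \<bar>\<rho> a b\<bar>)"
  have M: "M \<ge> 0" unfolding M_def by (intro sum_nonneg) auto
  have M_bound: "\<forall>a\<in>{1..K}. \<forall>b\<in>{1..K}. \<rho> a b \<le> M"
  proof (intro ballI)
    fix a b assume ab: "a \<in> {1..K}" "b \<in> {1..K}"
    have "\<bar>\<rho> a b\<bar> \<le> (\<Sum>b\<in>{1..K}. \<bar>\<rho> a b\<bar>)" using ab by (intro member_le_sum) auto
    also have "\<dots> \<le> M" unfolding M_def using ab by (intro member_le_sum) (auto intro: sum_nonneg)
    finally show "\<rho> a b \<le> M" by simp
  qed
  \<comment> \<open>With this \<open>r\<close>, about \<open>n / r\<close> exact letters at
    \<open>log 2 K\<close> bits each cost at most \<open>n / j\<close> bits.\<close>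
  define r where "r = nat \<lceil>real j * log 2 (real K)\<rceil> + 1"
  have lK: "log 2 (real K) \<ge> 0" using K by simp
  have r: "r \<ge> 1" "real j * log 2 (real K) \<le> real r" unfolding r_def by linarith+
  \<comment> \<open>From this length on the freed budget \<open>n * d / r\<close> pays for the
    mark.\<close>
  have ev1: "eventually (\<lambda>n. real (2 * j) * M * real r / d \<le> real n) sequentially"
    by real_asymp
  have lim: "(\<lambda>n. (4 + real K * log 2 (real n + 1) + log 2 (real r) + log 2 (real K)) / real n) \<longlonglongrightarrow> 0"
    by real_asymp
  have "(0::real) < 1 / real j" using j by simp
  from order_tendstoD(2)[OF lim this] have ev2: "eventually (\<lambda>n.
    (4 + real K * log 2 (real n + 1) + log 2 (real r) + log 2 (real K)) / real n < 1 / real j) sequentially" .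
  have ev3: "eventually (\<lambda>n. n \<ge> 2 * j ^ 2) sequentially" by (rule eventually_ge_at_top)
  from ev1 ev2 ev3 show ?thesis
  proof eventually_elim
    fix n
    assume n1: "real (2 * j) * M * real r / d \<le> real n"
      and n2: "(4 + real K * log 2 (real n + 1) + log 2 (real r) + log 2 (real K)) / real n < 1 / real j"
      and n3: "n \<ge> 2 * j ^ 2"
    have jj: "j \<le> j ^ 2" using j by (simp add: power2_eq_square)
    have n: "n \<ge> 1" "2 * j \<le> n" using n3 jj j by linarith+
    have slack: "real (2 * j) * M \<le> real n * d / real r"
      using n1 r d by (simp add: field_simps)
    obtain \<xi> where \<xi>: "semifaithful_code \<rho> d n \<xi>" and rate: "\<And>\<mu>. set_pmf \<mu> \<subseteq> alphabet \<Longrightarrow>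
      rate n \<xi> (replicate_pmf n \<mu>) \<le> optimal_rate \<rho> d n (replicate_pmf n \<mu>) +
      (ennreal (4 + real K * log 2 (real n + 1) + log 2 (real r) + real (n div r + 1) * log 2 (real K))
       + of_nat n * letter_bits (map_pmf (clip K) q) (map_pmf (clip K) \<mu>)
       + (of_nat (2 * j) + of_nat n * (ennreal ((1/4) ^ j) + of_nat (2 * j) * emeasure \<mu> {K<..})) * letter_bits q \<mu>)
      / of_nat n"
      using spliced_code_rate[OF dist d n(1) q K(2) n(2) r(1) M M_bound slack] by (elim exE conjE) (rule that; blast)
    have const: "4 + real K * log 2 (real n + 1) + log 2 (real r) + real (n div r + 1) * log 2 (real K) \<le> real n * (2 / real j)"
    proof -
      have "real (n div r) * log 2 (real K) \<le> real n / real r * log 2 (real K)"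
        using lK by (intro mult_right_mono of_nat_div_le_of_nat) auto
      also have "\<dots> = real n * (log 2 (real K) / real r)" by simp
      also have "\<dots> \<le> real n * (1 / real j)"
        using r j by (intro mult_left_mono) (auto simp: field_simps)
      finally have 1: "real (n div r) * log 2 (real K) \<le> real n * (1 / real j)" .
      have 2: "4 + real K * log 2 (real n + 1) + log 2 (real r) + log 2 (real K) \<le> real n * (1 / real j)"
        using n2 n(1) by (simp add: field_simps)
      have 3: "real n * (2 / real j) = real n * (1 / real j) + real n * (1 / real j)" by simp
      have 4: "real (n div r + 1) * log 2 (real K) = real (n div r) * log 2 (real K) + log 2 (real K)"
        by (simp add: distrib_right)
      show ?thesis using add_mono[OF 1 2] unfolding 3 4 by (simp only: ac_simps)
    qed
    have "rate n \<xi> (replicate_pmf n \<mu>) \<le> optimal_rate \<rho> d n (replicate_pmf n \<mu>)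
      + redundancy_bound q (tail_bits q \<mu>) (letter_bits q \<mu>) j" if \<mu>: "\<mu> \<in> envelope_family f" for \<mu>
    proof -
      have sup: "set_pmf \<mu> \<subseteq> alphabet" using \<mu> by (simp add: envelope_family_def)
      let ?X = "ennreal (2 / real j) + letter_bits (map_pmf (clip K) q) (map_pmf (clip K) \<mu>) + ennreal (3 / real j) * letter_bits q \<mu>"
      have "of_nat (2 * j) + of_nat n * (ennreal ((1/4) ^ j) + of_nat (2 * j) * emeasure \<mu> {K<..})
        \<le> ennreal (real n * (1 / real j)) + of_nat n * (ennreal (1 / real j) + of_nat (2 * j) * ennreal (1 / (2 * real j ^ 2)))"
      proof (intro add_mono mult_left_mono ennreal_leI)
        have "real (2 * j ^ 2) \<le> real n" using n3 by (rule of_nat_mono)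
        then have "real (2 * j) \<le> real n * (1 / real j)" using j by (simp add: field_simps power2_eq_square)
        then show "of_nat (2 * j) \<le> ennreal (real n * (1 / real j))"
          unfolding ennreal_of_nat_eq_real_of_nat by (rule ennreal_leI)
        have "real j \<le> 2 ^ j" by simp
        also have "(2::real) ^ j \<le> 4 ^ j" by (rule power_mono) auto
        finally show "(1/4::real) ^ j \<le> 1 / real j"
          using j by (simp add: power_one_over field_simps)
        show "emeasure \<mu> {K<..} \<le> ennreal (1 / (2 * real j ^ 2))"
          using envelope_tail[OF \<mu>, of K] K(1) by (meson less_imp_le order_trans)
      qed auto
      also have "\<dots> = of_nat n * ennreal (3 / real j)"
      proof -
        have 1: "of_nat (2 * j) * ennreal (1 / (2 * real j ^ 2)) = ennreal (1 / real j)"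
          using j by (simp add: ennreal_of_nat_eq_real_of_nat power2_eq_square flip: ennreal_mult')
        have "ennreal (real n * (1 / real j)) = of_nat n * ennreal (1 / real j)"
          by (simp only: ennreal_of_nat_eq_real_of_nat ennreal_mult'[OF of_nat_0_le_iff])
        moreover have "ennreal (3 / real j) = ennreal (1 / real j) + (ennreal (1 / real j) + ennreal (1 / real j))"
          by (subst ennreal_plus[symmetric], simp, simp, subst ennreal_plus[symmetric]) (simp_all add: field_simps)
        ultimately show ?thesis unfolding 1 by (simp only: distrib_left)
      qed
      finally have B: "of_nat (2 * j) + of_nat n * (ennreal ((1/4) ^ j) + of_nat (2 * j) * emeasure \<mu> {K<..})
        \<le> of_nat n * ennreal (3 / real j)" .
      have A: "ennreal (4 + real K * log 2 (real n + 1) + log 2 (real r) + real (n div r + 1) * log 2 (real K))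
        \<le> of_nat n * ennreal (2 / real j)"
        using ennreal_leI[OF const] by (simp only: ennreal_of_nat_eq_real_of_nat ennreal_mult'[OF of_nat_0_le_iff])
      have "ennreal (4 + real K * log 2 (real n + 1) + log 2 (real r) + real (n div r + 1) * log 2 (real K))
       + of_nat n * letter_bits (map_pmf (clip K) q) (map_pmf (clip K) \<mu>)
       + (of_nat (2 * j) + of_nat n * (ennreal ((1/4) ^ j) + of_nat (2 * j) * emeasure \<mu> {K<..})) * letter_bits q \<mu>
        \<le> of_nat n * ennreal (2 / real j) + of_nat n * letter_bits (map_pmf (clip K) q) (map_pmf (clip K) \<mu>)
          + of_nat n * ennreal (3 / real j) * letter_bits q \<mu>"
        by (intro add_mono A mult_right_mono B order_refl) auto
      also have "\<dots> = ?X * of_nat n" by (simp add: algebra_simps)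
      finally have "rate n \<xi> (replicate_pmf n \<mu>) \<le> optimal_rate \<rho> d n (replicate_pmf n \<mu>) + ?X * of_nat n / of_nat n"
        by (intro order_trans[OF rate[OF sup]] add_left_mono divide_right_mono_ennreal)
      also have "?X * of_nat n / of_nat n = ?X" using n(1) by (intro ennreal_mult_divide_eq) auto
      also have "?X \<le> redundancy_bound q (tail_bits q \<mu>) (letter_bits q \<mu>) j"
      proof -
        have "1 \<in> set_pmf q" using q by simp
        then have "0 < pmf q 1" by (rule pmf_positive)
        also have "pmf q 1 \<le> measure_pmf.prob q {..j}"
          using j by (simp flip: measure_pmf_single) (intro measure_pmf.finite_measure_mono, auto)
        finally have pos: "0 < measure_pmf.prob q {..j}" .
        moreover have "measure_pmf.prob q {..j} \<le> measure_pmf.prob q {..K}"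
          using K(3) by (intro measure_pmf.finite_measure_mono) auto
        ultimately have "- log 2 (measure_pmf.prob q {..K}) \<le> - log 2 (measure_pmf.prob q {..j})" by simp
        then have L: "letter_bits (map_pmf (clip K) q) (map_pmf (clip K) \<mu>)
          \<le> ennreal (- log 2 (measure_pmf.prob q {..j})) + tail_bits q \<mu> j"
          using tail_sum_antimono[OF K(3)] unfolding tail_bits_def
          by (intro order_trans[OF letter_bits_clip_le[OF q sup, unfolded tail_bits_def]] add_mono ennreal_leI)
        have "?X \<le> ennreal (2 / real j) + (ennreal (- log 2 (measure_pmf.prob q {..j})) + tail_bits q \<mu> j)
            + ennreal (3 / real j) * letter_bits q \<mu>"
          by (intro add_mono L order_refl)
        then show ?thesis unfolding redundancy_bound_def by (simp only: add.assoc)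
      qed
      finally show ?thesis by (simp add: add_left_mono)
    qed
    with \<xi> show "\<exists>\<xi>. semifaithful_code \<rho> d n \<xi> \<and> (\<forall>\<mu>\<in>envelope_family f.
      rate n \<xi> (replicate_pmf n \<mu>) \<le> optimal_rate \<rho> d n (replicate_pmf n \<mu>)
        + redundancy_bound q (tail_bits q \<mu>) (letter_bits q \<mu>) j)" by blast
  qed
qed

text \<open>\<open>J n\<close> is the largest \<open>j \<le> n\<close> that works at
  \<open>n\<close>, or 0 if there is none. The cap \<open>n\<close> makes the maximum exist, and
  every fixed \<open>j\<close> works eventually.\<close>

lemma eventually_diagonal:
  assumes "\<And>j. j \<ge> 1 \<Longrightarrow> eventually (P j) sequentially"
  shows "\<exists>J :: nat \<Rightarrow> nat. filterlim J at_top sequentially \<and> (\<forall>n. J n \<ge> 1 \<longrightarrow> P (J n) n)"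
proof -
  define S where "S n = {j. j \<le> n \<and> (j = 0 \<or> P j n)}" for n
  define J where "J n = Max (S n)" for n
  have fin: "finite (S n)" for n unfolding S_def by (rule finite_subset[of _ "{..n}"]) auto
  have J: "J n \<in> S n" for n unfolding J_def by (rule Max_in[OF fin]) (auto simp: S_def)
  show ?thesis
  proof (intro exI[of _ J] conjI allI impI)
    show "filterlim J at_top sequentially"
      unfolding filterlim_at_top
    proof
      fix Z :: nat
      have "eventually (\<lambda>n. P (Suc Z) n) sequentially" by (rule assms) simp
      with eventually_ge_at_top[of "Suc Z"] show "eventually (\<lambda>n. Z \<le> J n) sequentially"
      proof eventually_elim
        fix n assume "Suc Z \<le> n" "P (Suc Z) n"
        then have "Suc Z \<in> S n" by (simp add: S_def)
        then have "Suc Z \<le> J n" unfolding J_def by (rule Max_ge[OF fin])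
        then show "Z \<le> J n" by simp
      qed
    qed
    show "P (J n) n" if "J n \<ge> 1" for n using J[of n] that by (simp add: S_def)
  qed
qed

section \<open>A coding distribution dominating the envelope family\<close>

lemma summable_tail_sum:
  assumes f_nonneg: "\<forall>x\<in>alphabet. f x \<ge> (0::real)" and s: "(\<lambda>x. \<bar>f x\<bar>) summable_on alphabet"
  shows "tail_sum (\<lambda>x. ennreal (f x)) 0 < \<infinity>"
proof -
  have "tail_sum (\<lambda>x. ennreal (f x)) 0 = (\<integral>\<^sup>+x. ennreal (f x) \<partial>count_space alphabet)"
  proof -
    have "{0<..} = alphabet" by auto
    then show ?thesis unfolding tail_sum_def
      by (subst nn_integral_count_space_indicator[of alphabet]) (simp_all add: mult.commute)
  qed
  also have "\<dots> \<le> ennreal (infsum (\<lambda>x. \<bar>f x\<bar>) alphabet)"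
  proof (rule nn_integral_count_space_le_finite)
    fix F assume F: "finite F" "F \<subseteq> alphabet"
    have "(\<Sum>x\<in>F. ennreal (f x)) = (\<Sum>x\<in>F. ennreal \<bar>f x\<bar>)"
      using F f_nonneg by (intro sum.cong) auto
    also have "\<dots> = ennreal (\<Sum>x\<in>F. \<bar>f x\<bar>)" by simp
    also have "\<dots> \<le> ennreal (infsum (\<lambda>x. \<bar>f x\<bar>) alphabet)"
      using F by (intro ennreal_leI finite_sum_le_infsum s) auto
    finally show "(\<Sum>x\<in>F. ennreal (f x)) \<le> ennreal (infsum (\<lambda>x. \<bar>f x\<bar>) alphabet)" .
  qed simp
  also have "\<dots> < \<infinity>" by simp
  finally show ?thesis .
qed

text \<open>The summands \<open>(1/2) ^ x\<close> make sure that every letter gets a codeword, even where \<open>f\<close> vanishes.\<close>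

lemma envelope_source:
  assumes f_nonneg: "\<forall>x\<in>alphabet. f x \<ge> (0::real)" and F: "tail_sum (\<lambda>x. ennreal (f x)) 0 < \<infinity>"
  obtains q Z where "set_pmf q = alphabet"
    "\<And>\<mu>. \<mu> \<in> envelope_family f \<Longrightarrow> letter_bits q \<mu> \<le> ennreal Z + shannon_entropy \<mu>"
proof -
  define h where "h x = (if x \<ge> 1 then f x + (1/2) ^ x else 0)" for x
  define I where "I = (\<integral>\<^sup>+x. ennreal (h x) \<partial>count_space UNIV)"
  have h0: "0 \<le> h x" for x using f_nonneg by (simp add: h_def)
  have hpos: "0 < h x" if "x \<ge> 1" for x using f_nonneg that by (simp add: h_def add_nonneg_pos)
  have "I \<le> (\<integral>\<^sup>+x. indicator {0<..} x * ennreal (f x) + ennreal ((1/2) ^ x) \<partial>count_space UNIV)"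
    unfolding I_def
  proof (intro nn_integral_mono)
    fix x :: nat
    show "ennreal (h x) \<le> indicator {0<..} x * ennreal (f x) + ennreal ((1/2) ^ x)"
      using f_nonneg by (cases "x \<ge> 1") (auto simp: h_def ennreal_plus)
  qed
  also have "\<dots> = tail_sum (\<lambda>x. ennreal (f x)) 0 + (\<integral>\<^sup>+x. ennreal ((1/2) ^ x) \<partial>count_space (UNIV :: nat set))"
    unfolding tail_sum_def by (rule nn_integral_add) auto
  also have "(\<integral>\<^sup>+x. ennreal ((1/2) ^ x) \<partial>count_space (UNIV :: nat set)) = ennreal (\<Sum>x. (1/2) ^ x)"
    unfolding nn_integral_count_space_nat by (intro suminf_ennreal2 summable_geometric) auto
  finally have "I < \<infinity>" using F by (simp add: le_less_trans)
  then obtain Z where Z: "I = ennreal Z" "Z \<ge> 0" by (cases I) auto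
  have "I \<noteq> 0"
  proof
    assume "I = 0"
    then have "AE x in count_space UNIV. ennreal (h x) = 0"
      unfolding I_def by (subst (asm) nn_integral_0_iff_AE) auto
    then have "ennreal (h 1) = 0" by (simp add: AE_count_space)
    then show False using hpos[of 1] by simp
  qed
  then have Zpos: "Z > 0" using Z by (simp add: less_le)
  have "(\<integral>\<^sup>+x. ennreal (h x / Z) \<partial>count_space UNIV) = (\<integral>\<^sup>+x. ennreal (h x) / ennreal Z \<partial>count_space UNIV)"
    using h0 Zpos by (simp add: divide_ennreal)
  also have "\<dots> = I / ennreal Z" unfolding I_def by (rule nn_integral_divide) simp
  also have "\<dots> = 1" using Z Zpos by (simp add: divide_ennreal)
  finally obtain q where q: "\<And>x. pmf q x = h x / Z"
    using pmf_exists[of "\<lambda>x. h x / Z"] h0 Z(2) by auto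
  have set: "set_pmf q = alphabet"
  proof (intro set_eqI)
    fix x show "x \<in> set_pmf q \<longleftrightarrow> x \<in> alphabet"
      using hpos[of x] Zpos by (cases "x \<ge> 1") (auto simp: set_pmf_iff q h_def)
  qed
  \<comment> \<open>On the alphabet \<open>pmf \<mu> \<le> f \<le> Z * pmf q\<close>, so coding for
    \<open>q\<close> instead of \<open>\<mu>\<close> costs at most \<open>log 2 Z\<close> more bits
    per letter; the absolute value covers \<open>Z < 1\<close>.\<close>
  have "letter_bits q \<mu> \<le> ennreal \<bar>log 2 Z\<bar> + shannon_entropy \<mu>" if \<mu>: "\<mu> \<in> envelope_family f" for \<mu>
  proof -
    have "letter_bits q \<mu> \<le> (\<integral>\<^sup>+a. ennreal \<bar>log 2 Z\<bar> + ennreal (- log 2 (pmf \<mu> a)) \<partial>\<mu>)"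
      unfolding letter_bits_def
    proof (intro nn_integral_mono_AE, unfold AE_measure_pmf_iff, intro ballI)
      fix a assume a: "a \<in> set_pmf \<mu>"
      then have a1: "a \<ge> 1" using \<mu> by (auto simp: envelope_family_def)
      have p: "0 < pmf \<mu> a" using a by (rule pmf_positive)
      have "pmf \<mu> a \<le> f a" using \<mu> a1 by (simp add: envelope_family_def)
      also have "\<dots> \<le> h a" using a1 by (simp add: h_def)
      finally have "pmf \<mu> a / Z \<le> pmf q a" using Zpos by (simp add: q divide_right_mono)
      then have "log 2 (pmf \<mu> a / Z) \<le> log 2 (pmf q a)" using p Zpos by (intro log_mono) auto
      then have "- log 2 (pmf q a) \<le> \<bar>log 2 Z\<bar> + - log 2 (pmf \<mu> a)"
        using p Zpos by (simp add: log_divide)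
      then have "ennreal (- log 2 (pmf q a)) \<le> ennreal (\<bar>log 2 Z\<bar> + - log 2 (pmf \<mu> a))" by (rule ennreal_leI)
      also have "\<dots> = ennreal \<bar>log 2 Z\<bar> + ennreal (- log 2 (pmf \<mu> a))"
        by (rule ennreal_plus[OF abs_ge_zero neg_log_pmf_nonneg])
      finally show "ennreal (- log 2 (pmf q a)) \<le> ennreal \<bar>log 2 Z\<bar> + ennreal (- log 2 (pmf \<mu> a))" .
    qed
    also have "\<dots> = ennreal \<bar>log 2 Z\<bar> + (\<integral>\<^sup>+a. ennreal (- log 2 (pmf \<mu> a)) \<partial>\<mu>)"
      by (simp add: nn_integral_add)
    also have "(\<integral>\<^sup>+a. ennreal (- log 2 (pmf \<mu> a)) \<partial>\<mu>) = shannon_entropy \<mu>"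
      unfolding nn_integral_measure_pmf shannon_entropy_def
      by (simp flip: ennreal_mult'[OF pmf_nonneg])
    finally show ?thesis .
  qed
  with set show thesis by (rule that)
qed

text \<open>Fills the lengths for which no good parameter exists yet, and shows that the optimal
  rate is finite when the cross entropy is.\<close>

lemma lossless_code:
  assumes dist: "distortion \<rho>" and d: "d > 0" and q: "set_pmf q = alphabet"
  shows "\<exists>\<xi>. semifaithful_code \<rho> d n \<xi> \<and> (\<forall>\<mu>. set_pmf \<mu> \<subseteq> alphabet \<longrightarrow>
    rate n \<xi> (replicate_pmf n \<mu>) \<le> (2 + of_nat n * letter_bits q \<mu>) / of_nat n)"
proof -
  have W: "set_pmf (replicate_pmf n q) = words n" using q by (auto simp: set_replicate_pmf words_def)
  have "word_distortion \<rho> n x x \<le> d" if "x \<in> words n" for x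
    using word_distortion_self[OF dist that] d by simp
  then have "\<exists>\<xi>. semifaithful_code \<rho> d n \<xi> \<and>
    (\<forall>x\<in>words n. real (length (encoder \<xi> (quantizer \<xi> x))) \<le> 2 - log 2 (pmf (replicate_pmf n q) x))"
    using W by (intro semifaithful_code_of_pmf) auto
  then obtain \<xi> where \<xi>: "semifaithful_code \<rho> d n \<xi>"
    "\<And>x. x \<in> words n \<Longrightarrow> real (length (encoder \<xi> (quantizer \<xi> x))) \<le> 2 - log 2 (pmf (replicate_pmf n q) x)" by blast
  have "rate n \<xi> (replicate_pmf n \<mu>) \<le> (2 + of_nat n * letter_bits q \<mu>) / of_nat n"
    if sup: "set_pmf \<mu> \<subseteq> alphabet" for \<mu>
  proof -
    have "(\<integral>\<^sup>+x. of_nat (length (encoder \<xi> (quantizer \<xi> x))) \<partial>replicate_pmf n \<mu>)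
      \<le> (\<integral>\<^sup>+x. 2 + ennreal (code_bits q x) \<partial>replicate_pmf n \<mu>)"
    proof (intro nn_integral_mono_AE, unfold AE_measure_pmf_iff, intro ballI)
      fix x assume "x \<in> set_pmf (replicate_pmf n \<mu>)"
      then have x: "x \<in> words n" using set_replicate_pmf_words[OF sup] by blast
      then have "- log 2 (pmf (replicate_pmf n q) x) = code_bits q x"
        using q by (intro log_pmf_replicate_pmf) (auto simp: words_def)
      then have "real (length (encoder \<xi> (quantizer \<xi> x))) \<le> 2 + code_bits q x" using \<xi>(2)[OF x] by simp
      then have "ennreal (real (length (encoder \<xi> (quantizer \<xi> x)))) \<le> ennreal (2 + code_bits q x)" by (rule ennreal_leI)
      then show "of_nat (length (encoder \<xi> (quantizer \<xi> x))) \<le> 2 + ennreal (code_bits q x)"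
        using ennreal_plus[of 2 "code_bits q x"] code_bits_nonneg[of q x] by (simp add: ennreal_of_nat_eq_real_of_nat)
    qed
    also have "\<dots> = 2 + of_nat n * letter_bits q \<mu>"
      by (simp add: nn_integral_add nn_integral_code_bits)
    finally show ?thesis unfolding rate_def by (rule divide_right_mono_ennreal)
  qed
  with \<xi>(1) show ?thesis by blast
qed

text \<open>Comparison with the lossless code makes the optimal rate finite, so it can be subtracted
  from the inequalities in \<open>ereal\<close>.\<close>

lemma redundancy_sandwich:
  assumes dist: "distortion \<rho>" and d: "d > 0" and n: "n \<ge> 1" and q: "set_pmf q = alphabet"
    and sup: "set_pmf \<mu> \<subseteq> alphabet" and C: "letter_bits q \<mu> < \<infinity>"
    and code: "semifaithful_code \<rho> d n \<xi>"
    and le: "rate n \<xi> (replicate_pmf n \<mu>) \<le> optimal_rate \<rho> d n (replicate_pmf n \<mu>) + e"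
  shows "0 \<le> redundancy \<rho> d n \<xi> \<mu>" "redundancy \<rho> d n \<xi> \<mu> \<le> enn2ereal e"
proof -
  let ?P = "replicate_pmf n \<mu>"
  have PW: "set_pmf ?P \<subseteq> words n" using sup by (rule set_replicate_pmf_words)
  obtain \<xi>' where \<xi>': "semifaithful_code \<rho> d n \<xi>'" "rate n \<xi>' ?P \<le> (2 + of_nat n * letter_bits q \<mu>) / of_nat n"
    using lossless_code[OF dist d q, of n] sup by blast
  have "optimal_rate \<rho> d n ?P \<le> (2 + of_nat n * letter_bits q \<mu>) / of_nat n"
    using optimal_rate_le_rate[OF \<xi>'(1) PW] \<xi>'(2) by (rule order_trans)
  also have "\<dots> < \<infinity>"
    using C n by (auto simp: ennreal_divide_eq_top_iff ennreal_mult_less_top less_top[symmetric] ennreal_mult_eq_top_iff)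
  finally obtain p where p: "optimal_rate \<rho> d n ?P = ennreal p" "p \<ge> 0" by (cases "optimal_rate \<rho> d n ?P") auto
  have ge: "enn2ereal (optimal_rate \<rho> d n ?P) \<le> enn2ereal (rate n \<xi> ?P)"
    using optimal_rate_le_rate[OF code PW] by (simp add: less_eq_ennreal.rep_eq)
  have le': "enn2ereal (rate n \<xi> ?P) \<le> enn2ereal (optimal_rate \<rho> d n ?P) + enn2ereal e"
    using le by (simp add: less_eq_ennreal.rep_eq plus_ennreal.rep_eq)
  show "0 \<le> redundancy \<rho> d n \<xi> \<mu>"
    using ge p by (cases "enn2ereal (rate n \<xi> ?P)") (auto simp: redundancy_def)
  show "redundancy \<rho> d n \<xi> \<mu> \<le> enn2ereal e"
    using le' p by (cases "enn2ereal (rate n \<xi> ?P)"; cases "enn2ereal e") (auto simp: redundancy_def)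
qed

lemma universal_scheme:
  assumes dist: "distortion \<rho>" and d: "d > 0" and q: "set_pmf q = alphabet"
    and F: "tail_sum (\<lambda>x. ennreal (f x)) 0 < \<infinity>"
  shows "\<exists>\<xi> J. semifaithful_scheme \<rho> d \<xi> \<and> filterlim J at_top sequentially \<and>
    (\<forall>n\<ge>1. J n \<ge> 1 \<longrightarrow> (\<forall>\<mu>\<in>envelope_family f.
      rate n (\<xi> n) (replicate_pmf n \<mu>) \<le> optimal_rate \<rho> d n (replicate_pmf n \<mu>)
        + redundancy_bound q (tail_bits q \<mu>) (letter_bits q \<mu>) (J n)))"
proof -
  define R where "R j n \<xi> \<longleftrightarrow> semifaithful_code \<rho> d n \<xi> \<and> (\<forall>\<mu>\<in>envelope_family f.
      rate n \<xi> (replicate_pmf n \<mu>) \<le> optimal_rate \<rho> d n (replicate_pmf n \<mu>)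
        + redundancy_bound q (tail_bits q \<mu>) (letter_bits q \<mu>) j)" for j n \<xi>
  have "eventually (\<lambda>n. \<exists>\<xi>. R j n \<xi>) sequentially" if "j \<ge> 1" for j
    unfolding R_def using eventually_good_code[OF dist d q F that] .
  then have "\<exists>J. filterlim J at_top sequentially \<and> (\<forall>n. J n \<ge> 1 \<longrightarrow> (\<exists>\<xi>. R (J n) n \<xi>))"
    by (rule eventually_diagonal)
  then obtain J where J: "filterlim J at_top sequentially" "\<forall>n. J n \<ge> 1 \<longrightarrow> (\<exists>\<xi>. R (J n) n \<xi>)"
    by (elim exE conjE)
  have "\<exists>\<xi>. semifaithful_code \<rho> d n \<xi> \<and> (J n \<ge> 1 \<longrightarrow> R (J n) n \<xi>)" for n
    using J(2)[rule_format, of n] lossless_code[OF dist d q, of n] by (cases "J n \<ge> 1") (auto simp: R_def)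
  then obtain \<xi> where \<xi>: "\<And>n. semifaithful_code \<rho> d n (\<xi> n) \<and> (J n \<ge> 1 \<longrightarrow> R (J n) n (\<xi> n))" by metis
  show ?thesis
    using \<xi> J(1) by (intro exI[of _ \<xi>] exI[of _ J]) (simp add: semifaithful_scheme_def R_def)
qed

text \<open>Without summability there are members with all masses at most \<open>(1/2) ^ B\<close>;
  every letter then carries at least \<open>B\<close> bits, and the entropy is at least
  \<open>B\<close>.\<close>

lemma summable_if_bounded_entropy:
  assumes f_nonneg: "\<forall>x\<in>alphabet. f x \<ge> 0" and bdd: "(SUP \<mu>\<in>envelope_family f. shannon_entropy \<mu>) < \<infinity>"
  shows "(\<lambda>x. \<bar>f x\<bar>) summable_on alphabet"
proof (rule ccontr)
  assume ns: "\<not> ?thesis"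
  obtain B where B: "(SUP \<mu>\<in>envelope_family f. shannon_entropy \<mu>) < of_nat B"
    using ennreal_Ex_less_of_nat bdd by (auto simp: infinity_ennreal_def)
  obtain \<mu> where \<mu>: "\<mu> \<in> envelope_family f" "finite (set_pmf \<mu>)" "\<And>x. pmf \<mu> x \<le> (1/2) ^ B"
    using non_summable_source[OF f_nonneg ns, of 0 B] by blast
  have "real B = (\<Sum>x\<in>set_pmf \<mu>. pmf \<mu> x * real B)"
    using \<mu>(2) by (simp add: sum_pmf_eq_1 flip: sum_distrib_right)
  also have "\<dots> \<le> (\<Sum>x\<in>set_pmf \<mu>. - (pmf \<mu> x * log 2 (pmf \<mu> x)))"
  proof (intro sum_mono)
    fix x assume "x \<in> set_pmf \<mu>"
    then have "0 < pmf \<mu> x" by (rule pmf_positive)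
    then have "log 2 (pmf \<mu> x) \<le> log 2 ((1/2) ^ B)" using \<mu>(3)[of x] by (intro log_mono) auto
    also have "log 2 ((1/2) ^ B) = - real B" by (simp add: log_nat_power log_divide)
    finally have "pmf \<mu> x * real B \<le> pmf \<mu> x * - log 2 (pmf \<mu> x)" by (intro mult_left_mono) auto
    then show "pmf \<mu> x * real B \<le> - (pmf \<mu> x * log 2 (pmf \<mu> x))" by simp
  qed
  finally have "ennreal (real B) \<le> shannon_entropy \<mu>"
    unfolding finite_shannon_entropy[OF \<mu>(2)] by (rule ennreal_leI)
  also have "\<dots> \<le> (SUP \<mu>\<in>envelope_family f. shannon_entropy \<mu>)" using \<mu>(1) by (rule SUP_upper)
  finally show False using B by (simp add: ennreal_of_nat_eq_real_of_nat)
qed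

text \<open>A member of the envelope family that agrees with \<open>f\<close> far out turns the finiteness of its
  expected code length into a bound that is uniform on the family.\<close>

lemma uniform_tail_bits:
  assumes f_nonneg: "\<forall>x\<in>alphabet. f x \<ge> 0" and F: "tail_sum (\<lambda>x. ennreal (f x)) 0 < \<infinity>"
    and C: "\<And>\<mu>. \<mu> \<in> envelope_family f \<Longrightarrow> letter_bits q \<mu> < \<infinity>"
    and ne: "\<mu>0 \<in> envelope_family f"
  shows "tail_sum (\<lambda>x. ennreal (f x) * ennreal (- log 2 (pmf q x))) \<longlonglongrightarrow> 0"
proof -
  \<comment> \<open>A tail of mass below 1 leaves positive mass for the head of the new
    source.\<close>
  have "eventually (\<lambda>N. tail_sum (\<lambda>x. ennreal (f x)) N < 1) sequentially"
    by (rule order_tendstoD(2)[OF tail_sum_tendsto_0[OF F]]) simp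
  then obtain N where N: "tail_sum (\<lambda>x. ennreal (f x)) N < 1" by (auto dest: eventually_happens)
  then obtain \<tau> where \<tau>: "tail_sum (\<lambda>x. ennreal (f x)) N = ennreal \<tau>" "0 \<le> \<tau>" "\<tau> < 1"
    by (cases "tail_sum (\<lambda>x. ennreal (f x)) N") auto
  define m where "m = measure_pmf.prob \<mu>0 {..N}"
  have m: "1 - \<tau> \<le> m"
  proof -
    have "emeasure \<mu>0 {N<..} \<le> ennreal \<tau>" using envelope_tail[OF ne, of N] \<tau>(1) by simp
    then have "measure_pmf.prob \<mu>0 {N<..} \<le> \<tau>"
      using \<tau>(2) by (simp add: measure_pmf.emeasure_eq_measure)
    moreover have "measure_pmf.prob \<mu>0 {N<..} = 1 - m"
      unfolding m_def using measure_pmf.prob_compl[of "{..N}" \<mu>0]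
      by (simp add: Compl_eq_Diff_UNIV[symmetric] flip: Compl_atMost)
    ultimately show ?thesis by simp
  qed
  \<comment> \<open>Scales the head of \<open>\<mu>0\<close> to the mass that the tail of
    \<open>f\<close> leaves. The tail of \<open>\<mu>0\<close> is at most that of \<open>f\<close>,
    so the factor is at most 1 and the envelope is respected.\<close>
  define \<theta> where "\<theta> = (1 - \<tau>) / m"
  have m0: "m > 0" using m \<tau>(3) by simp
  have \<theta>: "0 \<le> \<theta>" "\<theta> \<le> 1" "\<theta> * m = 1 - \<tau>" using m m0 \<tau> by (auto simp: \<theta>_def)
  define v where "v x = (if x > N then f x else \<theta> * pmf \<mu>0 x)" for x
  have v0: "0 \<le> v x" for x using f_nonneg \<theta> by (auto simp: v_def)
  have "(\<integral>\<^sup>+x. ennreal (v x) \<partial>count_space UNIV)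
    = (\<integral>\<^sup>+x. indicator {N<..} x * ennreal (f x) + ennreal \<theta> * (ennreal (pmf \<mu>0 x) * indicator {..N} x) \<partial>count_space UNIV)"
    by (intro nn_integral_cong) (auto simp: v_def indicator_def ennreal_mult' \<theta>)
  also have "\<dots> = ennreal \<tau> + ennreal \<theta> * emeasure \<mu>0 {..N}"
  proof -
    have "(\<integral>\<^sup>+x. ennreal (pmf \<mu>0 x) * indicator {..N} x \<partial>count_space UNIV) = emeasure \<mu>0 {..N}"
      using nn_integral_pmf[where p = \<mu>0 and A = "{..N}"] by (simp add: nn_integral_count_space_indicator)
    then show ?thesis using \<tau>(1) by (simp add: nn_integral_add nn_integral_cmult tail_sum_def)
  qed
  also have "\<dots> = 1"
  proof -
    have "ennreal \<theta> * emeasure \<mu>0 {..N} = ennreal (\<theta> * m)"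
      unfolding m_def measure_pmf.emeasure_eq_measure by (rule ennreal_mult'[OF \<theta>(1), symmetric])
    then show ?thesis using \<tau> \<theta>(3) by (simp flip: ennreal_plus)
  qed
  finally obtain \<nu> where \<nu>: "\<And>x. pmf \<nu> x = v x" using pmf_exists[of v] v0 by auto
  have "\<nu> \<in> envelope_family f"
  proof -
    have "pmf \<nu> x \<le> f x" if x: "x \<in> alphabet" for x
    proof (cases "x > N")
      case False
      have "\<theta> * pmf \<mu>0 x \<le> 1 * pmf \<mu>0 x" using \<theta> by (intro mult_right_mono) auto
      also have "\<dots> \<le> f x" using ne x by (simp add: envelope_family_def)
      finally show ?thesis using False by (simp add: \<nu> v_def)
    qed (simp add: \<nu> v_def)
    moreover have "set_pmf \<nu> \<subseteq> alphabet"
    proof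
      fix x assume "x \<in> set_pmf \<nu>"
      then have "v x \<noteq> 0" by (simp add: set_pmf_iff \<nu>)
      moreover have "v 0 = 0"
      proof -
        have "0 \<notin> set_pmf \<mu>0" using ne by (auto simp: envelope_family_def)
        then show ?thesis by (simp add: v_def set_pmf_iff)
      qed
      ultimately show "x \<in> alphabet" by (cases x) auto
    qed
    ultimately show ?thesis by (simp add: envelope_family_def)
  qed
  then have "letter_bits q \<nu> < \<infinity>" by (rule C)
  then have "tail_bits q \<nu> N < \<infinity>" using tail_bits_le_letter_bits[of q \<nu> N] by (rule le_less_trans[rotated])
  moreover have "tail_sum (\<lambda>x. ennreal (f x) * ennreal (- log 2 (pmf q x))) N \<le> tail_bits q \<nu> N"
    unfolding tail_bits_def by (rule tail_sum_mono) (simp add: \<nu> v_def)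
  ultimately have "tail_sum (\<lambda>x. ennreal (f x) * ennreal (- log 2 (pmf q x))) N < \<infinity>" by (rule le_less_trans[rotated])
  then show ?thesis by (rule tail_sum_tendsto_0)
qed

lemma redundancy_bound_limit:
  assumes "filterlim J at_top sequentially" "redundancy_bound q T C \<longlonglongrightarrow> 0"
  shows "(\<lambda>n. enn2ereal (redundancy_bound q T C (J n))) \<longlonglongrightarrow> 0"
  using tendsto_enn2erealI[OF filterlim_compose[OF assms(2,1)]] unfolding zero_ennreal.rep_eq .

text \<open>One scheme serves both limits, since bounded entropy enters only the estimate of its
  redundancy and not its construction.\<close>

lemma envelope_universal_scheme:
  assumes f_nonneg: "\<forall>x\<in>alphabet. f x \<ge> 0" and dist: "distortion \<rho>" and d: "d > 0"
    and s: "(\<lambda>x. \<bar>f x\<bar>) summable_on alphabet"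
  shows "\<exists>\<xi>. semifaithful_scheme \<rho> d \<xi> \<and>
    (\<forall>\<mu> \<in> envelope_family f \<inter> finite_entropy_sources. (\<lambda>n. redundancy \<rho> d n (\<xi> n) \<mu>) \<longlonglongrightarrow> 0) \<and>
    ((SUP \<mu>\<in>envelope_family f. shannon_entropy \<mu>) < \<infinity> \<longrightarrow>
      (\<lambda>n. worst_redundancy \<rho> d n (\<xi> n) (envelope_family f)) \<longlonglongrightarrow> 0)"
proof -
  have F: "tail_sum (\<lambda>x. ennreal (f x)) 0 < \<infinity>" by (rule summable_tail_sum[OF f_nonneg s])
  obtain q Z where q: "set_pmf q = alphabet"
    and Z: "\<And>\<mu>. \<mu> \<in> envelope_family f \<Longrightarrow> letter_bits q \<mu> \<le> ennreal Z + shannon_entropy \<mu>"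
    using envelope_source[OF f_nonneg F] by metis
  obtain \<xi> J where \<xi>: "semifaithful_scheme \<rho> d \<xi>" and J: "filterlim J at_top sequentially"
    and rate: "\<forall>n\<ge>1. J n \<ge> 1 \<longrightarrow> (\<forall>\<mu>\<in>envelope_family f.
      rate n (\<xi> n) (replicate_pmf n \<mu>) \<le> optimal_rate \<rho> d n (replicate_pmf n \<mu>)
        + redundancy_bound q (tail_bits q \<mu>) (letter_bits q \<mu>) (J n))"
    using universal_scheme[OF dist d q F] by (elim exE conjE) (rule that)
  have C: "letter_bits q \<mu> < \<infinity>" if "\<mu> \<in> envelope_family f" "shannon_entropy \<mu> < \<infinity>" for \<mu>
    by (rule le_less_trans[OF Z[OF that(1)]]) (use that(2) in simp)
  have sup: "set_pmf \<mu> \<subseteq> alphabet" if "\<mu> \<in> envelope_family f" for \<mu>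
    using that by (simp add: envelope_family_def)
  have evJ: "eventually (\<lambda>n. n \<ge> 1 \<and> J n \<ge> 1) sequentially"
    using eventually_ge_at_top[of 1] filterlim_at_top[THEN iffD1, OF J, rule_format, of 1]
    by eventually_elim simp
  have bounds: "0 \<le> redundancy \<rho> d n (\<xi> n) \<mu> \<and> redundancy \<rho> d n (\<xi> n) \<mu>
      \<le> enn2ereal (redundancy_bound q (tail_bits q \<mu>) (letter_bits q \<mu>) (J n))"
    if \<mu>: "\<mu> \<in> envelope_family f" "shannon_entropy \<mu> < \<infinity>" and n: "n \<ge> 1 \<and> J n \<ge> 1" for \<mu> n
  proof -
    have code: "semifaithful_code \<rho> d n (\<xi> n)" using \<xi> n by (simp add: semifaithful_scheme_def)
    have le: "rate n (\<xi> n) (replicate_pmf n \<mu>) \<le> optimal_rate \<rho> d n (replicate_pmf n \<mu>)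
        + redundancy_bound q (tail_bits q \<mu>) (letter_bits q \<mu>) (J n)"
      using rate n \<mu>(1) by blast
    show ?thesis
      using redundancy_sandwich[OF dist d conjunct1[OF n] q sup[OF \<mu>(1)] C[OF \<mu>] code le] by simp
  qed
  have lim: "(\<lambda>n. redundancy \<rho> d n (\<xi> n) \<mu>) \<longlonglongrightarrow> 0" if "\<mu> \<in> envelope_family f \<inter> finite_entropy_sources" for \<mu>
  proof -
    from that have \<mu>: "\<mu> \<in> envelope_family f" "shannon_entropy \<mu> < \<infinity>" by (auto simp: finite_entropy_sources_def)
    have "tail_bits q \<mu> 0 < \<infinity>" using tail_bits_le_letter_bits[of q \<mu> 0] C[OF \<mu>] by (rule le_less_trans)
    then have "tail_bits q \<mu> \<longlonglongrightarrow> 0" unfolding tail_bits_def by (rule tail_sum_tendsto_0)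
    then have "redundancy_bound q (tail_bits q \<mu>) (letter_bits q \<mu>) \<longlonglongrightarrow> 0"
      using C[OF \<mu>] by (rule redundancy_bound_tendsto_0)
    note lim = redundancy_bound_limit[OF J this]
    show ?thesis
    proof (rule tendsto_sandwich[OF _ _ tendsto_const lim])
      show "eventually (\<lambda>n. 0 \<le> redundancy \<rho> d n (\<xi> n) \<mu>) sequentially"
        using evJ by eventually_elim (use bounds[OF \<mu>] in blast)
      show "eventually (\<lambda>n. redundancy \<rho> d n (\<xi> n) \<mu>
          \<le> enn2ereal (redundancy_bound q (tail_bits q \<mu>) (letter_bits q \<mu>) (J n))) sequentially"
        using evJ by eventually_elim (use bounds[OF \<mu>] in blast)
    qed
  qed
  have unif: "(\<lambda>n. worst_redundancy \<rho> d n (\<xi> n) (envelope_family f)) \<longlonglongrightarrow> 0"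
    if H: "(SUP \<mu>\<in>envelope_family f. shannon_entropy \<mu>) < \<infinity>"
  proof (cases "envelope_family f = {}")
    case True
    then show ?thesis by (simp add: worst_redundancy_def)
  next
    case False
    then obtain \<mu>0 where \<mu>0: "\<mu>0 \<in> envelope_family f" by blast
    let ?H = "SUP \<mu>\<in>envelope_family f. shannon_entropy \<mu>"
    let ?T = "tail_sum (\<lambda>x. ennreal (f x) * ennreal (- log 2 (pmf q x)))"
    let ?C = "ennreal Z + ?H"
    have ent: "shannon_entropy \<mu> < \<infinity>" if "\<mu> \<in> envelope_family f" for \<mu>
      using SUP_upper[OF that, of shannon_entropy] H by (rule le_less_trans)
    have T: "?T \<longlonglongrightarrow> 0"
      using C ent by (intro uniform_tail_bits[OF f_nonneg F _ \<mu>0]) simp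
    have "?C < \<infinity>" using H by simp
    with T have "redundancy_bound q ?T ?C \<longlonglongrightarrow> 0" by (rule redundancy_bound_tendsto_0)
    note lim' = redundancy_bound_limit[OF J this]
    \<comment> \<open>A member enters the bound through its masses above \<open>j\<close>, which
      \<open>f\<close> dominates, and through its cross entropy, which the largest entropy bounds up
      to a constant.\<close>
    have le: "redundancy_bound q (tail_bits q \<mu>) (letter_bits q \<mu>) j \<le> redundancy_bound q ?T ?C j"
      if \<mu>: "\<mu> \<in> envelope_family f" for \<mu> j
      unfolding redundancy_bound_def
    proof (intro add_mono mult_left_mono order_refl)
      show "tail_bits q \<mu> j \<le> ?T j"
        unfolding tail_bits_def using \<mu>
        by (intro tail_sum_mono mult_right_mono ennreal_leI) (auto simp: envelope_family_def)
      show "letter_bits q \<mu> \<le> ?C"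
        using Z[OF \<mu>] add_left_mono[OF SUP_upper[OF \<mu>, of shannon_entropy], of "ennreal Z"] by (rule order_trans)
    qed simp
    have b: "0 \<le> redundancy \<rho> d n (\<xi> n) \<mu> \<and> redundancy \<rho> d n (\<xi> n) \<mu> \<le> enn2ereal (redundancy_bound q ?T ?C (J n))"
      if "\<mu> \<in> envelope_family f" "n \<ge> 1 \<and> J n \<ge> 1" for \<mu> n
      using bounds[OF that(1) ent[OF that(1)] that(2)] le[OF that(1), of "J n"]
      by (meson less_eq_ennreal.rep_eq order_trans)
    have w: "0 \<le> worst_redundancy \<rho> d n (\<xi> n) (envelope_family f) \<and>
        worst_redundancy \<rho> d n (\<xi> n) (envelope_family f) \<le> enn2ereal (redundancy_bound q ?T ?C (J n))"
      if n: "n \<ge> 1 \<and> J n \<ge> 1" for n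
    proof -
      let ?M = "{\<mu>\<in>envelope_family f. \<not> (rate n (\<xi> n) (replicate_pmf n \<mu>) = \<infinity> \<and>
                        optimal_rate \<rho> d n (replicate_pmf n \<mu>) = \<infinity>)}"
      show ?thesis
      proof (cases "?M = {}")
        case True
        then show ?thesis unfolding worst_redundancy_def Let_def by simp
      next
        case False
        then obtain \<mu>1 where \<mu>1: "\<mu>1 \<in> ?M" by blast
        have eq: "worst_redundancy \<rho> d n (\<xi> n) (envelope_family f) = (SUP \<mu>\<in>?M. redundancy \<rho> d n (\<xi> n) \<mu>)"
          unfolding worst_redundancy_def Let_def using False by (simp only: if_False)
        have "0 \<le> redundancy \<rho> d n (\<xi> n) \<mu>1" using b n \<mu>1 by blast
        also have "\<dots> \<le> (SUP \<mu>\<in>?M. redundancy \<rho> d n (\<xi> n) \<mu>)" using \<mu>1 by (rule SUP_upper)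
        finally show ?thesis unfolding eq using b n by (intro conjI SUP_least) blast+
      qed
    qed
    show ?thesis
    proof (rule tendsto_sandwich[OF _ _ tendsto_const lim'])
      show "eventually (\<lambda>n. 0 \<le> worst_redundancy \<rho> d n (\<xi> n) (envelope_family f)) sequentially"
        using evJ by eventually_elim (use w in blast)
      show "eventually (\<lambda>n. worst_redundancy \<rho> d n (\<xi> n) (envelope_family f)
          \<le> enn2ereal (redundancy_bound q ?T ?C (J n))) sequentially"
        using evJ by eventually_elim (use w in blast)
    qed
  qed
  show ?thesis using \<xi> lim unif by blast
qed

theorem theorem3:
  fixes f :: "nat \<Rightarrow> real" and \<rho> :: "nat \<Rightarrow> nat \<Rightarrow> real"
  assumes f_nonneg: "\<forall>x\<in>alphabet. f x \<ge> 0"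
    and dist: "distortion \<rho>"
    and unbounded: "unbounded_distortion \<rho>"
    and consistent: "euclidean_consistent \<rho>"
  shows
    "(\<not> (\<lambda>x. \<bar>f x\<bar>) summable_on alphabet \<longrightarrow>
        (\<forall>d>0. \<forall>\<xi>. semifaithful_scheme \<rho> d \<xi> \<longrightarrow>
          (\<forall>n\<ge>1. worst_redundancy \<rho> d n (\<xi> n) (envelope_family f) = \<infinity>)))
     \<and>
     ((\<lambda>x. \<bar>f x\<bar>) summable_on alphabet \<longrightarrow>
        (\<forall>d>0. \<exists>\<xi>. semifaithful_scheme \<rho> d \<xi> \<and>
          (\<forall>\<mu> \<in> envelope_family f \<inter> finite_entropy_sources.
             (\<lambda>n. redundancy \<rho> d n (\<xi> n) \<mu>) \<longlonglongrightarrow> 0)))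
     \<and>
     ((SUP \<mu>\<in>envelope_family f. shannon_entropy \<mu>) < \<infinity> \<longleftrightarrow>
        envelope_family f \<subseteq> finite_entropy_sources)
     \<and>
     ((SUP \<mu>\<in>envelope_family f. shannon_entropy \<mu>) < \<infinity> \<longrightarrow>
        (\<forall>d>0. \<exists>\<xi>. semifaithful_scheme \<rho> d \<xi> \<and>
          (\<forall>\<mu> \<in> envelope_family f \<inter> finite_entropy_sources.
             (\<lambda>n. redundancy \<rho> d n (\<xi> n) \<mu>) \<longlonglongrightarrow> 0) \<and>
          (\<lambda>n. worst_redundancy \<rho> d n (\<xi> n) (envelope_family f)) \<longlonglongrightarrow> 0))"
proof (intro conjI impI allI)
  fix d :: real and \<xi> and n :: nat
  assume "\<not> (\<lambda>x. \<bar>f x\<bar>) summable_on alphabet" "0 < d" "semifaithful_scheme \<rho> d \<xi>" "1 \<le> n"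
  then show "worst_redundancy \<rho> d n (\<xi> n) (envelope_family f) = \<infinity>"
    by (intro infinite_worst_redundancy[OF f_nonneg dist consistent]) (auto simp: semifaithful_scheme_def)
next
  fix d :: real
  assume s: "(\<lambda>x. \<bar>f x\<bar>) summable_on alphabet" and d: "0 < d"
  show "\<exists>\<xi>. semifaithful_scheme \<rho> d \<xi> \<and>
    (\<forall>\<mu> \<in> envelope_family f \<inter> finite_entropy_sources. (\<lambda>n. redundancy \<rho> d n (\<xi> n) \<mu>) \<longlonglongrightarrow> 0)"
    using envelope_universal_scheme[OF f_nonneg dist d s] by blast
next
  show "(SUP \<mu>\<in>envelope_family f. shannon_entropy \<mu>) < \<infinity> \<longleftrightarrow> envelope_family f \<subseteq> finite_entropy_sources"
    by (rule bounded_entropy_iff)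
next
  fix d :: real
  assume H: "(SUP \<mu>\<in>envelope_family f. shannon_entropy \<mu>) < \<infinity>" and d: "0 < d"
  \<comment> \<open>Bounded entropy forces summability, which makes the universal scheme
    available.\<close>
  have s: "(\<lambda>x. \<bar>f x\<bar>) summable_on alphabet" by (rule summable_if_bounded_entropy[OF f_nonneg H])
  show "\<exists>\<xi>. semifaithful_scheme \<rho> d \<xi> \<and>
    (\<forall>\<mu> \<in> envelope_family f \<inter> finite_entropy_sources. (\<lambda>n. redundancy \<rho> d n (\<xi> n) \<mu>) \<longlonglongrightarrow> 0) \<and>
    (\<lambda>n. worst_redundancy \<rho> d n (\<xi> n) (envelope_family f)) \<longlonglongrightarrow> 0"
    using envelope_universal_scheme[OF f_nonneg dist d s] H by blast
qed

end
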